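(* Let $h$ be the standard Riemannian metric on the unit sphere $\mathbb{S}^2=\{(x,y,z)\in\mathbb{R}^3: x^2+y^2+z^2=1\}$ and let $\mathbf{v}$ be the vector field on $\mathbb{S}^2$ given by $\mathbf{v}_p=(-y,x,0)$ at $p=(x,y,z)$. Let $\epsilon\in\mathbb{R}$ and let $U_\epsilon=\{p\in\mathbb{S}^2:\epsilon^2 h(\mathbf{v}_p,\mathbf{v}_p)<1\}$; thus $U_\epsilon=\mathbb{S}^2$ if $|\epsilon|<1$, and if $|\epsilon|\ge 1$ then $U_\epsilon$ is the union of the open metric disks of radius $\sin^{-1}(1/|\epsilon|)$ around the north pole and the south pole. Let $F=\alpha+\beta$ be the Randers metric on $U_\epsilon$ given, for a tangent vector $\mathbf{y}$, by $$\alpha(\mathbf{y})=\frac{\sqrt{\epsilon^2h(\mathbf{v},\mathbf{y})^2+h(\mathbf{y},\mathbf{y})\left(1-\epsilon^2h(\mathbf{v},\mathbf{v})\right)}}{1-\epsilon^2h(\mathbf{v},\mathbf{v})},\qquad \beta(\mathbf{y})=-\frac{\epsilon\,h(\mathbf{v},\mathbf{y})}{1-\epsilon^2h(\mathbf{v},\mathbf{v})}.$$ Then: (a) $F$ has constant curvature $\mathbf{K}=1$; (b) the S-curvature of $F$ vanishes, $\mathbf{S}=0$; (c) $F$ is not locally projectively flat unless $\epsilon=0$; (d) the Gauss curvature $\bar{\mathbf{K}}$ of the Riemannian metric $\alpha$ is not constant unless $\epsilon\in\{0,1,-1\}$; when $\epsilon=0$, $\bar{\mathbf{K}}=1$, and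 when $\epsilon=\pm1$, $\bar{\mathbf{K}}=-4$.
   Context: A Finsler metric on a manifold $M$ is a function $F:TM\to[0,\infty)$, smooth away from the zero section, positively homogeneous of degree one on each tangent space, such that in standard local coordinates $(x^i,y^i)$ of $TM$ the matrix $g_{ij}=\frac12[F^2]_{y^iy^j}$ is positive definite for $y\ne0$. A Randers metric is a Finsler metric $F=\alpha+\beta$, where $\alpha(\mathbf y)=\sqrt{a_{ij}(x)y^iy^j}$ is (the norm of) a Riemannian metric and $\beta(\mathbf y)=b_i(x)y^i$ is a 1-form with $\sup_{y\in T_xM\setminus\{0\}}\beta(y)/\alpha(y)<1$ at every $x$. With $(g^{ij})=(g_{ij})^{-1}$, the geodesic coefficients of $F$ are $$G^i=\tfrac14 g^{ik}\Big\{2\frac{\partial g_{pk}}{\partial x^q}-\frac{\partial g_{pq}}{\partial x^k}\Big\}y^py^q,$$ and geodesics satisfy $\frac{d^2x^i}{dt^2}+2G^i(x,\frac{dx}{dt})=0$. The Riemann curvature is $\mathbf{R}_{\mathbf y}=R^i_{\ k}\,dx^k\otimes\frac{\partial}{\partial x^i}$ with $$R^i_{\ k}=2\frac{\partial G^i}{\partial x^k}-y^j\frac{\partial^2G^i}{\partial x^j\partial y^k}+2G^j\frac{\partial^2G^i}{\partial y^j\partial y^k}-\frac{\partial G^i}{\partial y^j}\frac{\partial G^j}{\partial y^k}.$$ $F$ has constant (flag) curvature $\mathbf{K}=\lambda$ if $R^i_{\ k}=\lambda\{F^2\delta^i_k-FF_{y^k}y^i\}$. The Busemann–Hausdorff volume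 form of $F$ on an $n$-manifold is $dV_F=\sigma(x)\,dx^1\cdots dx^n$, where $\sigma(x)=\mathrm{Vol}(B^n(1))/\mathrm{Vol}\{(y^i)\in\mathbb{R}^n:F(x,y)<1\}$, with $\mathrm{Vol}$ Euclidean volume and $B^n(1)$ the Euclidean unit ball. The S-curvature is $$\mathbf{S}(\mathbf y)=\frac{\partial G^i}{\partial y^i}(x,y)-\frac{y^i}{\sigma(x)}\frac{\partial\sigma}{\partial x^i}(x).$$ $F$ is locally projectively flat if around every point there is a local coordinate system in which the geodesics of $F$ are straight lines as point sets, equivalently in which $G^i=Py^i$ for some scalar function $P(x,y)$. *)

theory Defs
  imports "HOL-Analysis.Analysis"
begin

section \<open>Smooth maps and local coordinate systems\<close>

text \<open>The class C^k on an open set; as the domain is finite-dimensional, it suffices to ask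
  that all directional derivatives are again of class C^(k-1).\<close>

primrec Ck_on :: "nat \<Rightarrow> 'a::euclidean_space set \<Rightarrow> ('a \<Rightarrow> 'b::real_normed_vector) \<Rightarrow> bool" where
  "Ck_on 0 S f \<longleftrightarrow> continuous_on S f"
| "Ck_on (Suc k) S f \<longleftrightarrow>
     (\<forall>x\<in>S. f differentiable (at x)) \<and> (\<forall>v. Ck_on k S (\<lambda>x. frechet_derivative f (at x) v))"

definition smooth_on :: "'a::euclidean_space set \<Rightarrow> ('a \<Rightarrow> 'b::real_normed_vector) \<Rightarrow> bool" where
  "smooth_on S f \<longleftrightarrow> (\<forall>k. Ck_on k S f)"

text \<open>Manifolds are embedded submanifolds \<^term>\<open>M\<close> of some \<open>\<real>\<^sup>m\<close>, each with its full smooth structure: the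
  local coordinate systems are all smooth regular parametrizations \<open>\<phi> : V \<rightarrow> M\<close> of relatively
  open pieces of \<open>M\<close>. The coordinates of the point \<open>\<phi> x\<close> are \<open>x\<close>, and the tangent vector with
  components \<open>y\<close> at that point is \<open>D\<phi>(x) y\<close>.\<close>

definition local_coords ::
    "(real^'m) set \<Rightarrow> (real^'n) set \<Rightarrow> (real^'n \<Rightarrow> real^'m) \<Rightarrow> bool" where
  "local_coords M V \<phi> \<longleftrightarrow>
     open V \<and> smooth_on V \<phi> \<and> (\<forall>x\<in>V. inj (frechet_derivative \<phi> (at x))) \<and>
     \<phi> ` V \<subseteq> M \<and> openin (top_of_set M) (\<phi> ` V) \<and> (\<exists>\<psi>. homeomorphism V (\<phi> ` V) \<phi> \<psi>)"

text \<open>A function on the tangent bundle of \<open>M\<close> is given as \<open>F p y\<close> with \<open>p \<in> M\<close>, \<open>y\<close> tangent to \<open>M\<close>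
  at \<open>p\<close> (values at other arguments are irrelevant). Its expression in coordinates:\<close>

definition in_coords ::
    "(real^'m \<Rightarrow> real^'m \<Rightarrow> real) \<Rightarrow> (real^'n \<Rightarrow> real^'m) \<Rightarrow> real^'n \<Rightarrow> real^'n \<Rightarrow> real" where
  "in_coords F \<phi> x y = F (\<phi> x) (frechet_derivative \<phi> (at x) y)"


section \<open>Finsler geometry in local coordinates\<close>

text \<open>\<open>\<partial>f/\<partial>x^i\<close> for a function of one vector variable; \<open>\<partial>/\<partial>x^i\<close> and \<open>\<partial>/\<partial>y^i\<close> for functions of \<open>(x, y)\<close>.\<close>

definition pd :: "'n \<Rightarrow> (real^'n \<Rightarrow> real) \<Rightarrow> real^'n \<Rightarrow> real" where
  "pd i f x = deriv (\<lambda>t. f (x + t *\<^sub>R axis i 1)) 0"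

definition pdx :: "'n \<Rightarrow> (real^'n \<Rightarrow> real^'n \<Rightarrow> real) \<Rightarrow> real^'n \<Rightarrow> real^'n \<Rightarrow> real" where
  "pdx i f x y = pd i (\<lambda>x'. f x' y) x"

definition pdy :: "'n \<Rightarrow> (real^'n \<Rightarrow> real^'n \<Rightarrow> real) \<Rightarrow> real^'n \<Rightarrow> real^'n \<Rightarrow> real" where
  "pdy i f x y = pd i (f x) y"

definition fundamental_tensor ::
    "(real^'n \<Rightarrow> real^'n \<Rightarrow> real) \<Rightarrow> real^'n \<Rightarrow> real^'n \<Rightarrow> real^'n^'n" where
  "fundamental_tensor F x y = (\<chi> i j. 1/2 * pdy j (pdy i (\<lambda>x y. (F x y)\<^sup>2)) x y)"

definition geodesic_coeff ::
    "(real^'n \<Rightarrow> real^'n \<Rightarrow> real) \<Rightarrow> 'n::finite \<Rightarrow> real^'n \<Rightarrow> real^'n \<Rightarrow> real" where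
  "geodesic_coeff F i x y =
     (let g = (\<lambda>i j x y. fundamental_tensor F x y $ i $ j);
          ginv = matrix_inv (fundamental_tensor F x y)
      in 1/4 * (\<Sum>k\<in>UNIV. \<Sum>p\<in>UNIV. \<Sum>q\<in>UNIV.
           ginv $ i $ k * (2 * pdx q (g p k) x y - pdx k (g p q) x y) * y $ p * y $ q))"

definition riemann_curvature ::
    "(real^'n \<Rightarrow> real^'n \<Rightarrow> real) \<Rightarrow> 'n::finite \<Rightarrow> 'n \<Rightarrow> real^'n \<Rightarrow> real^'n \<Rightarrow> real" where
  "riemann_curvature F i k x y =
     (let G = geodesic_coeff F
      in 2 * pdx k (G i) x y
         - (\<Sum>j\<in>UNIV. y $ j * pdx j (pdy k (G i)) x y)
         + 2 * (\<Sum>j\<in>UNIV. G j x y * pdy j (pdy k (G i)) x y)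
         - (\<Sum>j\<in>UNIV. pdy j (G i) x y * pdy k (G j) x y))"

text \<open>The Busemann--Hausdorff density.\<close>

definition BH_density :: "(real^'n \<Rightarrow> real^'n \<Rightarrow> real) \<Rightarrow> real^'n \<Rightarrow> real" where
  "BH_density F x = measure lebesgue (ball (0::real^'n) 1) / measure lebesgue {y. F x y < 1}"

definition S_curvature ::
    "(real^'n \<Rightarrow> real^'n \<Rightarrow> real) \<Rightarrow> real^'n \<Rightarrow> real^'n::finite \<Rightarrow> real" where
  "S_curvature F x y =
     (\<Sum>i\<in>UNIV. pdy i (geodesic_coeff F i) x y)
     - (\<Sum>i\<in>UNIV. y $ i / BH_density F x * pd i (BH_density F) x)"


section \<open>Riemannian metrics in local coordinates\<close>

text \<open>The coefficients \<open>a\<^sub>i\<^sub>j(x)\<close> of a Riemannian metric, recovered by polarization from its norm \<open>\<alpha>\<close>.\<close>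

definition metric_coeff :: "(real^'n \<Rightarrow> real^'n \<Rightarrow> real) \<Rightarrow> real^'n \<Rightarrow> real^'n^'n" where
  "metric_coeff \<alpha> x =
     (\<chi> i j. ((\<alpha> x (axis i 1 + axis j 1))\<^sup>2 - (\<alpha> x (axis i 1))\<^sup>2 - (\<alpha> x (axis j 1))\<^sup>2) / 2)"

text \<open>\<open>christoffel a k i j\<close> is \<open>\<Gamma>^k\<^sub>i\<^sub>j\<close>.\<close>

definition christoffel ::
    "(real^'n \<Rightarrow> real^'n^'n) \<Rightarrow> 'n::finite \<Rightarrow> 'n \<Rightarrow> 'n \<Rightarrow> real^'n \<Rightarrow> real" where
  "christoffel a k i j x =
     1/2 * (\<Sum>l\<in>UNIV. matrix_inv (a x) $ k $ l *
       (pd i (\<lambda>x. a x $ j $ l) x + pd j (\<lambda>x. a x $ i $ l) x - pd l (\<lambda>x. a x $ i $ j) x))"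

text \<open>The component \<open>R^l\<^sub>k\<^sub>i\<^sub>j\<close> of the curvature tensor, i.e. the coefficient at \<open>\<partial>\<^sub>l\<close> of
  \<open>\<nabla>\<^sub>i \<nabla>\<^sub>j \<partial>\<^sub>k - \<nabla>\<^sub>j \<nabla>\<^sub>i \<partial>\<^sub>k\<close>.\<close>

definition curvature_tensor ::
    "(real^'n \<Rightarrow> real^'n^'n) \<Rightarrow> 'n::finite \<Rightarrow> 'n \<Rightarrow> 'n \<Rightarrow> 'n \<Rightarrow> real^'n \<Rightarrow> real" where
  "curvature_tensor a l k i j x =
     pd i (christoffel a l j k) x - pd j (christoffel a l i k) x
     + (\<Sum>m\<in>UNIV. christoffel a l i m x * christoffel a m j k x
                   - christoffel a l j m x * christoffel a m i k x)"

text \<open>\<open>K = \<langle>R(\<partial>\<^sub>1, \<partial>\<^sub>2)\<partial>\<^sub>2, \<partial>\<^sub>1\<rangle> / det (a\<^sub>i\<^sub>j)\<close>.\<close>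

definition gauss_in_coords :: "(real^2 \<Rightarrow> real^2 \<Rightarrow> real) \<Rightarrow> real^2 \<Rightarrow> real" where
  "gauss_in_coords \<alpha> x =
     (let a = metric_coeff \<alpha>
      in (\<Sum>l\<in>UNIV. curvature_tensor a l 2 1 2 x * a x $ l $ 1) / det (a x))"


section \<open>Randers metrics on surfaces in \<open>\<real>\<^sup>3\<close>\<close>

definition finsler_metric :: "(real^3) set \<Rightarrow> (real^3 \<Rightarrow> real^3 \<Rightarrow> real) \<Rightarrow> bool" where
  "finsler_metric M F \<longleftrightarrow> (\<forall>(V::(real^2) set) \<phi>. local_coords M V \<phi> \<longrightarrow>
     (let f = in_coords F \<phi> in
       (\<forall>x\<in>V. \<forall>y. f x y \<ge> 0) \<and>
       smooth_on (V \<times> (- {0})) (\<lambda>(x, y). f x y) \<and>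
       (\<forall>x\<in>V. \<forall>y. \<forall>c>0. f x (c *\<^sub>R y) = c * f x y) \<and>
       (\<forall>x\<in>V. \<forall>y. y \<noteq> 0 \<longrightarrow> (\<forall>u. u \<noteq> 0 \<longrightarrow> u \<bullet> (fundamental_tensor f x y *v u) > 0))))"

definition riemannian_norm :: "(real^3) set \<Rightarrow> (real^3 \<Rightarrow> real^3 \<Rightarrow> real) \<Rightarrow> bool" where
  "riemannian_norm M \<alpha> \<longleftrightarrow> (\<forall>(V::(real^2) set) \<phi>. local_coords M V \<phi> \<longrightarrow>
     (let f = in_coords \<alpha> \<phi>; a = metric_coeff f in
       smooth_on V a \<and>
       (\<forall>x\<in>V. \<forall>u. u \<noteq> 0 \<longrightarrow> u \<bullet> (a x *v u) > 0) \<and>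
       (\<forall>x\<in>V. \<forall>y. f x y = sqrt (y \<bullet> (a x *v y)))))"

definition one_form :: "(real^3) set \<Rightarrow> (real^3 \<Rightarrow> real^3 \<Rightarrow> real) \<Rightarrow> bool" where
  "one_form M \<beta> \<longleftrightarrow> (\<forall>(V::(real^2) set) \<phi>. local_coords M V \<phi> \<longrightarrow>
     (\<exists>b::real^2 \<Rightarrow> real^2. smooth_on V b \<and> (\<forall>x\<in>V. \<forall>y. in_coords \<beta> \<phi> x y = b x \<bullet> y)))"

text \<open>The supremum is taken in the extended reals, so that it is always meaningful.\<close>

definition randers_metric ::
    "(real^3) set \<Rightarrow> (real^3 \<Rightarrow> real^3 \<Rightarrow> real) \<Rightarrow> (real^3 \<Rightarrow> real^3 \<Rightarrow> real) \<Rightarrow> bool" where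
  "randers_metric M \<alpha> \<beta> \<longleftrightarrow>
     finsler_metric M (\<lambda>p y. \<alpha> p y + \<beta> p y) \<and> riemannian_norm M \<alpha> \<and> one_form M \<beta> \<and>
     (\<forall>(V::(real^2) set) \<phi>. local_coords M V \<phi> \<longrightarrow>
        (\<forall>x\<in>V. (SUP y\<in>-{0}. ereal (in_coords \<beta> \<phi> x y / in_coords \<alpha> \<phi> x y)) < 1))"

definition constant_flag_curvature ::
    "(real^3) set \<Rightarrow> (real^3 \<Rightarrow> real^3 \<Rightarrow> real) \<Rightarrow> real \<Rightarrow> bool" where
  "constant_flag_curvature M F c \<longleftrightarrow> (\<forall>(V::(real^2) set) \<phi>. local_coords M V \<phi> \<longrightarrow>
     (let f = in_coords F \<phi> in
       \<forall>x\<in>V. \<forall>y. y \<noteq> 0 \<longrightarrow> (\<forall>i k. riemann_curvature f i k x y =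
         c * ((f x y)\<^sup>2 * (if i = k then 1 else 0) - f x y * pdy k f x y * y $ i))))"

definition vanishing_S_curvature ::
    "(real^3) set \<Rightarrow> (real^3 \<Rightarrow> real^3 \<Rightarrow> real) \<Rightarrow> bool" where
  "vanishing_S_curvature M F \<longleftrightarrow> (\<forall>(V::(real^2) set) \<phi>. local_coords M V \<phi> \<longrightarrow>
     (\<forall>x\<in>V. \<forall>y. y \<noteq> 0 \<longrightarrow> S_curvature (in_coords F \<phi>) x y = 0))"

text \<open>Straightness of the geodesics is expressed by \<open>G^i = P y^i\<close>: the geodesic equation
  \<open>x'' + 2 G(x, x') = 0\<close> then makes \<open>x''\<close> proportional to \<open>x'\<close>.\<close>

definition locally_projectively_flat ::
    "(real^3) set \<Rightarrow> (real^3 \<Rightarrow> real^3 \<Rightarrow> real) \<Rightarrow> bool" where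
  "locally_projectively_flat M F \<longleftrightarrow>
     (\<forall>p\<in>M. \<exists>(V::(real^2) set) \<phi>. local_coords M V \<phi> \<and> p \<in> \<phi> ` V \<and>
       (\<exists>P::real^2 \<Rightarrow> real^2 \<Rightarrow> real. \<forall>x\<in>V. \<forall>y. y \<noteq> 0 \<longrightarrow>
          (\<forall>i. geodesic_coeff (in_coords F \<phi>) i x y = P x y * y $ i)))"

text \<open>The common value of the coordinate expressions in all coordinate systems around \<open>p\<close>.\<close>

definition gauss_curvature ::
    "(real^3) set \<Rightarrow> (real^3 \<Rightarrow> real^3 \<Rightarrow> real) \<Rightarrow> real^3 \<Rightarrow> real" where
  "gauss_curvature M \<alpha> p =
     (THE K. \<forall>(V::(real^2) set) \<phi> x. local_coords M V \<phi> \<longrightarrow> x \<in> V \<longrightarrow> \<phi> x = p \<longrightarrow>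
        gauss_in_coords (in_coords \<alpha> \<phi>) x = K)"


section \<open>The metrics on the sphere\<close>

text \<open>The standard metric \<open>h\<close> of the sphere is the restriction of the inner product of \<open>\<real>\<^sup>3\<close>.\<close>

definition vf :: "real^3 \<Rightarrow> real^3" where
  "vf p = vector [- (p $ 2), p $ 1, 0]"

definition U_eps :: "real \<Rightarrow> (real^3) set" where
  "U_eps \<epsilon> = {p \<in> sphere 0 1. \<epsilon>\<^sup>2 * (vf p \<bullet> vf p) < 1}"

definition alpha :: "real \<Rightarrow> real^3 \<Rightarrow> real^3 \<Rightarrow> real" where
  "alpha \<epsilon> p y =
     sqrt (\<epsilon>\<^sup>2 * (vf p \<bullet> y)\<^sup>2 + (y \<bullet> y) * (1 - \<epsilon>\<^sup>2 * (vf p \<bullet> vf p))) / (1 - \<epsilon>\<^sup>2 * (vf p \<bullet> vf p))"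

definition beta :: "real \<Rightarrow> real^3 \<Rightarrow> real^3 \<Rightarrow> real" where
  "beta \<epsilon> p y = - (\<epsilon> * (vf p \<bullet> y) / (1 - \<epsilon>\<^sup>2 * (vf p \<bullet> vf p)))"

definition F_eps :: "real \<Rightarrow> real^3 \<Rightarrow> real^3 \<Rightarrow> real" where
  "F_eps \<epsilon> p y = alpha \<epsilon> p y + beta \<epsilon> p y"

text \<open>\<open>arccos (c \<bullet> p)\<close> is the Riemannian distance of \<open>c\<close> and \<open>p\<close> on the unit sphere.\<close>

definition sphere_disk :: "real^3 \<Rightarrow> real \<Rightarrow> (real^3) set" where
  "sphere_disk c r = {p \<in> sphere 0 1. arccos (c \<bullet> p) < r}"

end

theory Submission
  imports Defs
begin

text \<open>The metric solves Zermelo's navigation problem: \<open>F\<close> is determined by \<open>|y - F W| = F\<close> with the wind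
  \<open>W = \<epsilon>v\<close>. In a chart \<open>\<phi>\<close> all derivatives of \<open>F\<close> are obtained from this implicit equation, and the
  geodesic coefficients become explicit after applying \<open>d\<phi>\<close>: they are \<open>-\<epsilon>F Jy + F\<^sup>2(p + \<epsilon>\<^sup>2J\<^sup>2p)/2 + d\<^sup>2\<phi>(y, y)/2\<close>,
  where \<open>J\<close> is the skew matrix with \<open>v = Jp\<close>. Differentiating once more gives the curvature and the
  divergence of the spray, and the latter is the logarithmic derivative of the Busemann--Hausdorff density,
  because the unit ball of \<open>F\<close> is a translate of that of \<open>h\<close>. At a pole the geodesic coefficients at
  \<open>y\<close> and \<open>-y\<close> differ by a multiple of \<open>\<epsilon> Jy\<close>, which is orthogonal to \<open>y\<close>; this excludes projective
  flatness. The Gauss curvature of \<open>\<alpha>\<close> comes from Cartan's structure equations for a frame adapted to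
  the rotational symmetry.\<close>

section \<open>Calculus of smooth maps\<close>

text \<open>Origin of the spray: since v is a Killing field, a unit-speed geodesic of
  \<open>F\<close> should be a great circle c carried along by the rotations, \<gamma>(t) = exp(t
  \<epsilon> J) c(t). Two differentiations with c'' = -c give \<gamma>'' = 2 \<epsilon> J \<gamma>'
  - (\<gamma> + \<epsilon>^2 J^2 \<gamma>). Homogenizing with \<open>F\<close> and inserting
  \<gamma>'' = d^2\<phi>(y, y) - 2 d\<phi>(G) yields the formula. This is only its source; what is
  checked is that the candidate satisfies the Euler-Lagrange equations, from which the defining
  formula of the coefficients follows. The obstacle is that every notion is quantified over all
  charts and written with iterated coordinate derivatives. No convenient coordinates are chosen: in
  an arbitrary chart each coordinate vector is sent to \<real>^3 by the injective \<open>d1\<close>,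
  where J is a constant skew matrix and the chart shows up only through its second and third
  derivatives. These cancel by their symmetry, which is why mixed derivatives are treated first.
  Unknown derivatives are read off by differentiating identities that hold on an open set.\<close>

lemma Ck_on_cong:
  assumes "open S" "\<And>x. x \<in> S \<Longrightarrow> f x = g x" "Ck_on k S f"
  shows "Ck_on k S g"
  using assms(2,3)
proof (induction k arbitrary: f g)
  case 0
  then show ?case by (simp cong: continuous_on_cong)
next
  case (Suc k)
  have d: "f differentiable (at x)" if "x \<in> S" for x using Suc.prems that by simp
  have 1: "g differentiable (at x)" if "x \<in> S" for x
    using d[OF that] Suc.prems(1) assms(1) that
    unfolding differentiable_def by (meson has_derivative_transform_within_open)
  have 2: "frechet_derivative f (at x) = frechet_derivative g (at x)" if "x \<in> S" for x
    using frechet_derivative_transform_within_open[OF d[OF that] assms(1) that Suc.prems(1)] by simp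
  have "Ck_on k S (\<lambda>x. frechet_derivative g (at x) v)" for v
    using Suc.IH[of "\<lambda>x. frechet_derivative f (at x) v"] Suc.prems(2) 2 by simp
  then show ?case using 1 by simp
qed

text \<open>Lets the inductions on \<open>k\<close> use a derivative found by differentiation rules
  in place of \<open>frechet_derivative\<close>; the two agree on the open set \<open>S\<close>, and
  \<open>Ck_on_cong\<close> transfers the regularity.\<close>

lemma Ck_on_SucI:
  assumes "open S" "\<And>x. x \<in> S \<Longrightarrow> (f has_derivative f' x) (at x)"
    "\<And>v. Ck_on k S (\<lambda>x. f' x v)"
  shows "Ck_on (Suc k) S f"
proof -
  have "Ck_on k S (\<lambda>x. frechet_derivative f (at x) v)" for v
    by (rule Ck_on_cong[OF assms(1) _ assms(3)[of v]]) (use frechet_derivative_at[OF assms(2)] in metis)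
  then show ?thesis using assms(2) by (auto simp: differentiable_def)
qed

lemma Ck_on_Suc_derivative:
  assumes "Ck_on (Suc k) S f" "x \<in> S"
  shows "(f has_derivative frechet_derivative f (at x)) (at x)"
  using assms frechet_derivative_works by auto

lemma Ck_on_SucD: "Ck_on (Suc k) S f \<Longrightarrow> Ck_on k S f"
proof (induction k arbitrary: f)
  case 0
  then show ?case
    by (auto intro!: continuous_at_imp_continuous_on differentiable_imp_continuous_within)
next
  case (Suc k)
  then show ?case by (metis Ck_on.simps(2))
qed

lemma Ck_on_const: "Ck_on k S (\<lambda>x. c)"
proof (induction k arbitrary: c)
  case (Suc k)
  then show ?case by (simp add: frechet_derivative_const)
qed simp

lemma Ck_on_add:
  assumes "open S"
  shows "Ck_on k S f \<Longrightarrow> Ck_on k S g \<Longrightarrow> Ck_on k S (\<lambda>x. f x + g x)"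
proof (induction k arbitrary: f g)
  case (Suc k)
  show ?case
    by (rule Ck_on_SucI[OF assms, where f' = "\<lambda>x v. frechet_derivative f (at x) v + frechet_derivative g (at x) v"])
      (use Suc in \<open>auto intro!: has_derivative_add simp: frechet_derivative_works\<close>)
qed (simp add: continuous_on_add)

lemma Ck_on_bounded_linear:
  assumes "open S" "bounded_linear L"
  shows "Ck_on k S f \<Longrightarrow> Ck_on k S (\<lambda>x. L (f x))"
proof (induction k arbitrary: f)
  case 0
  then show ?case using bounded_linear.continuous_on[OF assms(2)] by simp
next
  case (Suc k)
  show ?case
    by (rule Ck_on_SucI[OF assms(1), where f' = "\<lambda>x v. L (frechet_derivative f (at x) v)"])
      (use Suc in \<open>auto intro!: bounded_linear.has_derivative[OF assms(2)] simp: frechet_derivative_works\<close>)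
qed

lemma Ck_on_bilinear:
  assumes "open S" "bounded_bilinear B"
  shows "Ck_on k S f \<Longrightarrow> Ck_on k S g \<Longrightarrow> Ck_on k S (\<lambda>x. B (f x) (g x))"
proof (induction k arbitrary: f g)
  case 0
  then show ?case using bounded_bilinear.continuous_on[OF assms(2)] by simp
next
  case (Suc k)
  show ?case
  proof (rule Ck_on_SucI[OF assms(1)])
    show "((\<lambda>x. B (f x) (g x)) has_derivative
        (\<lambda>v. B (f x) (frechet_derivative g (at x) v) + B (frechet_derivative f (at x) v) (g x))) (at x)"
      if "x \<in> S" for x
      using Suc.prems that by (auto intro!: bounded_bilinear.FDERIV[OF assms(2)] Ck_on_Suc_derivative)
    show "Ck_on k S (\<lambda>x. B (f x) (frechet_derivative g (at x) v) + B (frechet_derivative f (at x) v) (g x))" for v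
      using Suc Ck_on_SucD[OF Suc.prems(1)] Ck_on_SucD[OF Suc.prems(2)]
      by (intro Ck_on_add assms(1) Suc.IH) auto
  qed
qed

lemma Ck_on_linear:
  assumes "open S" "bounded_linear L"
  shows "Ck_on k S L"
proof (cases k)
  case 0
  then show ?thesis using bounded_linear.continuous_on[OF assms(2)] continuous_on_id by fastforce
next
  case (Suc m)
  show ?thesis unfolding Suc
    by (rule Ck_on_SucI[OF assms(1)]) (auto intro: bounded_linear_imp_has_derivative assms Ck_on_const)
qed

lemma Ck_on_sum:
  assumes "open S" "\<And>i. i \<in> I \<Longrightarrow> Ck_on k S (f i)"
  shows "Ck_on k S (\<lambda>x. \<Sum>i\<in>I. f i x)"
  using assms(2) by (induction I rule: infinite_finite_induct) (auto intro!: Ck_on_const Ck_on_add assms(1))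

lemma linear_euclidean_sum:
  fixes L :: "'a::euclidean_space \<Rightarrow> 'b::real_vector"
  assumes "linear L"
  shows "L u = (\<Sum>b\<in>Basis. (u \<bullet> b) *\<^sub>R L b)"
proof -
  have "L u = L (\<Sum>b\<in>Basis. (u \<bullet> b) *\<^sub>R b)" by (simp add: euclidean_representation)
  also have "\<dots> = (\<Sum>b\<in>Basis. (u \<bullet> b) *\<^sub>R L b)"
    using assms by (simp add: linear_sum linear_scale)
  finally show ?thesis .
qed

text \<open>\<open>Ck_on\<close> speaks of derivatives in a fixed direction, but in the chain rule
  the direction \<open>frechet_derivative g (at x) v\<close> moves with \<open>x\<close>. Expanding
  it in the basis leaves scalar coefficients times derivatives of \<open>f\<close> in fixed
  directions, to which the induction hypothesis applies.\<close>

lemma Ck_on_compose: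
  fixes g :: "'a::euclidean_space \<Rightarrow> 'b::euclidean_space"
  assumes "open S" "g ` S \<subseteq> T" "Ck_on k S g"
  shows "Ck_on k T f \<Longrightarrow> Ck_on k S (\<lambda>x. f (g x))"
  using assms(3)
proof (induction k arbitrary: f)
  case 0
  then show ?case using assms(2) by (auto intro: continuous_on_compose2)
next
  case (Suc k)
  have D: "(f has_derivative frechet_derivative f (at (g x))) (at (g x))" if "x \<in> S" for x
    using Ck_on_Suc_derivative[OF Suc.prems(1)] assms(2) that by auto
  show ?case
  proof (rule Ck_on_SucI[OF assms(1)])
    show "((\<lambda>x. f (g x)) has_derivative
        (\<lambda>v. \<Sum>b\<in>Basis. (frechet_derivative g (at x) v \<bullet> b) *\<^sub>R frechet_derivative f (at (g x)) b)) (at x)"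
      if "x \<in> S" for x
      using has_derivative_compose[OF Ck_on_Suc_derivative[OF Suc.prems(2) that] D[OF that]]
      by (simp add: linear_euclidean_sum[OF has_derivative_linear[OF D[OF that]], symmetric])
    show "Ck_on k S (\<lambda>x. \<Sum>b\<in>Basis. (frechet_derivative g (at x) v \<bullet> b) *\<^sub>R frechet_derivative f (at (g x)) b)" for v
      using Suc Ck_on_SucD[OF Suc.prems(2)]
      by (intro Ck_on_sum assms(1) Ck_on_bilinear[OF assms(1) bounded_bilinear_scaleR]
          Ck_on_bounded_linear[OF assms(1) bounded_linear_inner_left] Suc.IH) auto
  qed
qed

lemma Ck_on_inverse: "Ck_on k (- {0::real}) inverse"
proof (induction k)
  case 0
  then show ?case by (auto intro!: continuous_intros)
next
  case (Suc k)
  have o: "open (- {0::real})" by auto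
  show ?case
  proof (rule Ck_on_SucI[OF o])
    show "(inverse has_derivative (\<lambda>v. (- v) *\<^sub>R (inverse x * inverse x))) (at x)" if "x \<in> - {0::real}" for x :: real
      using that by (auto intro!: derivative_eq_intros simp: algebra_simps)
    show "Ck_on k (- {0}) (\<lambda>x::real. (- v) *\<^sub>R (inverse x * inverse x))" for v
      by (intro Ck_on_bounded_linear[OF o bounded_linear_scaleR_right]
          Ck_on_bilinear[OF o bounded_bilinear_mult] Suc)
  qed
qed

text \<open>The derivative is a multiple of \<open>inverse (sqrt x)\<close>, so the step composes
  the induction hypothesis with \<open>Ck_on_inverse\<close>.\<close>

lemma Ck_on_sqrt: "Ck_on k {0<..} sqrt"
proof (induction k)
  case 0
  then show ?case by (auto intro!: continuous_intros)
next
  case (Suc k)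
  have o: "open {0::real<..}" by auto
  show ?case
  proof (rule Ck_on_SucI[OF o])
    show "(sqrt has_derivative (\<lambda>v. (v / 2) *\<^sub>R inverse (sqrt x))) (at x)" if "x \<in> {0<..}" for x
      using that by (auto intro!: derivative_eq_intros simp: field_simps)
    show "Ck_on k {0<..} (\<lambda>x. (v / 2) *\<^sub>R inverse (sqrt x))" for v
      by (intro Ck_on_bounded_linear[OF o bounded_linear_scaleR_right]
          Ck_on_compose[OF o _ Suc Ck_on_inverse]) auto
  qed
qed

lemma smooth_on_cong:
  "open S \<Longrightarrow> (\<And>x. x \<in> S \<Longrightarrow> f x = g x) \<Longrightarrow> smooth_on S f \<Longrightarrow> smooth_on S g"
  unfolding smooth_on_def using Ck_on_cong by blast

lemma smooth_on_const: "smooth_on S (\<lambda>x. c)"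
  by (simp add: smooth_on_def Ck_on_const)

lemma smooth_on_add:
  "open S \<Longrightarrow> smooth_on S f \<Longrightarrow> smooth_on S g \<Longrightarrow> smooth_on S (\<lambda>x. f x + g x)"
  by (simp add: smooth_on_def Ck_on_add)

lemma smooth_on_bounded_linear:
  "open S \<Longrightarrow> bounded_linear L \<Longrightarrow> smooth_on S f \<Longrightarrow> smooth_on S (\<lambda>x. L (f x))"
  by (simp add: smooth_on_def Ck_on_bounded_linear)

lemma smooth_on_linear: "open S \<Longrightarrow> bounded_linear L \<Longrightarrow> smooth_on S L"
  by (simp add: smooth_on_def Ck_on_linear)

lemma smooth_on_bilinear:
  "open S \<Longrightarrow> bounded_bilinear B \<Longrightarrow> smooth_on S f \<Longrightarrow> smooth_on S g \<Longrightarrow> smooth_on S (\<lambda>x. B (f x) (g x))"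
  by (simp add: smooth_on_def Ck_on_bilinear)

lemmas smooth_on_scaleR = smooth_on_bilinear[OF _ bounded_bilinear_scaleR]
lemmas smooth_on_mult = smooth_on_bilinear[OF _ bounded_bilinear_mult]
lemmas smooth_on_inner = smooth_on_bilinear[OF _ bounded_bilinear_inner]

lemma smooth_on_minus:
  fixes f :: "'a::euclidean_space \<Rightarrow> 'b::real_normed_vector"
  shows "open S \<Longrightarrow> smooth_on S f \<Longrightarrow> smooth_on S (\<lambda>x. - f x)"
  using smooth_on_bounded_linear[OF _ bounded_linear_minus[OF bounded_linear_ident]] .

lemma smooth_on_diff:
  fixes f :: "'a::euclidean_space \<Rightarrow> 'b::real_normed_vector"
  shows "open S \<Longrightarrow> smooth_on S f \<Longrightarrow> smooth_on S g \<Longrightarrow> smooth_on S (\<lambda>x. f x - g x)"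
  using smooth_on_add[OF _ _ smooth_on_minus] by fastforce

lemma smooth_on_power2:
  fixes f :: "'a::euclidean_space \<Rightarrow> real"
  shows "open S \<Longrightarrow> smooth_on S f \<Longrightarrow> smooth_on S (\<lambda>x. (f x)\<^sup>2)"
  unfolding power2_eq_square by (intro smooth_on_mult)

lemma smooth_on_sum:
  "open S \<Longrightarrow> (\<And>i. i \<in> I \<Longrightarrow> smooth_on S (f i)) \<Longrightarrow> smooth_on S (\<lambda>x. \<Sum>i\<in>I. f i x)"
  by (simp add: smooth_on_def Ck_on_sum)

lemma smooth_on_compose:
  fixes g :: "'a::euclidean_space \<Rightarrow> 'b::euclidean_space"
  shows "open S \<Longrightarrow> g ` S \<subseteq> T \<Longrightarrow> smooth_on S g \<Longrightarrow> smooth_on T f \<Longrightarrow> smooth_on S (\<lambda>x. f (g x))"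
  unfolding smooth_on_def by (auto intro: Ck_on_compose[where T = T and g = g])

lemma smooth_on_subset: "open S \<Longrightarrow> S \<subseteq> T \<Longrightarrow> smooth_on T f \<Longrightarrow> smooth_on S f"
  by (rule smooth_on_compose[of S "\<lambda>x. x" T f]) (auto intro: smooth_on_linear bounded_linear_ident)

lemma smooth_on_divide:
  fixes f g :: "'a::euclidean_space \<Rightarrow> real"
  assumes "open S" "smooth_on S f" "smooth_on S g" "\<And>x. x \<in> S \<Longrightarrow> g x \<noteq> 0"
  shows "smooth_on S (\<lambda>x. f x / g x)"
  unfolding divide_inverse
  by (intro smooth_on_mult assms smooth_on_compose[OF assms(1) _ assms(3), of "- {0}" inverse])
    (use assms(4) Ck_on_inverse in \<open>auto simp: smooth_on_def\<close>)

lemma smooth_on_sqrt: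
  assumes "open S" "smooth_on S f" "\<And>x. x \<in> S \<Longrightarrow> f x > 0"
  shows "smooth_on S (\<lambda>x. sqrt (f x))"
  by (intro smooth_on_compose[OF assms(1) _ assms(2), of "{0<..}" sqrt])
    (use assms(3) Ck_on_sqrt in \<open>auto simp: smooth_on_def\<close>)

lemma smooth_on_vec_lambda:
  fixes f :: "'n::finite \<Rightarrow> 'a::euclidean_space \<Rightarrow> 'b::euclidean_space"
  assumes "open S" "\<And>i. smooth_on S (f i)"
  shows "smooth_on S (\<lambda>x. \<chi> i. f i x)"
proof -
  have *: "(\<chi> i. f i x) = (\<Sum>i\<in>UNIV. axis i (f i x))" for x
    by (simp add: vec_eq_iff axis_def if_distrib cong: if_cong)
  have "bounded_linear (axis i :: 'b \<Rightarrow> 'b ^ 'n)" for i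
    by (intro linear_conv_bounded_linear[THEN iffD1] linearI)
      (auto simp: vec_eq_iff axis_def)
  then show ?thesis unfolding *
    by (intro smooth_on_sum smooth_on_bounded_linear[of S "axis _"] assms)
qed

lemma smooth_on_derivative: "smooth_on S f \<Longrightarrow> smooth_on S (\<lambda>x. frechet_derivative f (at x) v)"
  unfolding smooth_on_def by (metis Ck_on.simps(2))

lemma smooth_on_has_derivative:
  "smooth_on S f \<Longrightarrow> x \<in> S \<Longrightarrow> (f has_derivative frechet_derivative f (at x)) (at x)"
  unfolding smooth_on_def by (meson Ck_on_Suc_derivative)

lemma smooth_on_continuous_on: "smooth_on S f \<Longrightarrow> continuous_on S f"
  unfolding smooth_on_def by (metis Ck_on.simps(1))

text \<open>Derivatives such as \<open>d1\<close> and \<open>d2\<close> are known to be smooth only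
  for a frozen direction, while the velocity moves base point and direction together. Linearity in
  the direction reduces the second case to the first.\<close>

lemma smooth_on_linear_family:
  fixes B :: "'a::euclidean_space \<Rightarrow> 'b::euclidean_space \<Rightarrow> 'c::real_normed_vector"
  assumes "open S" "open V" "\<And>x. x \<in> V \<Longrightarrow> linear (B x)" "\<And>u. smooth_on V (\<lambda>x. B x u)"
    "X ` S \<subseteq> V" "smooth_on S X" "smooth_on S Y"
  shows "smooth_on S (\<lambda>z. B (X z) (Y z))"
proof -
  have "smooth_on S (\<lambda>z. \<Sum>b\<in>Basis. (Y z \<bullet> b) *\<^sub>R B (X z) b)"
    by (intro smooth_on_sum smooth_on_scaleR smooth_on_inner smooth_on_const assms
        smooth_on_compose[OF assms(1,5,6) assms(4)])
  then show ?thesis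
  proof (rule smooth_on_cong[OF assms(1), rotated])
    show "(\<Sum>b\<in>Basis. (Y z \<bullet> b) *\<^sub>R B (X z) b) = B (X z) (Y z)" if "z \<in> S" for z
      by (rule linear_euclidean_sum[symmetric]) (use assms(3,5) that in blast)
  qed
qed

lemma has_derivative_linear_family:
  fixes B :: "'a::real_normed_vector \<Rightarrow> 'b::euclidean_space \<Rightarrow> 'c::real_normed_vector"
  assumes V: "open V" "X z \<in> V" "\<And>x. x \<in> V \<Longrightarrow> linear (B x)"
    and B: "\<And>u. ((\<lambda>x. B x u) has_derivative B' u) (at (X z))"
    and X: "(X has_derivative X') (at z)" and Y: "(Y has_derivative Y') (at z)"
  shows "((\<lambda>z. B (X z) (Y z)) has_derivative (\<lambda>d. B' (Y z) (X' d) + B (X z) (Y' d))) (at z)"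
proof -
  \<comment> \<open>Linearity of \<open>B'\<close> in \<open>u\<close> is not assumed; it is
    inherited from \<open>B\<close> by uniqueness of derivatives.\<close>
  have B'sum: "B' u = (\<lambda>d. \<Sum>b\<in>Basis. (u \<bullet> b) *\<^sub>R B' b d)" for u
  proof -
    have "((\<lambda>x. \<Sum>b\<in>Basis. (u \<bullet> b) *\<^sub>R B x b) has_derivative (\<lambda>d. \<Sum>b\<in>Basis. (u \<bullet> b) *\<^sub>R B' b d)) (at (X z))"
      by (auto intro!: derivative_intros B)
    then have "((\<lambda>x. B x u) has_derivative (\<lambda>d. \<Sum>b\<in>Basis. (u \<bullet> b) *\<^sub>R B' b d)) (at (X z))"
      by (rule has_derivative_transform_within_open[OF _ V(1,2)])
        (rule linear_euclidean_sum[symmetric], rule V(3))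
    then show ?thesis using B has_derivative_unique by blast
  qed
  have "eventually (\<lambda>t. X t \<in> V) (nhds z)"
    using has_derivative_continuous[OF X] V(1,2)
    by (simp add: continuous_at topological_tendstoD tendsto_at_iff_tendsto_nhds)
  then have ev: "eventually (\<lambda>t. (\<Sum>b\<in>Basis. (Y t \<bullet> b) *\<^sub>R B (X t) b) = B (X t) (Y t)) (nhds z)"
    by eventually_elim (rule linear_euclidean_sum[symmetric], rule V(3))
  have "((\<lambda>t. \<Sum>b\<in>Basis. (Y t \<bullet> b) *\<^sub>R B (X t) b) has_derivative
      (\<lambda>d. \<Sum>b\<in>Basis. (Y z \<bullet> b) *\<^sub>R B' b (X' d) + (Y' d \<bullet> b) *\<^sub>R B (X z) b)) (at z)"
    by (auto intro!: derivative_intros has_derivative_compose[OF X B] Y)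
  then have "((\<lambda>t. B (X t) (Y t)) has_derivative
      (\<lambda>d. \<Sum>b\<in>Basis. (Y z \<bullet> b) *\<^sub>R B' b (X' d) + (Y' d \<bullet> b) *\<^sub>R B (X z) b)) (at z)"
    by (rule has_derivative_transform_eventually)
      (use ev eventually_nhds_x_imp_x[OF ev] in \<open>auto simp: eventually_at_filter elim: eventually_mono\<close>)
  moreover have "(\<Sum>b\<in>Basis. (Y z \<bullet> b) *\<^sub>R B' b (X' d) + (Y' d \<bullet> b) *\<^sub>R B (X z) b)
      = B' (Y z) (X' d) + B (X z) (Y' d)" for d
    using linear_euclidean_sum[OF V(3)[OF V(2)], of "Y' d"] B'sum[of "Y z"] by (simp add: sum.distrib)
  ultimately show ?thesis by simp
qed

section \<open>Symmetry of mixed second derivatives\<close>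

text \<open>The mean value theorem is applied twice: along \<open>u\<close> to the difference in
  direction \<open>v\<close>, then along \<open>v\<close> to \<open>f' _ u\<close>. The second
  difference is symmetric in \<open>u\<close> and \<open>v\<close>, so exchanging them evaluates the
  same number by the other mixed derivative.\<close>

lemma second_difference_mvt:
  fixes f :: "'a::real_normed_vector \<Rightarrow> real"
  assumes "s > 0"
    and S: "\<And>a b. a \<in> {0..s} \<Longrightarrow> b \<in> {0..s} \<Longrightarrow> x + a *\<^sub>R u + b *\<^sub>R v \<in> S"
    and f: "\<And>x. x \<in> S \<Longrightarrow> (f has_derivative f' x) (at x)"
    and g: "\<And>x. x \<in> S \<Longrightarrow> ((\<lambda>x. f' x u) has_derivative f'' x) (at x)"
  obtains a b where "a \<in> {0..s}" "b \<in> {0..s}"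
    "f (x + s *\<^sub>R u + s *\<^sub>R v) - f (x + s *\<^sub>R u) - f (x + s *\<^sub>R v) + f x = s * s * f'' (x + a *\<^sub>R u + b *\<^sub>R v) v"
proof -
  have d1: "((\<lambda>t. f (x + t *\<^sub>R u + b *\<^sub>R v)) has_real_derivative f' (x + t *\<^sub>R u + b *\<^sub>R v) u) (at t)"
    if "t \<in> {0..s}" "b \<in> {0..s}" for t b
  proof -
    have "((\<lambda>t. f (x + t *\<^sub>R u + b *\<^sub>R v)) has_derivative (\<lambda>h. f' (x + t *\<^sub>R u + b *\<^sub>R v) (h *\<^sub>R u))) (at t)"
      by (rule has_derivative_compose[of "\<lambda>t. x + t *\<^sub>R u + b *\<^sub>R v" "\<lambda>h. h *\<^sub>R u", OF _ f[OF S[OF that]]]) (auto intro!: derivative_eq_intros)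
    then show ?thesis
      by (rule has_derivative_imp_has_field_derivative)
        (simp add: linear_scale[OF has_derivative_linear[OF f[OF S[OF that]]]])
  qed
  have d2: "((\<lambda>t. f' (x + a *\<^sub>R u + t *\<^sub>R v) u) has_real_derivative f'' (x + a *\<^sub>R u + t *\<^sub>R v) v) (at t)"
    if "a \<in> {0..s}" "t \<in> {0..s}" for t a
  proof -
    have "((\<lambda>t. f' (x + a *\<^sub>R u + t *\<^sub>R v) u) has_derivative (\<lambda>h. f'' (x + a *\<^sub>R u + t *\<^sub>R v) (h *\<^sub>R v))) (at t)"
      by (rule has_derivative_compose[of "\<lambda>t. x + a *\<^sub>R u + t *\<^sub>R v" "\<lambda>h. h *\<^sub>R v", OF _ g[OF S[OF that]]]) (auto intro!: derivative_eq_intros)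
    then show ?thesis
      by (rule has_derivative_imp_has_field_derivative)
        (simp add: linear_scale[OF has_derivative_linear[OF g[OF S[OF that]]]])
  qed
  obtain a where a: "0 < a" "a < s" and a': "(f (x + s *\<^sub>R u + s *\<^sub>R v) - f (x + s *\<^sub>R u + 0 *\<^sub>R v))
      - (f (x + 0 *\<^sub>R u + s *\<^sub>R v) - f (x + 0 *\<^sub>R u + 0 *\<^sub>R v))
      = (s - 0) * (f' (x + a *\<^sub>R u + s *\<^sub>R v) u - f' (x + a *\<^sub>R u + 0 *\<^sub>R v) u)"
    using MVT2[OF \<open>s > 0\<close>, of "\<lambda>t. f (x + t *\<^sub>R u + s *\<^sub>R v) - f (x + t *\<^sub>R u + 0 *\<^sub>R v)"
        "\<lambda>t. f' (x + t *\<^sub>R u + s *\<^sub>R v) u - f' (x + t *\<^sub>R u + 0 *\<^sub>R v) u"]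
      DERIV_diff[OF d1[of _ s] d1[of _ 0]] \<open>s > 0\<close> by auto
  obtain b where b: "0 < b" "b < s" and b': "f' (x + a *\<^sub>R u + s *\<^sub>R v) u - f' (x + a *\<^sub>R u + 0 *\<^sub>R v) u
      = (s - 0) * f'' (x + a *\<^sub>R u + b *\<^sub>R v) v"
    using MVT2[OF \<open>s > 0\<close>, of "\<lambda>t. f' (x + a *\<^sub>R u + t *\<^sub>R v) u" "\<lambda>t. f'' (x + a *\<^sub>R u + t *\<^sub>R v) v"] d2[of a] a
    by auto
  show thesis
    by (rule that[of a b]) (use a b a' b' in auto)
qed

lemma symmetric_second_derivative_real:
  fixes f :: "'a::real_normed_vector \<Rightarrow> real"
  assumes "open S" "x \<in> S"
    and f: "\<And>x. x \<in> S \<Longrightarrow> (f has_derivative f' x) (at x)"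
    and f2: "\<And>x w. x \<in> S \<Longrightarrow> ((\<lambda>x. f' x w) has_derivative f'' x w) (at x)"
    and cont: "\<And>w w'. continuous_on S (\<lambda>x. f'' x w w')"
  shows "f'' x u v = f'' x v u"
proof (rule ccontr)
  \<comment> \<open>Half the supposed gap: a single number cannot be strictly within
    \<open>e\<close> of both mixed derivatives.\<close>
  define e where "e = \<bar>f'' x u v - f'' x v u\<bar> / 2"
  assume "f'' x u v \<noteq> f'' x v u"
  then have "e > 0" by (simp add: e_def)
  have near: "\<exists>d>0. \<forall>y. dist y x < d \<longrightarrow> y \<in> S \<and> \<bar>f'' y w w' - f'' x w w'\<bar> < e" for w w'
  proof -
    obtain d1 where d1: "d1 > 0" "\<And>y. y \<in> S \<Longrightarrow> dist y x < d1 \<Longrightarrow> dist (f'' y w w') (f'' x w w') < e"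
      using cont[of w w'] \<open>x \<in> S\<close> \<open>e > 0\<close> unfolding continuous_on_iff by blast
    obtain d2 where d2: "d2 > 0" "\<And>y. dist y x < d2 \<Longrightarrow> y \<in> S"
      using assms(1,2) unfolding open_dist by blast
    show ?thesis by (rule exI[of _ "min d1 d2"]) (use d1 d2 in \<open>auto simp: dist_real_def\<close>)
  qed
  obtain d1 where d1: "d1 > 0" "\<And>y. dist y x < d1 \<Longrightarrow> y \<in> S \<and> \<bar>f'' y u v - f'' x u v\<bar> < e"
    using near by blast
  obtain d2 where d2: "d2 > 0" "\<And>y. dist y x < d2 \<Longrightarrow> y \<in> S \<and> \<bar>f'' y v u - f'' x v u\<bar> < e"
    using near by blast
  \<comment> \<open>Keeps the parallelogram spanned by \<open>s *\<^sub>R u\<close> and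
    \<open>s *\<^sub>R v\<close> inside both neighbourhoods; the summand 1 keeps the divisor
    positive when both vectors vanish.\<close>
  define s where "s = min d1 d2 / 2 / (norm u + norm v + 1)"
  have pos: "norm u + norm v + 1 > 0" by (simp add: add_nonneg_pos)
  have "s > 0" using d1 d2 pos by (simp add: s_def)
  have "s * (norm u + norm v + 1) = min d1 d2 / 2"
    unfolding s_def using pos by (metis less_irrefl nonzero_eq_divide_eq)
  then have s1: "s * (norm u + norm v + 1) < min d1 d2" using d1(1) d2(1) by linarith
  have small: "dist (x + a *\<^sub>R u + b *\<^sub>R v) x < min d1 d2" if "a \<in> {0..s}" "b \<in> {0..s}" for a b
  proof -
    have "norm (a *\<^sub>R u + b *\<^sub>R v) \<le> \<bar>a\<bar> * norm u + \<bar>b\<bar> * norm v"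
      by (metis norm_scaleR norm_triangle_ineq)
    also have "\<dots> \<le> s * norm u + s * norm v"
      using that by (intro add_mono mult_right_mono) auto
    also have "\<dots> < min d1 d2" using s1 \<open>s > 0\<close> by (simp add: algebra_simps)
    finally show ?thesis by (simp add: dist_norm algebra_simps)
  qed
  have small': "dist (x + a *\<^sub>R v + b *\<^sub>R u) x < min d1 d2" if "a \<in> {0..s}" "b \<in> {0..s}" for a b
    using small[OF that(2,1)] by (simp add: algebra_simps)
  obtain a b where ab: "a \<in> {0..s}" "b \<in> {0..s}"
    "f (x + s *\<^sub>R u + s *\<^sub>R v) - f (x + s *\<^sub>R u) - f (x + s *\<^sub>R v) + f x = s * s * f'' (x + a *\<^sub>R u + b *\<^sub>R v) u v"
    by (rule second_difference_mvt[where x = x and u = u and v = v and S = S and f = f, OF \<open>s > 0\<close> _ f f2[of _ u]]) (use small d1 in fastforce)+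
  obtain a' b' where ab': "a' \<in> {0..s}" "b' \<in> {0..s}"
    "f (x + s *\<^sub>R v + s *\<^sub>R u) - f (x + s *\<^sub>R v) - f (x + s *\<^sub>R u) + f x = s * s * f'' (x + a' *\<^sub>R v + b' *\<^sub>R u) v u"
    by (rule second_difference_mvt[where x = x and u = v and v = u and S = S and f = f, OF \<open>s > 0\<close> _ f f2[of _ v]]) (use small' d1 in fastforce)+
  have "s * s * f'' (x + a *\<^sub>R u + b *\<^sub>R v) u v = s * s * f'' (x + a' *\<^sub>R v + b' *\<^sub>R u) v u"
    using ab(3) ab'(3) by (simp add: algebra_simps)
  then have "f'' (x + a *\<^sub>R u + b *\<^sub>R v) u v = f'' (x + a' *\<^sub>R v + b' *\<^sub>R u) v u" using \<open>s > 0\<close> by simp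
  moreover have "\<bar>f'' (x + a *\<^sub>R u + b *\<^sub>R v) u v - f'' x u v\<bar> < e" using small[OF ab(1,2)] d1 by auto
  moreover have "\<bar>f'' (x + a' *\<^sub>R v + b' *\<^sub>R u) v u - f'' x v u\<bar> < e" using small'[OF ab'(1,2)] d2 by auto
  ultimately show False unfolding e_def by (simp add: abs_if split: if_splits)
qed

lemma symmetric_second_derivative_smooth:
  fixes f :: "'a::euclidean_space \<Rightarrow> 'b::euclidean_space"
  assumes "open S" "x \<in> S" "smooth_on S f"
  shows "frechet_derivative (\<lambda>x. frechet_derivative f (at x) u) (at x) v
       = frechet_derivative (\<lambda>x. frechet_derivative f (at x) v) (at x) u"
proof (rule euclidean_eqI)
  fix b :: 'b assume "b \<in> Basis"
  let ?D = "\<lambda>x w w'. frechet_derivative (\<lambda>x. frechet_derivative f (at x) w) (at x) w'"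
  show "?D x u v \<bullet> b = ?D x v u \<bullet> b"
  proof (rule symmetric_second_derivative_real[OF assms(1,2), of "\<lambda>x. f x \<bullet> b" "\<lambda>x w. frechet_derivative f (at x) w \<bullet> b"])
    show "((\<lambda>x. f x \<bullet> b) has_derivative (\<lambda>w. frechet_derivative f (at x) w \<bullet> b)) (at x)" if "x \<in> S" for x
      by (intro has_derivative_inner_left smooth_on_has_derivative[OF assms(3) that])
    show "((\<lambda>x. frechet_derivative f (at x) w \<bullet> b) has_derivative (\<lambda>w'. ?D x w w' \<bullet> b)) (at x)" if "x \<in> S" for x w
      by (intro has_derivative_inner_left smooth_on_has_derivative[OF _ that] smooth_on_derivative assms)
    show "continuous_on S (\<lambda>x. ?D x w w' \<bullet> b)" for w w'
      by (intro continuous_on_inner continuous_on_const smooth_on_continuous_on smooth_on_derivative assms)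
  qed
qed

section \<open>Coordinate derivatives\<close>

lemma pd_eq:
  fixes f :: "real^'n::finite \<Rightarrow> real"
  assumes "(f has_derivative f') (at x)"
  shows "pd i f x = f' (axis i 1)"
proof -
  have "((\<lambda>t. f (x + t *\<^sub>R axis i 1)) has_derivative (\<lambda>h. f' (h *\<^sub>R axis i 1))) (at 0)"
    by (rule has_derivative_compose[of "\<lambda>t. x + t *\<^sub>R axis i 1" "\<lambda>h. h *\<^sub>R axis i 1" 0 UNIV f])
      (use assms in \<open>auto intro!: derivative_eq_intros\<close>)
  then have "((\<lambda>t. f (x + t *\<^sub>R axis i 1)) has_field_derivative f' (axis i 1)) (at 0)"
    by (rule has_derivative_imp_has_field_derivative)
      (simp add: linear_scale[OF has_derivative_linear[OF assms]])
  then show ?thesis unfolding pd_def by (rule DERIV_imp_deriv)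
qed

lemma pd_eq_open:
  fixes f :: "real^'n::finite \<Rightarrow> real"
  assumes "open S" "x \<in> S" "\<And>x. x \<in> S \<Longrightarrow> f x = g x" "(g has_derivative g') (at x)"
  shows "pd i f x = g' (axis i 1)"
  by (rule pd_eq, rule has_derivative_transform_within_open[OF assms(4,1,2)]) (simp add: assms(3))

text \<open>Agreement on an open set suffices: for iterated derivatives the inner one is known only
  over the chart domain and for nonzero \<open>y\<close>.\<close>

lemma pdx_eq:
  fixes h :: "real^'n::finite \<Rightarrow> real^'n \<Rightarrow> real"
  assumes "open T" "(x, y) \<in> T" "\<And>x y. (x, y) \<in> T \<Longrightarrow> h x y = k (x, y)" "(k has_derivative k') (at (x, y))"
  shows "pdx i h x y = k' (axis i 1, 0)"
proof -
  have "open ((\<lambda>x. (x, y)) -` T)" by (intro open_vimage assms continuous_intros)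
  moreover have "((\<lambda>x. k (x, y)) has_derivative (\<lambda>d. k' (d, 0))) (at x)"
    by (rule has_derivative_compose[of "\<lambda>x. (x, y)" "\<lambda>d. (d, 0)" x UNIV k, OF _ assms(4)])
      (auto intro!: derivative_eq_intros)
  ultimately show ?thesis
    unfolding pdx_def using assms(2,3) by (intro pd_eq_open[where g' = "\<lambda>d. k' (d, 0)"]) auto
qed

lemma pdy_eq:
  fixes h :: "real^'n::finite \<Rightarrow> real^'n \<Rightarrow> real"
  assumes "open T" "(x, y) \<in> T" "\<And>x y. (x, y) \<in> T \<Longrightarrow> h x y = k (x, y)" "(k has_derivative k') (at (x, y))"
  shows "pdy i h x y = k' (0, axis i 1)"
proof -
  have "open (Pair x -` T)" by (intro open_vimage assms continuous_intros)
  moreover have "((\<lambda>y. k (x, y)) has_derivative (\<lambda>d. k' (0, d))) (at y)"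
    by (rule has_derivative_compose[of "Pair x" "\<lambda>d. (0, d)" y UNIV k, OF _ assms(4)])
      (auto intro!: derivative_eq_intros)
  ultimately show ?thesis
    unfolding pdy_def using assms(2,3) by (intro pd_eq_open[where g' = "\<lambda>d. k' (0, d)"]) auto
qed

text \<open>The form in which identities are differentiated below: both sides are differentiated by
  rules, and the resulting equation is solved for the derivative that is wanted.\<close>

lemma has_derivative_eq_on:
  assumes "open T" "z \<in> T" "\<And>z. z \<in> T \<Longrightarrow> A z = B z"
    "(A has_derivative A') (at z)" "(B has_derivative B') (at z)"
  shows "A' d = B' d"
  using has_derivative_unique[OF has_derivative_transform_within_open[OF assms(4,1,2,3)] assms(5)] by simp

lemma linear_axis_sum:
  fixes L :: "real^'n::finite \<Rightarrow> 'b::real_vector"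
  assumes "linear L"
  shows "L u = (\<Sum>i\<in>UNIV. u $ i *\<^sub>R L (axis i 1))"
proof -
  have "L u = L (\<Sum>i\<in>UNIV. u $ i *\<^sub>R axis i 1)"
    using basis_expansion[of u] by (simp add: scalar_mult_eq_scaleR)
  then show ?thesis using assms by (simp add: linear_sum linear_scale)
qed

section \<open>Navigation description of the metric\<close>

lemma linear_vf: "linear vf"
  by (rule linearI) (simp_all add: vf_def vec_eq_iff forall_3)

lemmas bounded_linear_vf = linear_vf[unfolded linear_conv_bounded_linear]
lemmas has_derivative_vf [derivative_intros] = bounded_linear.has_derivative[OF bounded_linear_vf]
lemmas vf_simps = linear_add[OF linear_vf] linear_diff[OF linear_vf] linear_scale[OF linear_vf]
  linear_neg[OF linear_vf] linear_0[OF linear_vf]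

lemma vf_antisym: "vf p \<bullet> q = - (p \<bullet> vf q)"
  by (simp add: inner_vec_def sum_3 vf_def)

lemma vf_orthogonal [simp]: "vf p \<bullet> p = 0" "p \<bullet> vf p = 0"
  using vf_antisym[of p p] by (simp_all add: inner_commute)

text \<open>With \<open>l\<close> = \<lambda>, \<open>s\<close> = \<lambda> \<alpha> and
  \<open>b\<close> = -\<lambda> \<beta>, the value \<open>F\<close> is (s - b)/l, the positive root
  of l t^2 + 2 b t = |Y|^2 when \<open>Y\<close> is nonzero. This quadratic is |Y - t W|^2 = t^2 for
  the wind W = \<epsilon> v. The quantity in the last claim equals \<open>s\<close>.\<close>

lemma F_eps_unit_iff:
  assumes "\<epsilon>\<^sup>2 * (vf p \<bullet> vf p) < 1"
  shows "F_eps \<epsilon> p Y < 1 \<longleftrightarrow> (Y - \<epsilon> *\<^sub>R vf p) \<bullet> (Y - \<epsilon> *\<^sub>R vf p) < 1"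
    and "(Y - F_eps \<epsilon> p Y *\<^sub>R (\<epsilon> *\<^sub>R vf p)) \<bullet> (Y - F_eps \<epsilon> p Y *\<^sub>R (\<epsilon> *\<^sub>R vf p)) = (F_eps \<epsilon> p Y)\<^sup>2"
    and "Y \<noteq> 0 \<Longrightarrow> F_eps \<epsilon> p Y > 0"
    and "Y \<noteq> 0 \<Longrightarrow> F_eps \<epsilon> p Y
      + (Y - F_eps \<epsilon> p Y *\<^sub>R (\<epsilon> *\<^sub>R vf p)) \<bullet> (\<epsilon> *\<^sub>R vf p) > 0"
proof -
  define l where "l = 1 - \<epsilon>\<^sup>2 * (vf p \<bullet> vf p)"
  define b where "b = \<epsilon> * (vf p \<bullet> Y)"
  define s where "s = sqrt (b\<^sup>2 + (Y \<bullet> Y) * l)"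
  define F where "F = F_eps \<epsilon> p Y"
  have l: "l > 0" using assms by (simp add: l_def)
  have F: "l * F = s - b"
    using l by (simp add: F_def F_eps_def alpha_def beta_def l_def[symmetric] s_def b_def power_mult_distrib
        diff_divide_distrib[symmetric])
  have s2: "s\<^sup>2 = b\<^sup>2 + (Y \<bullet> Y) * l" and s0: "s \<ge> 0" using l by (simp_all add: s_def)
  have WW: "\<epsilon> * (\<epsilon> * (vf p \<bullet> vf p)) = 1 - l" by (simp add: l_def power2_eq_square)
  have YW: "\<epsilon> * (Y \<bullet> vf p) = b" by (simp add: b_def inner_commute)
  have e1: "(Y - c *\<^sub>R (\<epsilon> *\<^sub>R vf p)) \<bullet> (Y - c *\<^sub>R (\<epsilon> *\<^sub>R vf p)) = Y \<bullet> Y - 2 * c * b + c\<^sup>2 * (1 - l)" for c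
    by (simp add: WW[symmetric] YW[symmetric] algebra_simps power2_eq_square inner_commute)
  have "l * (Y \<bullet> Y) = l * (2 * F * b + l * F\<^sup>2)"
  proof -
    have "l * (2 * F * b + l * F\<^sup>2) = 2 * b * (l * F) + (l * F)\<^sup>2" by (simp add: power2_eq_square algebra_simps)
    also have "\<dots> = l * (Y \<bullet> Y)" unfolding F using s2 by (simp add: power2_eq_square algebra_simps)
    finally show ?thesis by (rule sym)
  qed
  then have "Y \<bullet> Y = 2 * F * b + l * F\<^sup>2" using l by (metis less_irrefl mult_cancel_left)
  then show "(Y - F_eps \<epsilon> p Y *\<^sub>R (\<epsilon> *\<^sub>R vf p)) \<bullet> (Y - F_eps \<epsilon> p Y *\<^sub>R (\<epsilon> *\<^sub>R vf p)) = (F_eps \<epsilon> p Y)\<^sup>2"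
    unfolding F_def[symmetric] e1 by (simp add: algebra_simps)
  have sb: "s \<ge> \<bar>b\<bar>" using l unfolding s_def by (intro real_le_rsqrt) simp
  have "F_eps \<epsilon> p Y < 1 \<longleftrightarrow> l * F < l * 1" using l unfolding F_def by simp
  also have "\<dots> \<longleftrightarrow> s < b + l" unfolding F by auto
  also have "\<dots> \<longleftrightarrow> s\<^sup>2 < (b + l)\<^sup>2"
  proof
    show "s < b + l \<Longrightarrow> s\<^sup>2 < (b + l)\<^sup>2" using s0 by (intro power_strict_mono) auto
    \<comment> \<open>A negative \<open>b + l\<close> would give \<open>s < - b - l\<close>, which
      is less than \<open>\<bar>b\<bar>\<close>, against \<open>sb\<close>.\<close>
    assume "s\<^sup>2 < (b + l)\<^sup>2"
    then have "s < \<bar>b + l\<bar>" using s0 by (metis abs_of_nonneg power2_abs power2_less_imp_less abs_ge_zero)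
    then show "s < b + l" using sb l by linarith
  qed
  also have "\<dots> \<longleftrightarrow> l * (Y \<bullet> Y) < l * (2 * b + l)" unfolding s2 by (simp add: power2_eq_square algebra_simps)
  also have "\<dots> \<longleftrightarrow> Y \<bullet> Y < 2 * b + l" using l by simp
  also have "\<dots> \<longleftrightarrow> (Y - \<epsilon> *\<^sub>R vf p) \<bullet> (Y - \<epsilon> *\<^sub>R vf p) < 1" using e1[of 1] by auto
  finally show "F_eps \<epsilon> p Y < 1 \<longleftrightarrow> (Y - \<epsilon> *\<^sub>R vf p) \<bullet> (Y - \<epsilon> *\<^sub>R vf p) < 1" .
  assume "Y \<noteq> 0"
  then have "\<bar>b\<bar> < s" using l unfolding s_def by (intro real_less_rsqrt) simp
  then have "l * F > 0" "s > 0" unfolding F by auto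
  then show "F_eps \<epsilon> p Y > 0" using l by (simp add: F_def zero_less_mult_iff)
  have "F + (Y - F *\<^sub>R (\<epsilon> *\<^sub>R vf p)) \<bullet> (\<epsilon> *\<^sub>R vf p) = F + (\<epsilon> * (Y \<bullet> vf p) - F * (\<epsilon> * (\<epsilon> * (vf p \<bullet> vf p))))"
    by (simp add: algebra_simps)
  also have "\<dots> = s" unfolding WW YW using F by (simp add: algebra_simps)
  finally show "F_eps \<epsilon> p Y + (Y - F_eps \<epsilon> p Y *\<^sub>R (\<epsilon> *\<^sub>R vf p)) \<bullet> (\<epsilon> *\<^sub>R vf p) > 0"
    using \<open>s > 0\<close> by (simp add: F_def)
qed

section \<open>Coordinate systems of the sphere\<close>

locale sphere_chart =
  fixes \<epsilon> :: real and V :: "(real^2) set" and \<phi> :: "real^2 \<Rightarrow> real^3"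
  assumes coords: "local_coords (U_eps \<epsilon>) V \<phi>"
begin

definition d1 :: "real^2 \<Rightarrow> real^2 \<Rightarrow> real^3" where
  "d1 x u = frechet_derivative \<phi> (at x) u"

definition d2 :: "real^2 \<Rightarrow> real^2 \<Rightarrow> real^2 \<Rightarrow> real^3" where
  "d2 x u v = frechet_derivative (\<lambda>x. d1 x u) (at x) v"

definition d3 :: "real^2 \<Rightarrow> real^2 \<Rightarrow> real^2 \<Rightarrow> real^2 \<Rightarrow> real^3" where
  "d3 x u v w = frechet_derivative (\<lambda>x. d2 x u v) (at x) w"

lemma open_V: "open V" and smooth_phi: "smooth_on V \<phi>"
  and inj_frechet: "x \<in> V \<Longrightarrow> inj (frechet_derivative \<phi> (at x))"
  and phi_in_U: "x \<in> V \<Longrightarrow> \<phi> x \<in> U_eps \<epsilon>"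
  using coords unfolding local_coords_def by auto

lemma phi_unit: "x \<in> V \<Longrightarrow> \<phi> x \<bullet> \<phi> x = 1"
  using phi_in_U[of x] by (simp add: U_eps_def norm_eq_1)

lemma lam_pos: "x \<in> V \<Longrightarrow> \<epsilon>\<^sup>2 * (vf (\<phi> x) \<bullet> vf (\<phi> x)) < 1"
  using phi_in_U[of x] by (simp add: U_eps_def)

lemma smooth_d1: "smooth_on V (\<lambda>x. d1 x u)"
  unfolding d1_def by (intro smooth_on_derivative smooth_phi)

lemma smooth_d2: "smooth_on V (\<lambda>x. d2 x u v)"
  unfolding d2_def by (intro smooth_on_derivative smooth_d1)

lemma phi_derivative: "x \<in> V \<Longrightarrow> (\<phi> has_derivative d1 x) (at x)"
  using smooth_on_has_derivative[OF smooth_phi] by (simp add: d1_def[abs_def])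

lemma d1_derivative: "x \<in> V \<Longrightarrow> ((\<lambda>x. d1 x u) has_derivative d2 x u) (at x)"
  using smooth_on_has_derivative[OF smooth_d1[of u]] by (simp add: d2_def[abs_def])

lemma d2_derivative: "x \<in> V \<Longrightarrow> ((\<lambda>x. d2 x u v) has_derivative d3 x u v) (at x)"
  using smooth_on_has_derivative[OF smooth_d2[of u v]] by (simp add: d3_def[abs_def])

lemma linear_d1: "x \<in> V \<Longrightarrow> linear (d1 x)"
  using phi_derivative has_derivative_linear by blast

lemma linear_d2: "x \<in> V \<Longrightarrow> linear (d2 x u)"
  using d1_derivative has_derivative_linear by blast

lemma d2_sym: "x \<in> V \<Longrightarrow> d2 x u v = d2 x v u"
  unfolding d2_def d1_def by (rule symmetric_second_derivative_smooth[OF open_V _ smooth_phi])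

lemma d3_sym: "x \<in> V \<Longrightarrow> d3 x u v w = d3 x u w v"
  unfolding d3_def d2_def by (rule symmetric_second_derivative_smooth[OF open_V _ smooth_d1])

lemma linear_d2_left:
  assumes "x \<in> V"
  shows "linear (\<lambda>u. d2 x u v)"
proof -
  have "(\<lambda>u. d2 x u v) = d2 x v" using d2_sym[OF assms] by blast
  then show ?thesis using linear_d2[OF assms] by simp
qed

lemmas d1_simps = linear_add[OF linear_d1] linear_diff[OF linear_d1] linear_scale[OF linear_d1]
  linear_neg[OF linear_d1] linear_0[OF linear_d1]

lemmas d2_simps = linear_add[OF linear_d2] linear_diff[OF linear_d2] linear_scale[OF linear_d2]
  linear_neg[OF linear_d2] linear_0[OF linear_d2]

lemma d1_eq_0: "x \<in> V \<Longrightarrow> d1 x u = 0 \<longleftrightarrow> u = 0"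
  using inj_frechet[of x] linear_d1[of x] linear_injective_0[of "d1 x"] by (auto simp: d1_def[abs_def] linear_0)

lemma d1_inject: "x \<in> V \<Longrightarrow> d1 x u = d1 x v \<longleftrightarrow> u = v"
  using d1_eq_0[of x "u - v"] by (simp add: d1_simps)

lemma phi_d1: "x \<in> V \<Longrightarrow> \<phi> x \<bullet> d1 x u = 0"
  using has_derivative_eq_on[OF open_V _ phi_unit
      has_derivative_inner[OF phi_derivative phi_derivative] has_derivative_const, of x u]
  by (simp add: inner_commute)

text \<open>Differentiating \<open>phi_d1\<close> gives the second fundamental form of the sphere.
  It is what makes the spray candidate tangent.\<close>

lemma phi_d2: "x \<in> V \<Longrightarrow> \<phi> x \<bullet> d2 x u v = - (d1 x u \<bullet> d1 x v)"
  using has_derivative_eq_on[OF open_V _ phi_d1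
      has_derivative_inner[OF phi_derivative d1_derivative] has_derivative_const, of x u v]
  by (simp add: inner_commute)

subsection \<open>The Gram matrix and the projection to coordinates\<close>

definition gram :: "real^2 \<Rightarrow> 2 \<Rightarrow> 2 \<Rightarrow> real" where
  "gram x i j = d1 x (axis i 1) \<bullet> d1 x (axis j 1)"

definition gram_det :: "real^2 \<Rightarrow> real" where
  "gram_det x = gram x 1 1 * gram x 2 2 - (gram x 1 2)\<^sup>2"

text \<open>Cramer's rule for the Gram matrix: the components of the orthogonal projection of
  \<open>q\<close> to the tangent plane. The explicit quotient makes the smooth dependence on
  \<open>x\<close> visible.\<close>

definition coord :: "real^2 \<Rightarrow> real^3 \<Rightarrow> real^2" where
  "coord x q = (\<chi> i. if i = 1
     then (gram x 2 2 * (q \<bullet> d1 x (axis 1 1)) - gram x 1 2 * (q \<bullet> d1 x (axis 2 1))) / gram_det x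
     else (gram x 1 1 * (q \<bullet> d1 x (axis 2 1)) - gram x 1 2 * (q \<bullet> d1 x (axis 1 1))) / gram_det x)"

lemma d1_expand: "x \<in> V \<Longrightarrow> d1 x u = u $ 1 *\<^sub>R d1 x (axis 1 1) + u $ 2 *\<^sub>R d1 x (axis 2 1)"
  using linear_axis_sum[OF linear_d1, of x u] by (simp add: sum_2)

text \<open>For the coordinate vectors a and b, the vector (b.b) a - (a.b) b is nonzero by
  injectivity of \<open>d1\<close>, and its squared length is (b.b) times the Gram
  determinant.\<close>

lemma gram_det_pos:
  assumes "x \<in> V"
  shows "gram_det x > 0"
proof -
  let ?a = "d1 x (axis 1 1)" and ?b = "d1 x (axis 2 1)"
  have b: "?b \<bullet> ?b > 0" using d1_eq_0[OF assms, of "axis 2 1"] by (simp add: axis_eq_0_iff)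
  have "axis 1 (?b \<bullet> ?b) - axis 2 (?a \<bullet> ?b) \<noteq> (0 :: real^2)"
    using b by (auto simp: vec_eq_iff forall_2 axis_def)
  then have "d1 x (axis 1 (?b \<bullet> ?b) - axis 2 (?a \<bullet> ?b)) \<noteq> 0" using d1_eq_0[OF assms] by blast
  moreover have "d1 x (axis 1 (?b \<bullet> ?b) - axis 2 (?a \<bullet> ?b)) = (?b \<bullet> ?b) *\<^sub>R ?a - (?a \<bullet> ?b) *\<^sub>R ?b"
    by (subst d1_expand[OF assms]) (simp add: axis_def)
  ultimately have "((?b \<bullet> ?b) *\<^sub>R ?a - (?a \<bullet> ?b) *\<^sub>R ?b) \<bullet> ((?b \<bullet> ?b) *\<^sub>R ?a - (?a \<bullet> ?b) *\<^sub>R ?b) > 0"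
    by simp
  also have "((?b \<bullet> ?b) *\<^sub>R ?a - (?a \<bullet> ?b) *\<^sub>R ?b) \<bullet> ((?b \<bullet> ?b) *\<^sub>R ?a - (?a \<bullet> ?b) *\<^sub>R ?b)
      = (?b \<bullet> ?b) * gram_det x"
    by (simp add: gram_det_def gram_def algebra_simps inner_commute power2_eq_square)
  finally show ?thesis using b by (simp add: zero_less_mult_iff)
qed

text \<open>A dimension count: the complement of the tangent plane in \<real>^3 is a line, so it
  cannot contain the independent vectors \<open>r\<close> and \<open>\<phi> x\<close>.\<close>

lemma orthogonal_frame_0:
  assumes x: "x \<in> V" and r: "r \<bullet> \<phi> x = 0" "\<And>i. r \<bullet> d1 x (axis i 1) = 0"
  shows "r = 0"
proof (rule ccontr)
  assume "r \<noteq> 0"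
  define S where "S = range (d1 x)"
  have ort: "r \<bullet> d1 x u = 0" for u
    using r(2) by (subst d1_expand[OF x]) (simp add: inner_add_right)
  have "dim S = 2"
    using dim_image_eq[of "d1 x" UNIV] linear_d1[OF x] inj_frechet[OF x]
    by (simp add: S_def d1_def[abs_def])
  have "pairwise orthogonal {r, \<phi> x}"
    using r(1) by (auto simp: pairwise_def orthogonal_def inner_commute)
  moreover have "0 \<notin> {r, \<phi> x}" using \<open>r \<noteq> 0\<close> phi_unit[OF x] by auto
  ultimately have ind: "independent {r, \<phi> x}" by (rule pairwise_orthogonal_independent)
  have "r \<noteq> \<phi> x" using r(1) \<open>r \<noteq> 0\<close> by auto
  have "{r, \<phi> x} \<subseteq> {y \<in> UNIV. \<forall>s\<in>S. orthogonal s y}"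
    using ort phi_d1[OF x] by (auto simp: S_def orthogonal_def inner_commute)
  then have "card {r, \<phi> x} \<le> dim {y \<in> UNIV. \<forall>s\<in>S. orthogonal s y}"
    using ind independent_card_le_dim by blast
  moreover have "dim {y \<in> UNIV. \<forall>s\<in>S. orthogonal s y} + dim S = dim (UNIV :: (real^3) set)"
    by (rule dim_subspace_orthogonal_to_vectors)
      (auto simp: S_def linear_subspace_image[OF linear_d1[OF x]])
  ultimately show False using \<open>dim S = 2\<close> \<open>r \<noteq> \<phi> x\<close> by simp
qed

lemma d1_coord:
  assumes x: "x \<in> V"
  shows "d1 x (coord x q) = q - (q \<bullet> \<phi> x) *\<^sub>R \<phi> x"
proof -
  have D: "gram_det x \<noteq> 0" using gram_det_pos[OF x] by simp
  have sym: "gram x 2 1 = gram x 1 2" by (simp add: gram_def inner_commute)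
  have e: "d1 x (coord x q) \<bullet> p = coord x q $ 1 * (d1 x (axis 1 1) \<bullet> p) + coord x q $ 2 * (d1 x (axis 2 1) \<bullet> p)" for p
    by (subst d1_expand[OF x]) (simp add: inner_add_left)
  have "d1 x (coord x q) \<bullet> d1 x (axis i 1) = q \<bullet> d1 x (axis i 1)" for i
    using exhaust_2[of i] D unfolding e gram_def[symmetric] sym
    by (auto simp: coord_def sym field_simps) (auto simp: gram_det_def algebra_simps power2_eq_square)
  then have "d1 x (coord x q) - (q - (q \<bullet> \<phi> x) *\<^sub>R \<phi> x) = 0"
    using phi_d1[OF x] phi_unit[OF x]
    by (intro orthogonal_frame_0[OF x]) (auto simp: inner_diff_left inner_diff_right inner_commute)
  then show ?thesis by simp
qed

lemma coord_d1: "x \<in> V \<Longrightarrow> coord x (d1 x u) = u"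
  using d1_coord[of x "d1 x u"] d1_inject[of x] phi_d1[of x u] by (simp add: inner_commute)

end

section \<open>First and second derivatives of the metric\<close>

lemma matrix_inv_left_inverse:
  fixes A :: "real^'n^'n"
  assumes "invertible A"
  shows "matrix_inv A ** A = mat 1"
  using someI_ex[OF assms[unfolded invertible_def]] by (simp add: matrix_inv_def)

context sphere_chart
begin

text \<open>\<open>rel\<close> is the velocity relative to the wind \<open>\<epsilon>v\<close>, and \<open>den\<close> equals \<open>\<lambda>\<alpha>\<close> with
  \<open>\<lambda> = 1 - \<epsilon>\<^sup>2 h(v, v)\<close>. Differentiating \<open>rel \<bullet> rel = F\<^sup>2\<close> gives all derivatives of \<open>F\<close>, with
  denominator \<open>den\<close>, and avoids the square root in \<open>\<alpha>\<close>.\<close>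

definition TV :: "((real^2) \<times> (real^2)) set" where
  "TV = V \<times> (- {0})"

definition F :: "(real^2) \<times> (real^2) \<Rightarrow> real" where
  "F z = in_coords (F_eps \<epsilon>) \<phi> (fst z) (snd z)"

definition vel :: "(real^2) \<times> (real^2) \<Rightarrow> real^3" where
  "vel z = d1 (fst z) (snd z)"

definition wind :: "(real^2) \<times> (real^2) \<Rightarrow> real^3" where
  "wind z = \<epsilon> *\<^sub>R vf (\<phi> (fst z))"

definition rel :: "(real^2) \<times> (real^2) \<Rightarrow> real^3" where
  "rel z = vel z - F z *\<^sub>R wind z"

definition den :: "(real^2) \<times> (real^2) \<Rightarrow> real" where
  "den z = F z + rel z \<bullet> wind z"

text \<open>The pull towards the centre that keeps a great circle on the sphere, reduced by the
  centrifugal term of the rotation.\<close>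

definition cen :: "(real^2) \<times> (real^2) \<Rightarrow> real^3" where
  "cen z = \<phi> (fst z) + \<epsilon>\<^sup>2 *\<^sub>R vf (vf (\<phi> (fst z)))"

definition F' :: "(real^2) \<times> (real^2) \<Rightarrow> (real^2) \<times> (real^2) \<Rightarrow> real" where
  "F' z d = frechet_derivative F (at z) d"

abbreviation fx :: "(real^2) \<times> (real^2) \<Rightarrow> real^2 \<Rightarrow> real" where
  "fx z u \<equiv> F' z (u, 0)"

abbreviation fy :: "(real^2) \<times> (real^2) \<Rightarrow> real^2 \<Rightarrow> real" where
  "fy z u \<equiv> F' z (0, u)"

definition fy' :: "(real^2) \<times> (real^2) \<Rightarrow> real^2 \<Rightarrow> (real^2) \<times> (real^2) \<Rightarrow> real" where
  "fy' z u d = frechet_derivative (\<lambda>z. fy z u) (at z) d"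

lemma open_TV: "open TV"
  unfolding TV_def by (intro open_Times open_V) auto

lemma TV_fst: "z \<in> TV \<Longrightarrow> fst z \<in> V" and TV_snd: "z \<in> TV \<Longrightarrow> snd z \<noteq> 0"
  by (auto simp: TV_def)

lemma smooth_fst: "smooth_on TV (\<lambda>z. fst z)" and smooth_snd: "smooth_on TV (\<lambda>z. snd z)"
  by (intro smooth_on_linear open_TV bounded_linear_fst bounded_linear_snd)+

lemma fst_TV: "(\<lambda>z. fst z) ` TV \<subseteq> V"
  by (auto simp: TV_def)

lemmas smooth_intros = smooth_on_const smooth_on_add[OF open_TV] smooth_on_diff[OF open_TV]
  smooth_on_minus[OF open_TV] smooth_on_scaleR[OF open_TV] smooth_on_mult[OF open_TV]
  smooth_on_inner[OF open_TV] smooth_on_power2[OF open_TV] smooth_on_divide[OF open_TV]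
  smooth_on_sqrt[OF open_TV] smooth_on_bounded_linear[OF open_TV bounded_linear_vf]
  smooth_on_compose[OF open_TV fst_TV smooth_fst smooth_phi]
  smooth_on_compose[OF open_TV fst_TV smooth_fst smooth_d1]

lemma smooth_vel: "smooth_on TV vel"
  unfolding vel_def[abs_def]
  by (rule smooth_on_linear_family[OF open_TV open_V linear_d1 smooth_d1 fst_TV smooth_fst smooth_snd])

lemma vel_nonzero: "z \<in> TV \<Longrightarrow> vel z \<noteq> 0"
  using d1_eq_0[of "fst z" "snd z"] by (auto simp: TV_def vel_def)

lemma F_eq: "F z = F_eps \<epsilon> (\<phi> (fst z)) (vel z)"
  by (simp add: F_def in_coords_def vel_def d1_def)

lemma smooth_F: "smooth_on TV F"
proof -
  have "smooth_on TV (\<lambda>z. F_eps \<epsilon> (\<phi> (fst z)) (vel z))"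
    unfolding F_eps_def alpha_def beta_def
  proof (intro smooth_intros smooth_vel)
    fix z assume z: "z \<in> TV"
    have l: "\<epsilon>\<^sup>2 * (vf (\<phi> (fst z)) \<bullet> vf (\<phi> (fst z))) < 1" using lam_pos[OF TV_fst[OF z]] .
    then show "1 - \<epsilon>\<^sup>2 * (vf (\<phi> (fst z)) \<bullet> vf (\<phi> (fst z))) \<noteq> 0"
      "1 - \<epsilon>\<^sup>2 * (vf (\<phi> (fst z)) \<bullet> vf (\<phi> (fst z))) \<noteq> 0" by auto
    show "0 < \<epsilon>\<^sup>2 * (vf (\<phi> (fst z)) \<bullet> vel z)\<^sup>2 +
      vel z \<bullet> vel z * (1 - \<epsilon>\<^sup>2 * (vf (\<phi> (fst z)) \<bullet> vf (\<phi> (fst z))))"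
      using l vel_nonzero[OF z] by (intro add_nonneg_pos mult_pos_pos) auto
  qed
  then show ?thesis by (rule smooth_on_cong[OF open_TV F_eq[symmetric], rotated])
qed

lemma smooth_fy: "smooth_on TV (\<lambda>z. fy z u)"
  unfolding F'_def by (rule smooth_on_derivative[OF smooth_F])

lemma smooth_fy': "smooth_on TV (\<lambda>z. fy' z u d)"
  unfolding fy'_def by (rule smooth_on_derivative[OF smooth_fy])

lemma F_derivative: "z \<in> TV \<Longrightarrow> (F has_derivative F' z) (at z)"
  using smooth_on_has_derivative[OF smooth_F] by (simp add: F'_def[abs_def])

lemma fy_derivative: "z \<in> TV \<Longrightarrow> ((\<lambda>z. fy z u) has_derivative fy' z u) (at z)"
  using smooth_on_has_derivative[OF smooth_fy[of u]] by (simp add: fy'_def[abs_def])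

lemma linear_F': "z \<in> TV \<Longrightarrow> linear (F' z)"
  using F_derivative has_derivative_linear by blast

lemma linear_fy'_right: "z \<in> TV \<Longrightarrow> linear (fy' z u)"
  using fy_derivative has_derivative_linear by blast

lemma F'_split: "z \<in> TV \<Longrightarrow> F' z d = fx z (fst d) + fy z (snd d)"
  using linear_add[OF linear_F', of z "(fst d, 0)" "(0, snd d)"] by simp

lemma linear_fx: "z \<in> TV \<Longrightarrow> linear (\<lambda>u. fx z u)"
  using linear_compose[OF _ linear_F', of "\<lambda>u. (u, 0)"] by (auto simp: o_def linear_iff)

lemma linear_fy: "z \<in> TV \<Longrightarrow> linear (\<lambda>u. fy z u)"
  using linear_compose[OF _ linear_F', of "\<lambda>u. (0, u)"] by (auto simp: o_def linear_iff)

lemma F_pos: "z \<in> TV \<Longrightarrow> F z > 0"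
  using F_eps_unit_iff(3)[OF lam_pos vel_nonzero] by (simp add: F_eq TV_fst)

lemma den_pos: "z \<in> TV \<Longrightarrow> den z > 0"
  using F_eps_unit_iff(4)[OF lam_pos vel_nonzero, of "fst z" z]
  by (simp add: F_eq TV_fst den_def rel_def wind_def)

lemma rel_rel: "z \<in> TV \<Longrightarrow> rel z \<bullet> rel z = (F z)\<^sup>2"
  using F_eps_unit_iff(2)[OF lam_pos, of "fst z" "vel z"] by (simp add: F_eq TV_fst rel_def wind_def)

lemma vel_phi: "z \<in> TV \<Longrightarrow> vel z \<bullet> \<phi> (fst z) = 0"
  using phi_d1[OF TV_fst] by (simp add: vel_def inner_commute)

lemma rel_phi: "z \<in> TV \<Longrightarrow> rel z \<bullet> \<phi> (fst z) = 0"
  by (simp add: rel_def wind_def inner_diff_left vel_phi)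

lemma vel_eq: "vel z = rel z + (F z * \<epsilon>) *\<^sub>R vf (\<phi> (fst z))"
  by (simp add: rel_def wind_def)

lemma rel_vf_vel: "rel z \<bullet> vf (vel z) = (F z * \<epsilon>) * (rel z \<bullet> vf (vf (\<phi> (fst z))))"
  by (simp add: vel_eq vf_simps inner_add_right)

text \<open>Pairing with the tangent vector \<open>rel z\<close> kills the position in
  \<open>cen\<close>, and skewness of \<open>vf\<close> removes \<open>rel\<close> from
  \<open>vel\<close> on the right; both sides reduce to the same multiple of
  \<open>rel z \<bullet> vf (vf (\<phi> (fst z)))\<close>. All later cancellations that involve the
  wind rest on this identity.\<close>

lemma rel_cen: "z \<in> TV \<Longrightarrow> F z * (rel z \<bullet> cen z) = \<epsilon> * (rel z \<bullet> vf (vel z))"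
  by (simp add: cen_def inner_add_right rel_phi rel_vf_vel power2_eq_square)

lemma phi_fst_derivative [derivative_intros]:
  "z \<in> TV \<Longrightarrow> ((\<lambda>z. \<phi> (fst z)) has_derivative (\<lambda>d. d1 (fst z) (fst d))) (at z)"
  by (rule has_derivative_compose[of fst fst z UNIV \<phi>])
    (auto intro!: derivative_intros phi_derivative TV_fst)

lemma d1_fst_derivative [derivative_intros]:
  "z \<in> TV \<Longrightarrow> ((\<lambda>z. d1 (fst z) u) has_derivative (\<lambda>d. d2 (fst z) u (fst d))) (at z)"
  by (rule has_derivative_compose[of fst fst z UNIV "\<lambda>x. d1 x u"])
    (auto intro!: derivative_intros d1_derivative TV_fst)

lemma vel_derivative [derivative_intros]:
  assumes "z \<in> TV"
  shows "(vel has_derivative (\<lambda>d. d2 (fst z) (snd z) (fst d) + d1 (fst z) (snd d))) (at z)"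
  unfolding vel_def[abs_def] using assms
  by (intro has_derivative_linear_family[where V = V] open_V TV_fst linear_d1 d1_derivative)
    (auto intro!: derivative_intros)

lemma d2_snd_derivative [derivative_intros]:
  assumes "z \<in> TV"
  shows "((\<lambda>z. d2 (fst z) u (snd z)) has_derivative
      (\<lambda>d. d3 (fst z) u (snd z) (fst d) + d2 (fst z) u (snd d))) (at z)"
  using assms
  by (intro has_derivative_linear_family[where V = V] open_V TV_fst linear_d2 d2_derivative)
    (auto intro!: derivative_intros)

text \<open>The vector \<open>y\<close> sits in both slots, so the slots are released one at a time.
  In the second round \<open>z\<close> itself plays the part of the base point. Symmetry of
  \<open>d2\<close> merges the two contributions into the factor 2.\<close>

lemma d2_snd_snd_derivative [derivative_intros]:
  assumes z: "z \<in> TV"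
  shows "((\<lambda>z. d2 (fst z) (snd z) (snd z)) has_derivative
      (\<lambda>d. d3 (fst z) (snd z) (snd z) (fst d) + 2 *\<^sub>R d2 (fst z) (snd z) (snd d))) (at z)"
proof -
  have 1: "((\<lambda>z. d2 (fst z) (snd z) v) has_derivative
      (\<lambda>d. d3 (fst z) (snd z) v (fst d) + d2 (fst z) (snd d) v)) (at z)" for v
    using z
    by (intro has_derivative_linear_family[where V = V and B' = "\<lambda>u. d3 (fst z) u v"]
        open_V TV_fst linear_d2_left d2_derivative)
      (auto intro!: derivative_intros)
  have "((\<lambda>z. d2 (fst z) (snd z) (snd z)) has_derivative
      (\<lambda>d. (d3 (fst z) (snd z) (snd z) (fst d) + d2 (fst z) (snd d) (snd z)) + d2 (fst z) (snd z) (snd d))) (at z)"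
    by (rule has_derivative_linear_family[where V = TV and X = "\<lambda>z. z" and X' = "\<lambda>d. d"
          and Y' = snd and B = "\<lambda>z. d2 (fst z) (snd z)"])
      (use z 1 in \<open>auto intro!: open_TV linear_d2 TV_fst derivative_intros\<close>)
  then show ?thesis
    using d2_sym[OF TV_fst[OF z]] by (simp add: scaleR_2 add.assoc)
qed

text \<open>The derivative of \<open>rel\<close> with \<open>F'\<close> left in place as an unknown,
  for which \<open>den_F'\<close> then solves.\<close>

definition relD :: "(real^2) \<times> (real^2) \<Rightarrow> (real^2) \<times> (real^2) \<Rightarrow> real^3" where
  "relD z d = d2 (fst z) (snd z) (fst d) + d1 (fst z) (snd d)
     - (F z * \<epsilon>) *\<^sub>R vf (d1 (fst z) (fst d)) - F' z d *\<^sub>R wind z"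

definition denD :: "(real^2) \<times> (real^2) \<Rightarrow> (real^2) \<times> (real^2) \<Rightarrow> real" where
  "denD z d = F' z d + relD z d \<bullet> wind z + \<epsilon> * (rel z \<bullet> vf (d1 (fst z) (fst d)))"

lemma rel_derivative: "z \<in> TV \<Longrightarrow> (rel has_derivative relD z) (at z)"
  unfolding rel_def[abs_def] wind_def relD_def[abs_def]
  by (auto intro!: derivative_eq_intros F_derivative simp: algebra_simps)

lemma den_derivative: "z \<in> TV \<Longrightarrow> (den has_derivative denD z) (at z)"
  unfolding den_def[abs_def] wind_def denD_def[abs_def]
  by (auto intro!: derivative_eq_intros F_derivative rel_derivative simp: algebra_simps)

text \<open>Differentiating \<open>rel_rel\<close> and collecting the terms with \<open>F'\<close>
  produces exactly the factor F + rel . wind.\<close>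

lemma den_F':
  assumes z: "z \<in> TV"
  shows "den z * F' z d = rel z \<bullet> (d2 (fst z) (snd z) (fst d) + d1 (fst z) (snd d)
     - (F z * \<epsilon>) *\<^sub>R vf (d1 (fst z) (fst d)))"
proof -
  have "2 * (rel z \<bullet> relD z d) = 2 * (F z * F' z d)"
    using has_derivative_eq_on[OF open_TV z rel_rel
        has_derivative_inner[OF rel_derivative[OF z] rel_derivative[OF z]]
        has_derivative_power[OF F_derivative[OF z], of 2], of d]
    by (simp add: inner_commute)
  then show ?thesis by (simp add: relD_def den_def inner_diff_right algebra_simps)
qed

lemma den_fy: "z \<in> TV \<Longrightarrow> den z * fy z u = rel z \<bullet> d1 (fst z) u"
  using den_F'[of z "(0, u)"] by (simp add: d1_simps d2_simps TV_fst vf_simps)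

lemma den_fx: "z \<in> TV \<Longrightarrow> den z * fx z u
    = rel z \<bullet> (d2 (fst z) (snd z) u - (F z * \<epsilon>) *\<^sub>R vf (d1 (fst z) u))"
  using den_F'[of z "(u, 0)"] by (simp add: d1_simps TV_fst)

lemma den_cancel: "z \<in> TV \<Longrightarrow> den z * a = den z * b \<Longrightarrow> a = b"
  using den_pos by fastforce

lemma den_fy':
  assumes z: "z \<in> TV"
  shows "den z * fy' z u d
    = relD z d \<bullet> d1 (fst z) u + rel z \<bullet> d2 (fst z) u (fst d) - denD z d * fy z u"
  using has_derivative_eq_on[OF open_TV z den_fy
      has_derivative_mult[OF den_derivative[OF z] fy_derivative[OF z]]
      has_derivative_inner[OF rel_derivative[OF z] d1_fst_derivative[OF z]], of u d]
  by (simp add: algebra_simps)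

text \<open>\<open>fy'\<close> differentiates each \<open>fy _ u\<close> separately, which hides the
  linearity in \<open>u\<close>; the right side of \<open>den_fy'\<close> displays it.\<close>

lemma linear_fy':
  assumes z: "z \<in> TV"
  shows "linear (\<lambda>u. fy' z u d)"
proof -
  have "linear (\<lambda>u. relD z d \<bullet> d1 (fst z) u + rel z \<bullet> d2 (fst z) u (fst d) - denD z d * fy z u)"
    using linear_d1[OF TV_fst[OF z]] linear_d2_left[OF TV_fst[OF z], of "fst d"] linear_fy[OF z]
    by (simp add: linear_iff algebra_simps)
  then have "linear (\<lambda>u. inverse (den z) *\<^sub>R (den z * fy' z u d))"
    unfolding den_fy'[OF z] by (rule linear_compose_scale_right)
  moreover have "inverse (den z) *\<^sub>R (den z * a) = a" for a using den_pos[OF z] by simp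
  ultimately show ?thesis by (simp only:)
qed

text \<open>Euler's relation for a function homogeneous of degree one, taken here from the implicit
  equation.\<close>

lemma fy_snd: "z \<in> TV \<Longrightarrow> fy z (snd z) = F z"
proof (rule den_cancel, assumption)
  assume z: "z \<in> TV"
  have "den z * fy z (snd z) = rel z \<bullet> (rel z + F z *\<^sub>R wind z)"
    unfolding den_fy[OF z] by (simp add: rel_def vel_def)
  then show "den z * fy z (snd z) = den z * F z"
    by (simp add: inner_add_right rel_rel[OF z] den_def power2_eq_square algebra_simps)
qed

lemma relD_vertical: "z \<in> TV \<Longrightarrow> relD z (0, v) = d1 (fst z) v - fy z v *\<^sub>R wind z"
  by (simp add: relD_def d1_simps d2_simps TV_fst vf_simps)

lemma denD_vertical: "z \<in> TV \<Longrightarrow> denD z (0, v) = fy z v + relD z (0, v) \<bullet> wind z"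
  by (simp add: denD_def d1_simps TV_fst vf_simps)

text \<open>The fibre Hessian of \<open>F\<close> in a form that is visibly symmetric and to which
  Cauchy-Schwarz applies.\<close>

lemma den_fy'_vertical:
  assumes z: "z \<in> TV"
  shows "den z * fy' z u (0, v) = relD z (0, v) \<bullet> relD z (0, u) - fy z v * fy z u"
  unfolding den_fy'[OF z] denD_vertical[OF z]
  by (simp add: relD_vertical[OF z] d2_simps TV_fst[OF z] inner_diff_left inner_diff_right algebra_simps)

lemma fy'_sym: "z \<in> TV \<Longrightarrow> fy' z u (0, v) = fy' z v (0, u)"
  by (rule den_cancel, assumption) (simp add: den_fy'_vertical inner_commute)

lemma fy'_snd: "z \<in> TV \<Longrightarrow> fy' z u (0, snd z) = 0"
proof (rule den_cancel, assumption)
  assume z: "z \<in> TV"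
  have "relD z (0, snd z) = rel z"
    by (simp add: relD_vertical[OF z] fy_snd[OF z] rel_def vel_def)
  then show "den z * fy' z u (0, snd z) = den z * 0"
    unfolding den_fy'_vertical[OF z]
    by (simp add: fy_snd[OF z] relD_vertical[OF z] inner_diff_right den_fy[OF z, symmetric])
      (simp add: den_def algebra_simps)
qed

subsection \<open>The fundamental tensor\<close>

definition fund :: "(real^2) \<times> (real^2) \<Rightarrow> real^2 \<Rightarrow> real^2 \<Rightarrow> real" where
  "fund z u v = fy z u * fy z v + F z * fy' z u (0, v)"

lemma smooth_fund: "smooth_on TV (\<lambda>z. fund z u v)"
  unfolding fund_def by (intro smooth_intros smooth_F smooth_fy smooth_fy')

lemma linear_fund: "z \<in> TV \<Longrightarrow> linear (\<lambda>u. fund z u v)"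
  using linear_fy[of z] linear_fy'[of z "(0, v)"] by (simp add: fund_def linear_iff algebra_simps)

lemma fund_sym: "z \<in> TV \<Longrightarrow> fund z u v = fund z v u"
  by (simp add: fund_def fy'_sym[of z u v])

lemma fund_expand: "z \<in> TV \<Longrightarrow> fund z u v = u $ 1 * fund z (axis 1 1) v + u $ 2 * fund z (axis 2 1) v"
  using linear_axis_sum[OF linear_fund, of z u v] by (simp add: sum_2)

lemma fund_snd: "z \<in> TV \<Longrightarrow> fund z (snd z) v = F z * fy z v"
  by (simp add: fund_def fy_snd fy'_snd fy'_sym[of z "snd z"])

text \<open>Since \<open>rel z\<close> has length \<open>F z\<close> and its product with
  \<open>relD z (0, u)\<close> is \<open>F z * fy z u\<close>, Cauchy-Schwarz makes the Hessian term
  nonnegative. The square of \<open>fy z u\<close> settles the case where it is nonzero; otherwise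
  \<open>relD z (0, u)\<close> is the nonzero vector \<open>d1 (fst z) u\<close>.\<close>

lemma fund_pos:
  assumes z: "z \<in> TV" and "u \<noteq> 0"
  shows "fund z u u > 0"
proof -
  let ?m = "relD z (0, u)"
  have "rel z \<bullet> ?m = F z * fy z u"
    by (simp add: relD_vertical[OF z] inner_diff_right den_fy[OF z, symmetric]) (simp add: den_def algebra_simps)
  then have "(F z * fy z u)\<^sup>2 \<le> (F z)\<^sup>2 * (?m \<bullet> ?m)"
    using Cauchy_Schwarz_ineq[of "rel z" ?m] by (simp add: rel_rel[OF z])
  then have ge: "(fy z u)\<^sup>2 \<le> ?m \<bullet> ?m"
    using F_pos[OF z] by (simp add: power_mult_distrib)
  have eq: "den z * fy' z u (0, u) = ?m \<bullet> ?m - (fy z u)\<^sup>2"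
    by (simp add: den_fy'_vertical[OF z] power2_eq_square)
  show ?thesis
  proof (cases "fy z u = 0")
    case True
    have "?m \<noteq> 0" using True d1_eq_0[OF TV_fst[OF z]] \<open>u \<noteq> 0\<close> by (simp add: relD_vertical[OF z])
    then have "den z * fy' z u (0, u) > 0" unfolding eq True by simp
    then have "fy' z u (0, u) > 0" using den_pos[OF z] by (simp add: zero_less_mult_iff)
    then show ?thesis using F_pos[OF z] True by (simp add: fund_def)
  next
    case False
    have "den z * fy' z u (0, u) \<ge> 0" unfolding eq using ge by simp
    then have "fy' z u (0, u) \<ge> 0" using den_pos[OF z] by (simp add: zero_le_mult_iff)
    then have "F z * fy' z u (0, u) \<ge> 0" using F_pos[OF z] by simp
    moreover have "fy z u * fy z u > 0" using False by (simp add: zero_less_mult_iff) linarith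
    ultimately show ?thesis unfolding fund_def by linarith
  qed
qed

abbreviation Fc :: "real^2 \<Rightarrow> real^2 \<Rightarrow> real" where
  "Fc \<equiv> in_coords (F_eps \<epsilon>) \<phi>"

lemma Fc_eq: "Fc x y = F (x, y)"
  by (simp add: F_def)

lemma fundamental_tensor_eq:
  assumes "(x, y) \<in> TV"
  shows "fundamental_tensor Fc x y $ i $ j = fund (x, y) (axis i 1) (axis j 1)"
proof -
  have 1: "pdy i (\<lambda>x y. (Fc x y)\<^sup>2) x y = 2 * F (x, y) * fy (x, y) (axis i 1)" if "(x, y) \<in> TV" for x y i
    using pdy_eq[OF open_TV that Fc_eq[THEN arg_cong, of "\<lambda>t. t\<^sup>2"] has_derivative_power[OF F_derivative[OF that], of 2], of i]
    by simp
  have "((\<lambda>z. 2 * F z * fy z (axis i 1)) has_derivative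
      (\<lambda>d. 2 * (F (x, y) * fy' (x, y) (axis i 1) d + F' (x, y) d * fy (x, y) (axis i 1)))) (at (x, y))"
    using assms by (auto intro!: derivative_eq_intros F_derivative fy_derivative simp: algebra_simps)
  from pdy_eq[OF open_TV assms 1 this, of j]
  show ?thesis by (simp add: fundamental_tensor_def fund_def algebra_simps)
qed

lemma fundamental_tensor_quadratic:
  assumes "(x, y) \<in> TV"
  shows "u \<bullet> (fundamental_tensor Fc x y *v v) = fund (x, y) u v"
proof -
  have "fund (x, y) (axis i 1) v = v $ 1 * fund (x, y) (axis i 1) (axis 1 1) + v $ 2 * fund (x, y) (axis i 1) (axis 2 1)" for i
    by (subst (1 2 3) fund_sym[OF assms]) (rule fund_expand[OF assms])
  then show ?thesis
    by (subst fund_expand[OF assms])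
      (simp add: inner_vec_def matrix_vector_mult_def sum_2 fundamental_tensor_eq[OF assms] algebra_simps)
qed

lemma fundamental_tensor_invertible:
  assumes "(x, y) \<in> TV"
  shows "invertible (fundamental_tensor Fc x y)"
proof -
  have "u = 0" if "fundamental_tensor Fc x y *v u = 0" for u
    using fundamental_tensor_quadratic[OF assms, of u u] fund_pos[OF assms, of u] that by auto
  then show ?thesis
    by (simp add: invertible_left_inverse matrix_left_invertible_ker)
qed

section \<open>The spray\<close>

text \<open>\<open>spray3\<close> is the image of the spray coefficients under the differential of the chart. It is
  determined by the requirement that \<open>F\<close> and the derivatives of \<open>F\<close> satisfy the Euler--Lagrange
  equations.\<close>

definition spray3 :: "(real^2) \<times> (real^2) \<Rightarrow> real^3" where
  "spray3 z = - (F z * \<epsilon>) *\<^sub>R vf (vel z) + ((F z)\<^sup>2 / 2) *\<^sub>R cen z + (1/2) *\<^sub>R d2 (fst z) (snd z) (snd z)"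

definition spray :: "(real^2) \<times> (real^2) \<Rightarrow> real^2" where
  "spray z = coord (fst z) (spray3 z)"

text \<open>\<open>coord\<close> projects, so the claim is that \<open>spray3 z\<close> has no
  normal component. The normal parts of its three summands add up to zero precisely because of
  \<open>rel_rel\<close>.\<close>

lemma d1_spray:
  assumes z: "z \<in> TV"
  shows "d1 (fst z) (spray z) = spray3 z"
proof -
  let ?p = "\<phi> (fst z)"
  have "vel z \<bullet> vel z = (F z)\<^sup>2 * (1 - \<epsilon>\<^sup>2 * (vf ?p \<bullet> vf ?p)) + 2 * (F z * \<epsilon>) * (vel z \<bullet> vf ?p)"
    using rel_rel[OF z] by (simp add: rel_def wind_def inner_diff_left inner_diff_right inner_commute
        algebra_simps power2_eq_square)
  moreover have "vf (vel z) \<bullet> ?p = - (vel z \<bullet> vf ?p)" by (rule vf_antisym)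
  moreover have "cen z \<bullet> ?p = 1 - \<epsilon>\<^sup>2 * (vf ?p \<bullet> vf ?p)"
    by (simp add: cen_def inner_add_left phi_unit TV_fst[OF z] vf_antisym[of "vf ?p"])
  moreover have "d2 (fst z) (snd z) (snd z) \<bullet> ?p = - (vel z \<bullet> vel z)"
    using phi_d2[OF TV_fst[OF z]] by (simp add: vel_def inner_commute)
  ultimately have "spray3 z \<bullet> ?p = 0"
    by (simp add: spray3_def inner_add_left inner_diff_left) (simp add: field_simps)
  then show ?thesis by (simp add: spray_def d1_coord[OF TV_fst[OF z]])
qed

text \<open>The derivative in the direction \<open>(y, -2G)\<close> is the derivative along the geodesic flow: there
  \<open>F\<close> and the denominator are constant, and the relative velocity rotates.\<close>

abbreviation flow :: "(real^2) \<times> (real^2) \<Rightarrow> (real^2) \<times> (real^2)" where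
  "flow z \<equiv> (snd z, - (2 *\<^sub>R spray z))"

text \<open>The left side is the acceleration in \<real>^3 of a curve with x'' = -2 G; the last
  summand of \<open>spray3\<close> removes the second derivative of the chart from it.\<close>

lemma vel_flow:
  assumes z: "z \<in> TV"
  shows "d2 (fst z) (snd z) (snd z) + d1 (fst z) (- (2 *\<^sub>R spray z))
    = (2 * F z * \<epsilon>) *\<^sub>R vf (vel z) - (F z)\<^sup>2 *\<^sub>R cen z"
  by (simp add: d1_simps TV_fst[OF z] d1_spray[OF z] spray3_def algebra_simps)

lemma F'_flow:
  assumes z: "z \<in> TV"
  shows "F' z (flow z) = 0"
proof (rule den_cancel[OF z])
  show "den z * F' z (flow z) = den z * 0"
    unfolding den_F'[OF z] fst_conv snd_conv vel_flow[OF z] vel_def[symmetric]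
    using rel_cen[OF z]
    by (simp add: inner_diff_right power2_eq_square)
qed

lemma relD_flow:
  assumes z: "z \<in> TV"
  shows "relD z (flow z) = (F z * \<epsilon>) *\<^sub>R vf (rel z) - (F z)\<^sup>2 *\<^sub>R \<phi> (fst z)"
  unfolding relD_def fst_conv snd_conv vel_flow[OF z] vel_def[symmetric] F'_flow[OF z]
  by (simp add: vec_eq_iff vel_eq[of z] cen_def vf_simps algebra_simps power2_eq_square)

lemma denD_flow:
  assumes z: "z \<in> TV"
  shows "denD z (flow z) = 0"
proof -
  have "relD z (flow z) \<bullet> wind z = - (F z * \<epsilon> * \<epsilon>) * (rel z \<bullet> vf (vf (\<phi> (fst z))))"
    unfolding relD_flow[OF z] by (simp add: wind_def inner_diff_left vf_antisym[of "rel z"])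
  then show ?thesis
    unfolding denD_def fst_conv vel_def[symmetric] rel_vf_vel by (simp add: F'_flow[OF z])
qed

text \<open>The Euler-Lagrange equation: along the flow the rate of change of F_y is F_x.\<close>

lemma fy'_flow:
  assumes z: "z \<in> TV"
  shows "fy' z u (flow z) = fx z u"
proof (rule den_cancel[OF z])
  show "den z * fy' z u (flow z) = den z * fx z u"
    unfolding den_fy'[OF z] den_fx[OF z] denD_flow[OF z] relD_flow[OF z] fst_conv
    using phi_d1[OF TV_fst[OF z], of u]
    by (simp add: inner_diff_left inner_diff_right vf_antisym[of "rel z"] d2_sym[OF TV_fst[OF z], of u])
qed

text \<open>Contracted with \<open>y\<close>, the derivatives of the fundamental tensor reduce to
  derivatives of \<open>F\<close>. The Euler-Lagrange equation then turns the sum in the definition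
  into 4 times the fundamental tensor applied to the spray, and the inverse matrix cancels.\<close>

lemma geodesic_coeff_eq:
  assumes z: "(x, y) \<in> TV"
  shows "geodesic_coeff Fc i x y = spray (x, y) $ i"
proof -
  define s where "s = spray (x, y)"
  define g where "g = fundamental_tensor Fc x y"
  define g' where "g' p q d = frechet_derivative (\<lambda>z. fund z (axis p 1) (axis q 1)) (at (x, y)) d" for p q :: 2 and d
  have g'_deriv: "((\<lambda>z. fund z (axis p 1) (axis q 1)) has_derivative g' p q) (at (x, y))" for p q
    using smooth_on_has_derivative[OF smooth_fund z] by (simp add: g'_def[abs_def])
  have pdx_g: "pdx k (\<lambda>x y. fundamental_tensor Fc x y $ p $ q) x y = g' p q (axis k 1, 0)" for k p q
    by (rule pdx_eq[OF open_TV z fundamental_tensor_eq g'_deriv])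
  \<comment> \<open>The identity g(y, .) = F F_y differentiated in a base direction, so that the
    factor \<open>y\<close> is not differentiated.\<close>
  have I1: "y $ 1 * g' 1 k (axis q 1, 0) + y $ 2 * g' 2 k (axis q 1, 0)
      = fx (x, y) (axis q 1) * fy (x, y) (axis k 1) + F (x, y) * fy' (x, y) (axis k 1) (axis q 1, 0)" for k q
  proof -
    have A: "snd z $ 1 * fund z (axis 1 1) (axis k 1) + snd z $ 2 * fund z (axis 2 1) (axis k 1)
        = F z * fy z (axis k 1)" if "z \<in> TV" for z
      using fund_expand[OF that, of "snd z"] fund_snd[OF that] by simp
    have B: "((\<lambda>z. snd z $ 1 * fund z (axis 1 1) (axis k 1) + snd z $ 2 * fund z (axis 2 1) (axis k 1)) has_derivative
        (\<lambda>d. y $ 1 * g' 1 k d + snd d $ 1 * fund (x, y) (axis 1 1) (axis k 1)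
      + (y $ 2 * g' 2 k d + snd d $ 2 * fund (x, y) (axis 2 1) (axis k 1)))) (at (x, y))"
      by (rule derivative_eq_intros g'_deriv bounded_linear.has_derivative[OF bounded_linear_vec_nth] has_derivative_snd refl)+ simp
    have C: "((\<lambda>z. F z * fy z (axis k 1)) has_derivative
        (\<lambda>d. F (x, y) * fy' (x, y) (axis k 1) d + F' (x, y) d * fy (x, y) (axis k 1))) (at (x, y))"
      by (rule has_derivative_mult[OF F_derivative[OF z] fy_derivative[OF z]])
    from has_derivative_eq_on[OF open_TV z A B C, of "(axis q 1, 0)"]
    show ?thesis by (simp add: algebra_simps)
  qed
  \<comment> \<open>Euler's relation differentiated in a base direction.\<close>
  have I2: "y $ 1 * fy' (x, y) (axis 1 1) (axis q 1, 0) + y $ 2 * fy' (x, y) (axis 2 1) (axis q 1, 0)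
      = fx (x, y) (axis q 1)" for q
  proof -
    have A: "snd z $ 1 * fy z (axis 1 1) + snd z $ 2 * fy z (axis 2 1) = F z" if "z \<in> TV" for z
      using linear_axis_sum[OF linear_fy[OF that], of "snd z"] fy_snd[OF that] by (simp add: sum_2)
    have B: "((\<lambda>z. snd z $ 1 * fy z (axis 1 1) + snd z $ 2 * fy z (axis 2 1)) has_derivative
        (\<lambda>d. y $ 1 * fy' (x, y) (axis 1 1) d + snd d $ 1 * fy (x, y) (axis 1 1)
      + (y $ 2 * fy' (x, y) (axis 2 1) d + snd d $ 2 * fy (x, y) (axis 2 1)))) (at (x, y))"
      by (rule derivative_eq_intros fy_derivative z bounded_linear.has_derivative[OF bounded_linear_vec_nth] has_derivative_snd refl)+ simp
    from has_derivative_eq_on[OF open_TV z A B F_derivative[OF z], of "(axis q 1, 0)"]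
    show ?thesis by simp
  qed
  have fF: "y $ 1 * fy (x, y) (axis 1 1) + y $ 2 * fy (x, y) (axis 2 1) = F (x, y)"
    using linear_axis_sum[OF linear_fy[OF z], of y] fy_snd[OF z] by (simp add: sum_2)
  \<comment> \<open>Conservation of \<open>F\<close> along the flow, split into its base and fibre
    parts; \<open>flow2\<close> splits the Euler-Lagrange equation in the same way.\<close>
  have flow1: "y $ 1 * fx (x, y) (axis 1 1) + y $ 2 * fx (x, y) (axis 2 1) = 2 * fy (x, y) s"
    using F'_flow[OF z] F'_split[OF z, of "flow (x, y)"] linear_axis_sum[OF linear_fx[OF z], of y]
      linear_neg[OF linear_fy[OF z], of "2 *\<^sub>R s"] linear_scale[OF linear_fy[OF z], of 2 s] by (simp add: sum_2 s_def)
  have flow2: "y $ 1 * fy' (x, y) u (axis 1 1, 0) + y $ 2 * fy' (x, y) u (axis 2 1, 0)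
      = fx (x, y) u + 2 * fy' (x, y) u (0, s)" for u
  proof -
    have "fy' (x, y) u (flow (x, y)) = fy' (x, y) u (y $ 1 *\<^sub>R (axis 1 1, 0) + y $ 2 *\<^sub>R (axis 2 1, 0) + (-2) *\<^sub>R (0, s))"
      using basis_expansion[of y] by (simp add: s_def scalar_mult_eq_scaleR sum_2)
    then show ?thesis
      unfolding fy'_flow[OF z] linear_add[OF linear_fy'_right[OF z]] linear_scale[OF linear_fy'_right[OF z]]
      by simp
  qed
  have key: "(\<Sum>p\<in>UNIV. \<Sum>q\<in>UNIV. (2 * pdx q (\<lambda>x y. fundamental_tensor Fc x y $ p $ k) x y
        - pdx k (\<lambda>x y. fundamental_tensor Fc x y $ p $ q) x y) * y $ p * y $ q)
      = 4 * (g *v s) $ k" for k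
  proof -
    have "(\<Sum>p\<in>UNIV. \<Sum>q\<in>UNIV. (2 * pdx q (\<lambda>x y. fundamental_tensor Fc x y $ p $ k) x y
        - pdx k (\<lambda>x y. fundamental_tensor Fc x y $ p $ q) x y) * y $ p * y $ q)
      = 2 * (y $ 1 * (y $ 1 * g' 1 k (axis 1 1, 0) + y $ 2 * g' 2 k (axis 1 1, 0))
           + y $ 2 * (y $ 1 * g' 1 k (axis 2 1, 0) + y $ 2 * g' 2 k (axis 2 1, 0)))
        - (y $ 1 * (y $ 1 * g' 1 1 (axis k 1, 0) + y $ 2 * g' 2 1 (axis k 1, 0))
           + y $ 2 * (y $ 1 * g' 1 2 (axis k 1, 0) + y $ 2 * g' 2 2 (axis k 1, 0)))"
      unfolding pdx_g sum_2 by (simp add: algebra_simps)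
    also have "\<dots> = 2 * ((y $ 1 * fx (x, y) (axis 1 1) + y $ 2 * fx (x, y) (axis 2 1)) * fy (x, y) (axis k 1)
          + F (x, y) * (y $ 1 * fy' (x, y) (axis k 1) (axis 1 1, 0) + y $ 2 * fy' (x, y) (axis k 1) (axis 2 1, 0)))
        - (fx (x, y) (axis k 1) * (y $ 1 * fy (x, y) (axis 1 1) + y $ 2 * fy (x, y) (axis 2 1))
          + F (x, y) * (y $ 1 * fy' (x, y) (axis 1 1) (axis k 1, 0) + y $ 2 * fy' (x, y) (axis 2 1) (axis k 1, 0)))"
      unfolding I1 by (simp add: algebra_simps)
    \<comment> \<open>The terms F F_x cancel: two come from \<open>flow2\<close>, one from
      \<open>fF\<close> and one from \<open>I2\<close>.\<close>
    also have "\<dots> = 4 * fund (x, y) (axis k 1) s"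
      unfolding flow1 flow2 fF I2 fund_def by (simp add: algebra_simps)
    also have "fund (x, y) (axis k 1) s = (g *v s) $ k"
      using fundamental_tensor_quadratic[OF z, of "axis k 1" s] by (simp add: g_def inner_axis')
    finally show ?thesis .
  qed
  have "geodesic_coeff Fc i x y = 1/4 * (\<Sum>k\<in>UNIV. matrix_inv g $ i $ k *
      (\<Sum>p\<in>UNIV. \<Sum>q\<in>UNIV. (2 * pdx q (\<lambda>x y. fundamental_tensor Fc x y $ p $ k) x y
        - pdx k (\<lambda>x y. fundamental_tensor Fc x y $ p $ q) x y) * y $ p * y $ q))"
    by (simp add: geodesic_coeff_def Let_def g_def sum_2 algebra_simps)
  also have "\<dots> = (matrix_inv g *v (g *v s)) $ i"
    unfolding key by (simp add: matrix_vector_mult_def sum_2 algebra_simps)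
  also have "\<dots> = s $ i"
    using matrix_inv_left_inverse[OF fundamental_tensor_invertible[OF z]]
    by (simp add: g_def matrix_vector_mul_assoc)
  finally show ?thesis by (simp add: s_def)
qed

end

context sphere_chart
begin

section \<open>The Riemann curvature\<close>

definition spray' :: "(real^2) \<times> (real^2) \<Rightarrow> (real^2) \<times> (real^2) \<Rightarrow> real^2" where
  "spray' z d = frechet_derivative spray (at z) d"

text \<open>The nonlinear connection N^i_k = dG^i/dy^k, applied to a vector.\<close>

abbreviation conn :: "(real^2) \<times> (real^2) \<Rightarrow> real^2 \<Rightarrow> real^2" where
  "conn z u \<equiv> spray' z (0, u)"

definition conn' :: "(real^2) \<times> (real^2) \<Rightarrow> real^2 \<Rightarrow> (real^2) \<times> (real^2) \<Rightarrow> real^2" where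
  "conn' z u d = frechet_derivative (\<lambda>z. conn z u) (at z) d"

definition conn3 :: "(real^2) \<times> (real^2) \<Rightarrow> real^2 \<Rightarrow> real^3" where
  "conn3 z u = - (\<epsilon> * fy z u) *\<^sub>R vf (vel z) - (\<epsilon> * F z) *\<^sub>R vf (d1 (fst z) u)
     + (F z * fy z u) *\<^sub>R cen z + d2 (fst z) u (snd z)"

lemma d3_sym_left:
  assumes "x \<in> V"
  shows "d3 x u v w = d3 x v u w"
proof -
  have "(\<lambda>x. d2 x u v) differentiable (at x)"
    using d2_derivative[OF assms] by (auto simp: differentiable_def)
  from frechet_derivative_transform_within_open[OF this open_V assms, of "\<lambda>x. d2 x v u"]
  show ?thesis unfolding d3_def using d2_sym by simp
qed

lemma smooth_d2_snd: "smooth_on TV (\<lambda>z. d2 (fst z) (snd z) (snd z))"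
proof -
  have "smooth_on TV (\<lambda>z. d2 (fst z) (snd z) v)" for v
    by (rule smooth_on_linear_family[OF open_TV open_V, of "\<lambda>x u. d2 x u v" fst snd])
      (use linear_d2_left smooth_d2 TV_fst smooth_fst smooth_snd in auto)
  then show ?thesis
    using smooth_on_linear_family[OF open_TV open_TV, of "\<lambda>z. d2 (fst z) (snd z)" "\<lambda>z. z" snd]
      linear_d2 TV_fst smooth_snd smooth_on_linear[OF open_TV bounded_linear_ident] by auto
qed

lemma smooth_spray3: "smooth_on TV spray3"
  unfolding spray3_def[abs_def] cen_def
  by (intro smooth_intros smooth_F smooth_vel smooth_d2_snd) auto

lemma smooth_spray: "smooth_on TV spray"
proof -
  have D: "gram_det (fst z) \<noteq> 0" if "z \<in> TV" for z
    using gram_det_pos[OF TV_fst[OF that]] by simp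
  have "smooth_on TV (\<lambda>z. (gram (fst z) i i * (spray3 z \<bullet> d1 (fst z) (axis j 1))
      - gram (fst z) 1 2 * (spray3 z \<bullet> d1 (fst z) (axis i 1))) / gram_det (fst z))" for i j
  proof (rule smooth_on_divide[OF open_TV _ _ D])
    show "smooth_on TV (\<lambda>z. gram_det (fst z))"
      unfolding gram_def gram_det_def by (intro smooth_intros)
    show "smooth_on TV (\<lambda>z. gram (fst z) i i * (spray3 z \<bullet> d1 (fst z) (axis j 1))
      - gram (fst z) 1 2 * (spray3 z \<bullet> d1 (fst z) (axis i 1)))"
      unfolding gram_def by (intro smooth_intros smooth_spray3)
  qed
  then have "smooth_on TV (\<lambda>z. if i = 1
     then (gram (fst z) 2 2 * (spray3 z \<bullet> d1 (fst z) (axis 1 1)) - gram (fst z) 1 2 * (spray3 z \<bullet> d1 (fst z) (axis 2 1))) / gram_det (fst z)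
     else (gram (fst z) 1 1 * (spray3 z \<bullet> d1 (fst z) (axis 2 1)) - gram (fst z) 1 2 * (spray3 z \<bullet> d1 (fst z) (axis 1 1))) / gram_det (fst z))" for i :: 2
    by (cases "i = 1") auto
  then show ?thesis
    unfolding spray_def[abs_def] coord_def by (intro smooth_on_vec_lambda open_TV)
qed

lemma smooth_conn: "smooth_on TV (\<lambda>z. conn z u)"
  unfolding spray'_def by (rule smooth_on_derivative[OF smooth_spray])

lemma spray_derivative: "z \<in> TV \<Longrightarrow> (spray has_derivative spray' z) (at z)"
  using smooth_on_has_derivative[OF smooth_spray] by (simp add: spray'_def[abs_def])

lemma conn_derivative: "z \<in> TV \<Longrightarrow> ((\<lambda>z. conn z u) has_derivative conn' z u) (at z)"
  using smooth_on_has_derivative[OF smooth_conn[of u]] by (simp add: conn'_def[abs_def])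

lemma linear_spray': "z \<in> TV \<Longrightarrow> linear (spray' z)"
  using spray_derivative has_derivative_linear by blast

lemma linear_conn: "z \<in> TV \<Longrightarrow> linear (\<lambda>u. conn z u)"
  using linear_compose[OF _ linear_spray', of "\<lambda>u. (0, u)"] by (auto simp: o_def linear_iff)

lemma linear_conn': "z \<in> TV \<Longrightarrow> linear (conn' z u)"
  using conn_derivative has_derivative_linear by blast

lemma spray3_derivative:
  assumes "z \<in> TV"
  shows "(spray3 has_derivative (\<lambda>d.
    - (\<epsilon> * F' z d) *\<^sub>R vf (vel z) - (\<epsilon> * F z) *\<^sub>R vf (d2 (fst z) (snd z) (fst d) + d1 (fst z) (snd d))
    + (F z * F' z d) *\<^sub>R cen z + ((F z)\<^sup>2 / 2) *\<^sub>R (d1 (fst z) (fst d) + \<epsilon>\<^sup>2 *\<^sub>R vf (vf (d1 (fst z) (fst d))))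
    + (1/2) *\<^sub>R d3 (fst z) (snd z) (snd z) (fst d) + d2 (fst z) (snd z) (snd d))) (at z)"
  unfolding spray3_def[abs_def] cen_def
  by (rule has_derivative_eq_rhs,
      (rule derivative_intros F_derivative assms zero_neq_numeral[symmetric])+)
    (auto simp: fun_eq_iff vec_eq_iff vf_simps field_simps)

lemma conn3_derivative:
  assumes "z \<in> TV"
  shows "((\<lambda>z. conn3 z u) has_derivative (\<lambda>d.
    - (\<epsilon> * fy' z u d) *\<^sub>R vf (vel z) - (\<epsilon> * fy z u) *\<^sub>R vf (d2 (fst z) (snd z) (fst d) + d1 (fst z) (snd d))
    - (\<epsilon> * F' z d) *\<^sub>R vf (d1 (fst z) u) - (\<epsilon> * F z) *\<^sub>R vf (d2 (fst z) u (fst d))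
    + (F' z d * fy z u + F z * fy' z u d) *\<^sub>R cen z
    + (F z * fy z u) *\<^sub>R (d1 (fst z) (fst d) + \<epsilon>\<^sup>2 *\<^sub>R vf (vf (d1 (fst z) (fst d))))
    + d3 (fst z) u (snd z) (fst d) + d2 (fst z) u (snd d))) (at z)"
  unfolding conn3_def[abs_def] cen_def
  by (rule has_derivative_eq_rhs,
      (rule derivative_intros F_derivative fy_derivative assms)+)
    (auto simp: fun_eq_iff vec_eq_iff vf_simps field_simps)

text \<open>The product rule for \<open>d1_spray\<close>. The term
  \<open>d2 (fst z) (spray z) (fst d)\<close> depends on the chart and cancels only in the
  curvature.\<close>

lemma d1_spray':
  assumes z: "z \<in> TV"
  shows "d2 (fst z) (spray z) (fst d) + d1 (fst z) (spray' z d)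
    = - (\<epsilon> * F' z d) *\<^sub>R vf (vel z) - (\<epsilon> * F z) *\<^sub>R vf (d2 (fst z) (snd z) (fst d) + d1 (fst z) (snd d))
    + (F z * F' z d) *\<^sub>R cen z + ((F z)\<^sup>2 / 2) *\<^sub>R (d1 (fst z) (fst d) + \<epsilon>\<^sup>2 *\<^sub>R vf (vf (d1 (fst z) (fst d))))
    + (1/2) *\<^sub>R d3 (fst z) (snd z) (snd z) (fst d) + d2 (fst z) (snd z) (snd d)"
proof -
  have "((\<lambda>z. d1 (fst z) (spray z)) has_derivative
      (\<lambda>d. d2 (fst z) (spray z) (fst d) + d1 (fst z) (spray' z d))) (at z)"
    using z by (intro has_derivative_linear_family[where V = V] open_V TV_fst linear_d1 d1_derivative spray_derivative)
      (auto intro!: derivative_intros)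
  from has_derivative_eq_on[OF open_TV z d1_spray this spray3_derivative[OF z], of d]
  show ?thesis .
qed

lemma d1_conn:
  assumes z: "z \<in> TV"
  shows "d1 (fst z) (conn z u) = conn3 z u"
  using d1_spray'[OF z, of "(0, u)"]
  by (simp add: conn3_def d1_simps d2_simps TV_fst[OF z] vf_simps linear_0[OF has_derivative_linear[OF d2_derivative]]
      d2_sym[OF TV_fst[OF z], of u])

lemma d1_conn':
  assumes z: "z \<in> TV"
  shows "d2 (fst z) (conn z u) (fst d) + d1 (fst z) (conn' z u d)
    = - (\<epsilon> * fy' z u d) *\<^sub>R vf (vel z) - (\<epsilon> * fy z u) *\<^sub>R vf (d2 (fst z) (snd z) (fst d) + d1 (fst z) (snd d))
    - (\<epsilon> * F' z d) *\<^sub>R vf (d1 (fst z) u) - (\<epsilon> * F z) *\<^sub>R vf (d2 (fst z) u (fst d))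
    + (F' z d * fy z u + F z * fy' z u d) *\<^sub>R cen z
    + (F z * fy z u) *\<^sub>R (d1 (fst z) (fst d) + \<epsilon>\<^sup>2 *\<^sub>R vf (vf (d1 (fst z) (fst d))))
    + d3 (fst z) u (snd z) (fst d) + d2 (fst z) u (snd d)"
proof -
  have "((\<lambda>z. d1 (fst z) (conn z u)) has_derivative
      (\<lambda>d. d2 (fst z) (conn z u) (fst d) + d1 (fst z) (conn' z u d))) (at z)"
    using z by (intro has_derivative_linear_family[where V = V] open_V TV_fst linear_d1 d1_derivative conn_derivative)
      (auto intro!: derivative_intros)
  from has_derivative_eq_on[OF open_TV z d1_conn this conn3_derivative[OF z], of d]
  show ?thesis .
qed

text \<open>The horizontal derivative F_x - N F_y of \<open>F\<close> vanishes. By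
  \<open>rel_cen\<close> the part of \<open>conn3\<close> proportional to \<open>fy z u\<close> is
  orthogonal to \<open>rel z\<close>.\<close>

lemma fx_eq_fy_conn:
  assumes z: "z \<in> TV"
  shows "fy z (conn z u) = fx z u"
proof (rule den_cancel[OF z])
  have "rel z \<bullet> conn3 z u = fy z u * (F z * (rel z \<bullet> cen z) - \<epsilon> * (rel z \<bullet> vf (vel z)))
      + rel z \<bullet> (d2 (fst z) (snd z) u - (F z * \<epsilon>) *\<^sub>R vf (d1 (fst z) u))"
    by (simp add: conn3_def inner_add_right inner_diff_right d2_sym[OF TV_fst[OF z], of u] algebra_simps)
  then show "den z * fy z (conn z u) = den z * fx z u"
    by (simp add: den_fy[OF z] den_fx[OF z] d1_conn[OF z] rel_cen[OF z])
qed

text \<open>After applying \<open>d1\<close>, the second and third derivatives of the chart cancel,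
  and so do all terms with \<epsilon>. What survives comes from differentiating the position inside
  \<open>cen\<close>: F^2 \<open>d1\<close> u from the spray and -F F_y(u) times the velocity from
  the connection. This is curvature 1.\<close>

lemma riemann_curvature_vector:
  assumes z: "z \<in> TV"
  shows "2 *\<^sub>R spray' z (u, 0) - conn' z u (flow z) - conn z (conn z u)
    = (F z)\<^sup>2 *\<^sub>R u - (F z * fy z u) *\<^sub>R snd z"
proof -
  let ?x = "fst z" and ?y = "snd z"
  have x: "?x \<in> V" using TV_fst[OF z] .
  \<comment> \<open>Brings the third derivative from \<open>conn'\<close> into the form in which
    \<open>spray'\<close> produces it.\<close>
  have d3: "d3 ?x u ?y ?y = d3 ?x ?y ?y u"
    using d3_sym[OF x, of ?y u ?y] d3_sym_left[OF x, of u ?y ?y] by simp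
  have S: "d1 ?x (spray' z (u, 0)) = - (\<epsilon> * fx z u) *\<^sub>R vf (vel z) - (\<epsilon> * F z) *\<^sub>R vf (d2 ?x ?y u)
    + (F z * fx z u) *\<^sub>R cen z + ((F z)\<^sup>2 / 2) *\<^sub>R (d1 ?x u + \<epsilon>\<^sup>2 *\<^sub>R vf (vf (d1 ?x u)))
    + (1/2) *\<^sub>R d3 ?x ?y ?y u - d2 ?x u (spray z)"
    using d1_spray'[OF z, of "(u, 0)"] d2_sym[OF x, of u "spray z"]
    by (simp add: d1_simps d2_simps x algebra_simps)
  have C: "d1 ?x (conn' z u (flow z)) = - (\<epsilon> * fx z u) *\<^sub>R vf (vel z)
      - (\<epsilon> * fy z u) *\<^sub>R vf ((2 * F z * \<epsilon>) *\<^sub>R vf (vel z) - (F z)\<^sup>2 *\<^sub>R cen z)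
      - (\<epsilon> * F z) *\<^sub>R vf (d2 ?x ?y u) + (F z * fx z u) *\<^sub>R cen z
      + (F z * fy z u) *\<^sub>R (vel z + \<epsilon>\<^sup>2 *\<^sub>R vf (vf (vel z)))
      + d3 ?x ?y ?y u - 2 *\<^sub>R d2 ?x u (spray z) - d2 ?x ?y (conn z u)"
    using d1_conn'[OF z, of u "flow z"]
    unfolding fst_conv snd_conv vel_flow[OF z] F'_flow[OF z] fy'_flow[OF z] d3
      d2_sym[OF x, of "conn z u"] d2_sym[OF x, of u ?y]
    by (simp add: d2_simps x vel_def[symmetric] algebra_simps)
  have N: "d1 ?x (conn z (conn z u)) = - (\<epsilon> * fx z u) *\<^sub>R vf (vel z) - (\<epsilon> * F z) *\<^sub>R vf (conn3 z u)
      + (F z * fx z u) *\<^sub>R cen z + d2 ?x ?y (conn z u)"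
    unfolding d1_conn[OF z, of "conn z u"] conn3_def[of z "conn z u"] fx_eq_fy_conn[OF z] d1_conn[OF z]
      d2_sym[OF x, of "conn z u"] ..
  have "d1 ?x (2 *\<^sub>R spray' z (u, 0) - conn' z u (flow z) - conn z (conn z u))
      = d1 ?x ((F z)\<^sup>2 *\<^sub>R u - (F z * fy z u) *\<^sub>R ?y)"
    unfolding linear_diff[OF linear_d1[OF x]] linear_scale[OF linear_d1[OF x]] S C N
      conn3_def d2_sym[OF x, of u ?y] vel_def[symmetric]
    by (simp add: vec_eq_iff vf_simps) (simp add: field_simps power2_eq_square)
  then show ?thesis using d1_inject[OF x] by blast
qed

lemma geodesic_coeff_eq': "(x, y) \<in> TV \<Longrightarrow> geodesic_coeff Fc i x y = (\<lambda>z. spray z $ i) (x, y)"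
  by (simp add: geodesic_coeff_eq)

lemma pdx_geodesic_coeff: "(x, y) \<in> TV \<Longrightarrow>
    pdx k (geodesic_coeff Fc i) x y = spray' (x, y) (axis k 1, 0) $ i"
  by (rule pdx_eq[OF open_TV _ geodesic_coeff_eq'
        bounded_linear.has_derivative[OF bounded_linear_vec_nth spray_derivative]])

lemma pdy_geodesic_coeff: "(x, y) \<in> TV \<Longrightarrow>
    pdy k (geodesic_coeff Fc i) x y = conn (x, y) (axis k 1) $ i"
  by (rule pdy_eq[OF open_TV _ geodesic_coeff_eq'
        bounded_linear.has_derivative[OF bounded_linear_vec_nth spray_derivative]])

lemma pdx_pdy_geodesic_coeff: "(x, y) \<in> TV \<Longrightarrow>
    pdx j (pdy k (geodesic_coeff Fc i)) x y = conn' (x, y) (axis k 1) (axis j 1, 0) $ i"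
  by (rule pdx_eq[OF open_TV _ pdy_geodesic_coeff
        bounded_linear.has_derivative[OF bounded_linear_vec_nth conn_derivative]])

lemma pdy_pdy_geodesic_coeff: "(x, y) \<in> TV \<Longrightarrow>
    pdy j (pdy k (geodesic_coeff Fc i)) x y = conn' (x, y) (axis k 1) (0, axis j 1) $ i"
  by (rule pdy_eq[OF open_TV _ pdy_geodesic_coeff
        bounded_linear.has_derivative[OF bounded_linear_vec_nth conn_derivative]])

lemma riemann_curvature_eq:
  assumes z: "(x, y) \<in> TV"
  shows "riemann_curvature Fc i k x y
    = (F (x, y))\<^sup>2 * (if i = k then 1 else 0) - F (x, y) * fy (x, y) (axis k 1) * y $ i"
proof -
  let ?z = "(x, y)" and ?u = "axis k 1"
  have 1: "conn' ?z ?u (flow ?z) = y $ 1 *\<^sub>R conn' ?z ?u (axis 1 1, 0) + y $ 2 *\<^sub>R conn' ?z ?u (axis 2 1, 0)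
      - (2 * spray ?z $ 1) *\<^sub>R conn' ?z ?u (0, axis 1 1) - (2 * spray ?z $ 2) *\<^sub>R conn' ?z ?u (0, axis 2 1)"
  proof -
    have "flow ?z = y $ 1 *\<^sub>R (axis 1 1, 0) + y $ 2 *\<^sub>R (axis 2 1, 0)
        - (2 * spray ?z $ 1) *\<^sub>R (0, axis 1 1) - (2 * spray ?z $ 2) *\<^sub>R (0, axis 2 1)"
      by (simp add: vec_eq_iff forall_2 axis_def)
    then show ?thesis
      by (simp only: linear_diff[OF linear_conn'[OF z]] linear_add[OF linear_conn'[OF z]]
          linear_scale[OF linear_conn'[OF z]])
  qed
  have 2: "conn ?z (conn ?z ?u) = (conn ?z ?u) $ 1 *\<^sub>R conn ?z (axis 1 1) + (conn ?z ?u) $ 2 *\<^sub>R conn ?z (axis 2 1)"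
    using linear_axis_sum[OF linear_conn[OF z], of "conn ?z ?u"] by (simp add: sum_2)
  have "riemann_curvature Fc i k x y = (2 *\<^sub>R spray' ?z (?u, 0) - conn' ?z ?u (flow ?z) - conn ?z (conn ?z ?u)) $ i"
    unfolding riemann_curvature_def Let_def pdx_geodesic_coeff[OF z] pdy_geodesic_coeff[OF z]
      pdx_pdy_geodesic_coeff[OF z] pdy_pdy_geodesic_coeff[OF z] geodesic_coeff_eq[OF z] 1 2
    by (simp add: sum_2 algebra_simps)
  then show ?thesis
    unfolding riemann_curvature_vector[OF z] by (simp add: axis_def)
qed

lemma pdy_F: "(x, y) \<in> TV \<Longrightarrow> pdy k Fc x y = fy (x, y) (axis k 1)"
  by (rule pdy_eq[OF open_TV _ Fc_eq F_derivative])

section \<open>The S-curvature\<close>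

lemma gram_derivative:
  "x \<in> V \<Longrightarrow> ((\<lambda>x. gram x i j) has_derivative
     (\<lambda>d. d2 x (axis i 1) d \<bullet> d1 x (axis j 1) + d1 x (axis i 1) \<bullet> d2 x (axis j 1) d)) (at x)"
  unfolding gram_def
  by (rule has_derivative_eq_rhs[OF has_derivative_inner[OF d1_derivative d1_derivative]]) (auto simp: add.commute)

definition gram_det' :: "real^2 \<Rightarrow> real^2 \<Rightarrow> real" where
  "gram_det' x d = frechet_derivative gram_det (at x) d"

lemma gram_det_derivative:
  assumes "x \<in> V"
  shows "(gram_det has_derivative gram_det' x) (at x)"
proof -
  have "gram_det differentiable (at x)"
    unfolding gram_det_def[abs_def] differentiable_def
    by (rule exI, (rule derivative_intros gram_derivative[OF assms])+)
  then show ?thesis by (simp add: frechet_derivative_works gram_det'_def[abs_def])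
qed

lemma gram_det'_eq:
  assumes "x \<in> V"
  shows "gram_det' x d = 2 * (
     gram x 2 2 * (d2 x (axis 1 1) d \<bullet> d1 x (axis 1 1)) - gram x 1 2 * (d2 x (axis 1 1) d \<bullet> d1 x (axis 2 1))
     + gram x 1 1 * (d2 x (axis 2 1) d \<bullet> d1 x (axis 2 1)) - gram x 1 2 * (d2 x (axis 2 1) d \<bullet> d1 x (axis 1 1)))"
proof -
  have "((\<lambda>x. gram x 1 1 * gram x 2 2 - (gram x 1 2)\<^sup>2) has_derivative (\<lambda>d. 2 * (
     gram x 2 2 * (d2 x (axis 1 1) d \<bullet> d1 x (axis 1 1)) - gram x 1 2 * (d2 x (axis 1 1) d \<bullet> d1 x (axis 2 1))
     + gram x 1 1 * (d2 x (axis 2 1) d \<bullet> d1 x (axis 2 1)) - gram x 1 2 * (d2 x (axis 2 1) d \<bullet> d1 x (axis 1 1))))) (at x)"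
    by (rule has_derivative_eq_rhs, (rule derivative_eq_intros gram_derivative[OF assms] refl)+)
      (simp add: fun_eq_iff inner_commute algebra_simps)
  then show ?thesis
    using has_derivative_unique[OF gram_det_derivative[OF assms]] by (simp add: gram_det_def[abs_def])
qed

text \<open>In \<open>conn3\<close> the rotation term has trace zero because \<open>vf\<close> is
  skew, the rank-one term has trace zero by \<open>rel_cen\<close>, and the trace of the remaining
  \<open>d2\<close> term is half the logarithmic derivative of the Gram determinant.\<close>

lemma trace_conn:
  assumes z: "z \<in> TV"
  shows "2 * gram_det (fst z) * (\<Sum>i\<in>UNIV. conn z (axis i 1) $ i) = gram_det' (fst z) (snd z)"
proof -
  let ?x = "fst z" and ?y = "snd z"
  have x: "?x \<in> V" using TV_fst[OF z] .
  define a where "a = d1 ?x (axis 1 1)"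
  define b where "b = d1 ?x (axis 2 1)"
  define M where "M = F z *\<^sub>R cen z - \<epsilon> *\<^sub>R vf (vel z)"
  have D: "gram_det ?x \<noteq> 0" using gram_det_pos[OF x] by simp
  have c: "conn z u = coord ?x (conn3 z u)" for u
    using coord_d1[OF x, of "conn z u"] by (simp add: d1_conn[OF z])
  have g: "gram ?x 1 1 = a \<bullet> a" "gram ?x 1 2 = a \<bullet> b" "gram ?x 2 2 = b \<bullet> b"
    by (simp_all add: gram_def a_def b_def)
  \<comment> \<open>This number is the trace of the rank-one map that sends u to F_y(u)
    \<open>coord ?x M\<close>.\<close>
  have "fy z (coord ?x M) = 0"
  proof (rule den_cancel[OF z])
    have "F z * (rel z \<bullet> cen z) - \<epsilon> * (rel z \<bullet> vf (vel z)) = 0" using rel_cen[OF z] by simp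
    then show "den z * fy z (coord ?x M) = den z * 0"
      unfolding den_fy[OF z] d1_coord[OF x] by (simp add: inner_diff_right rel_phi[OF z] M_def)
  qed
  then have "fy z (axis 1 1) * coord ?x M $ 1 + fy z (axis 2 1) * coord ?x M $ 2 = 0"
    using linear_axis_sum[OF linear_fy[OF z], of "coord ?x M"] by (simp add: sum_2 mult.commute)
  then have f: "fy z (axis 1 1) * (b \<bullet> b * (M \<bullet> a) - a \<bullet> b * (M \<bullet> b))
      + fy z (axis 2 1) * (a \<bullet> a * (M \<bullet> b) - a \<bullet> b * (M \<bullet> a)) = 0"
    using D by (simp add: coord_def g a_def[symmetric] b_def[symmetric] add_divide_distrib[symmetric])
  have v: "vf a \<bullet> b = - (vf b \<bullet> a)" using vf_antisym[of a b] by (simp add: inner_commute)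
  have c3: "conn3 z u = fy z u *\<^sub>R M - (\<epsilon> * F z) *\<^sub>R vf (d1 ?x u) + d2 ?x u ?y" for u
    by (simp add: conn3_def M_def algebra_simps)
  have "gram_det ?x * (\<Sum>i\<in>UNIV. conn z (axis i 1) $ i)
    = b \<bullet> b * (conn3 z (axis 1 1) \<bullet> a) - a \<bullet> b * (conn3 z (axis 1 1) \<bullet> b)
      + (a \<bullet> a * (conn3 z (axis 2 1) \<bullet> b) - a \<bullet> b * (conn3 z (axis 2 1) \<bullet> a))"
    using D by (simp add: sum_2 c coord_def g a_def[symmetric] b_def[symmetric]) (simp add: field_simps)
  also have "\<dots> = b \<bullet> b * (d2 ?x (axis 1 1) ?y \<bullet> a) - a \<bullet> b * (d2 ?x (axis 1 1) ?y \<bullet> b)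
      + (a \<bullet> a * (d2 ?x (axis 2 1) ?y \<bullet> b) - a \<bullet> b * (d2 ?x (axis 2 1) ?y \<bullet> a))"
    unfolding c3 a_def[symmetric] b_def[symmetric] using f
    by (simp add: inner_add_left inner_diff_left v ring_distribs) (simp add: algebra_simps)
  finally show ?thesis
    unfolding gram_det'_eq[OF x] g a_def[symmetric] b_def[symmetric] by simp
qed

end

context sphere_chart
begin

lemma BH_density_eq:
  assumes x: "x \<in> V"
  shows "BH_density Fc x = sqrt (gram_det x)"
proof -
  define a where "a = gram x 1 1"
  define b where "b = gram x 1 2"
  \<comment> \<open>The Cholesky factor of the Gram matrix: it sends the ellipse |d1 x u| < 1 to the
    unit disc, and its determinant is the square root of the Gram determinant.\<close>
  define A :: "real^2 \<Rightarrow> real^2" where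
    "A u = (\<chi> i. if i = 1 then sqrt a * u $ 1 + b / sqrt a * u $ 2 else sqrt (gram_det x / a) * u $ 2)" for u
  define W where "W = \<epsilon> *\<^sub>R vf (\<phi> x)"
  define c where "c = coord x W"
  have a: "a > 0" using d1_eq_0[OF x, of "axis 1 1"] by (simp add: a_def gram_def axis_eq_0_iff)
  have D: "gram_det x > 0" by (rule gram_det_pos[OF x])
  have "linear A"
    by (rule linearI) (auto simp: A_def vec_eq_iff algebra_simps)
  have detA: "det (matrix A) = sqrt (gram_det x)"
    using a D by (simp add: det_2 matrix_def A_def axis_def real_sqrt_divide)
  have AA: "A u \<bullet> A u = d1 x u \<bullet> d1 x u" for u
  proof -
    have s: "sqrt a * sqrt a = a" "sqrt (gram_det x / a) * sqrt (gram_det x / a) = gram_det x / a"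
      using a D by simp_all
    have "A u \<bullet> A u = (sqrt a * sqrt a) * (u $ 1)\<^sup>2 + 2 * b * u $ 1 * u $ 2 + b\<^sup>2 / (sqrt a * sqrt a) * (u $ 2)\<^sup>2
        + (sqrt (gram_det x / a) * sqrt (gram_det x / a)) * (u $ 2)\<^sup>2"
      using a by (simp add: A_def inner_vec_def sum_2 power2_eq_square algebra_simps)
    also have "\<dots> = a * (u $ 1)\<^sup>2 + 2 * b * u $ 1 * u $ 2 + gram x 2 2 * (u $ 2)\<^sup>2"
      unfolding s using a by (simp add: gram_det_def a_def[symmetric] b_def[symmetric] field_simps)
    also have "\<dots> = d1 x u \<bullet> d1 x u"
      by (subst (1 2) d1_expand[OF x])
        (simp add: a_def b_def gram_def algebra_simps inner_commute power2_eq_square)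
    finally show ?thesis .
  qed
  have "inj A"
    using AA d1_eq_0[OF x] \<open>linear A\<close> by (metis inner_eq_zero_iff linear_injective_0)
  then obtain B where B: "linear B" "\<And>u. B (A u) = u" "\<And>u. A (B u) = u"
    using linear_injective_isomorphism[OF \<open>linear A\<close>] by blast
  have "matrix A ** matrix B = matrix (A \<circ> B)"
    using matrix_compose[OF B(1) \<open>linear A\<close>] by simp
  also have "A \<circ> B = id" using B(3) by auto
  finally have "det (matrix A) * det (matrix B) = 1"
    by (metis det_I det_mul matrix_id_mat_1)
  then have detB: "\<bar>det (matrix B)\<bar> = 1 / sqrt (gram_det x)"
    using D by (simp add: detA divide_simps abs_mult[symmetric] mult.commute)
      (metis abs_mult abs_one real_sqrt_ge_zero abs_of_nonneg less_imp_le mult.commute)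
  have W: "d1 x c = W" using d1_coord[OF x, of W] by (simp add: c_def W_def)
  have "{y. Fc x y < 1} = {y. d1 x (y - c) \<bullet> d1 x (y - c) < 1}"
    using F_eps_unit_iff(1)[OF lam_pos[OF x]]
    by (simp add: in_coords_def d1_def[symmetric] linear_diff[OF linear_d1[OF x]] W W_def)
  also have "\<dots> = (+) c ` (B ` ball 0 1)"
  proof -
    have "B ` ball 0 1 = {u. d1 x u \<bullet> d1 x u < 1}"
    proof (intro set_eqI iffI)
      fix u assume "u \<in> B ` ball 0 1"
      then show "u \<in> {u. d1 x u \<bullet> d1 x u < 1}"
        using B(3) by (auto simp: AA[symmetric] norm_lt_square power2_norm_eq_inner)
    next
      fix u assume "u \<in> {u. d1 x u \<bullet> d1 x u < 1}"
      then have "A u \<in> ball 0 1" by (simp add: AA[symmetric] norm_lt_square)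
      then show "u \<in> B ` ball 0 1" using B(2) by (metis imageI)
    qed
    then show ?thesis by (force simp: image_iff intro: exI[of _ "_ - c"])
  qed
  finally have "measure lebesgue {y. Fc x y < 1} = measure lebesgue (B ` ball 0 1)"
    by (simp add: measure_translation)
  also have "\<dots> = measure lebesgue (ball (0::real^2) 1) / sqrt (gram_det x)"
    using measure_linear_image[OF B(1), of "ball 0 1"] by (simp add: detB)
  finally show ?thesis
    using content_ball_pos[of 1 "0::real^2"] by (simp add: BH_density_def)
qed

lemma S_curvature_eq_0:
  assumes z: "(x, y) \<in> TV"
  shows "S_curvature Fc x y = 0"
proof -
  have x: "x \<in> V" using TV_fst[OF z] by simp
  have D: "gram_det x > 0" by (rule gram_det_pos[OF x])
  have pd: "pd i (BH_density Fc) x = gram_det' x (axis i 1) / (2 * sqrt (gram_det x))" for i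
  proof -
    have "((\<lambda>x. sqrt (gram_det x)) has_derivative (\<lambda>d. gram_det' x d / (2 * sqrt (gram_det x)))) (at x)"
      using D by (auto intro!: derivative_eq_intros gram_det_derivative[OF x] simp: field_simps)
    from pd_eq_open[OF open_V x BH_density_eq this] show ?thesis .
  qed
  define r where "r = sqrt (gram_det x)"
  have r: "r \<noteq> 0" "gram_det x = r * r" using D by (simp_all add: r_def)
  have "(\<Sum>i\<in>UNIV. y $ i / BH_density Fc x * pd i (BH_density Fc) x)
      = (y $ 1 * gram_det' x (axis 1 1) + y $ 2 * gram_det' x (axis 2 1)) / (2 * (r * r))"
    unfolding pd BH_density_eq[OF x] r_def[symmetric] using r(1) by (simp add: sum_2 field_simps)
  also have "\<dots> = gram_det' x y / (2 * gram_det x)"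
    using linear_axis_sum[OF has_derivative_linear[OF gram_det_derivative[OF x]], of y]
    by (simp add: sum_2 r(2))
  also have "\<dots> = (\<Sum>i\<in>UNIV. conn (x, y) (axis i 1) $ i)"
    using trace_conn[OF z] D by (simp add: field_simps)
  finally show ?thesis by (simp add: S_curvature_def pdy_geodesic_coeff[OF z])
qed

end

lemma F_eps_nonneg:
  assumes "\<epsilon>\<^sup>2 * (vf p \<bullet> vf p) < 1"
  shows "F_eps \<epsilon> p Y \<ge> 0"
proof (cases "Y = 0")
  case True
  then show ?thesis by (simp add: F_eps_def alpha_def beta_def)
next
  case False
  then show ?thesis using F_eps_unit_iff(3)[OF assms] by force
qed

lemma F_eps_scale:
  assumes "c > 0"
  shows "F_eps \<epsilon> p (c *\<^sub>R Y) = c * F_eps \<epsilon> p Y"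
proof -
  have "\<epsilon>\<^sup>2 * (vf p \<bullet> (c *\<^sub>R Y))\<^sup>2 + (c *\<^sub>R Y) \<bullet> (c *\<^sub>R Y) * l = c\<^sup>2 * (\<epsilon>\<^sup>2 * (vf p \<bullet> Y)\<^sup>2 + (Y \<bullet> Y) * l)" for l
    by (simp add: power_mult_distrib algebra_simps power2_eq_square)
  then have "alpha \<epsilon> p (c *\<^sub>R Y) = c * alpha \<epsilon> p Y"
    using assms by (simp only: alpha_def real_sqrt_mult) simp
  moreover have "beta \<epsilon> p (c *\<^sub>R Y) = c * beta \<epsilon> p Y" by (simp add: beta_def)
  ultimately show ?thesis by (simp add: F_eps_def ring_distribs)
qed

lemma finsler_metric_F_eps: "finsler_metric (U_eps \<epsilon>) (F_eps \<epsilon>)"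
  unfolding finsler_metric_def Let_def
proof (intro allI impI)
  fix V and \<phi> :: "real^2 \<Rightarrow> real^3" assume "local_coords (U_eps \<epsilon>) V \<phi>"
  then interpret sphere_chart \<epsilon> V \<phi> by unfold_locales
  show "(\<forall>x\<in>V. \<forall>y. 0 \<le> Fc x y) \<and> smooth_on (V \<times> - {0}) (\<lambda>(x, y). Fc x y) \<and>
      (\<forall>x\<in>V. \<forall>y. \<forall>c>0. Fc x (c *\<^sub>R y) = c * Fc x y) \<and>
      (\<forall>x\<in>V. \<forall>y. y \<noteq> 0 \<longrightarrow> (\<forall>u. u \<noteq> 0 \<longrightarrow> 0 < u \<bullet> (fundamental_tensor Fc x y *v u)))"
  proof (intro conjI ballI allI impI)
    fix x assume x: "x \<in> V"
    show "0 \<le> Fc x y" for y unfolding in_coords_def by (rule F_eps_nonneg[OF lam_pos[OF x]])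
    show "Fc x (c *\<^sub>R y) = c * Fc x y" if "c > 0" for c y
      using F_eps_scale[OF that] linear_scale[OF linear_d1[OF x], of c y]
      by (simp add: in_coords_def d1_def)
    show "0 < u \<bullet> (fundamental_tensor Fc x y *v u)" if "y \<noteq> 0" "u \<noteq> 0" for y u
      using fundamental_tensor_quadratic[of x y u u] fund_pos[of "(x, y)" u] x that by (simp add: TV_def)
  next
    show "smooth_on (V \<times> - {0}) (\<lambda>(x, y). Fc x y)"
      using smooth_F by (simp add: TV_def F_def[abs_def] case_prod_unfold)
  qed
qed

lemma constant_flag_curvature_F_eps: "constant_flag_curvature (U_eps \<epsilon>) (F_eps \<epsilon>) 1"
  unfolding constant_flag_curvature_def Let_def
proof (intro allI impI ballI)
  fix V and \<phi> :: "real^2 \<Rightarrow> real^3" and x and y :: "real^2" and i k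
  assume "local_coords (U_eps \<epsilon>) V \<phi>" and x: "x \<in> V" and "y \<noteq> 0"
  then interpret sphere_chart \<epsilon> V \<phi> by unfold_locales
  have "(x, y) \<in> TV" using x \<open>y \<noteq> 0\<close> by (simp add: TV_def)
  then show "riemann_curvature Fc i k x y
      = 1 * ((Fc x y)\<^sup>2 * (if i = k then 1 else 0) - Fc x y * pdy k Fc x y * y $ i)"
    by (simp add: riemann_curvature_eq pdy_F Fc_eq)
qed

lemma vanishing_S_curvature_F_eps: "vanishing_S_curvature (U_eps \<epsilon>) (F_eps \<epsilon>)"
  unfolding vanishing_S_curvature_def
proof (intro allI impI ballI)
  fix V and \<phi> :: "real^2 \<Rightarrow> real^3" and x and y :: "real^2"
  assume "local_coords (U_eps \<epsilon>) V \<phi>" and x: "x \<in> V" and "y \<noteq> 0"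
  then interpret sphere_chart \<epsilon> V \<phi> by unfold_locales
  show "S_curvature Fc x y = 0" using S_curvature_eq_0 x \<open>y \<noteq> 0\<close> by (simp add: TV_def)
qed

section \<open>Projective flatness\<close>

lemma not_locally_projectively_flat_F_eps:
  assumes "\<epsilon> \<noteq> 0"
  shows "\<not> locally_projectively_flat (U_eps \<epsilon>) (F_eps \<epsilon>)"
proof
  assume flat: "locally_projectively_flat (U_eps \<epsilon>) (F_eps \<epsilon>)"
  \<comment> \<open>The rotation fixes the north pole, so this point lies in
    \<open>U_eps \<epsilon>\<close> for every \<epsilon>.\<close>
  have v3: "vf (axis 3 1) = 0" by (simp add: vf_def vec_eq_iff forall_3 axis_def)
  then have "axis 3 1 \<in> U_eps \<epsilon>" by (simp add: U_eps_def)
  then obtain V and \<phi> :: "real^2 \<Rightarrow> real^3" and P where c: "local_coords (U_eps \<epsilon>) V \<phi>" "axis 3 1 \<in> \<phi> ` V"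
    and P: "\<And>x y i. x \<in> V \<Longrightarrow> y \<noteq> 0 \<Longrightarrow> geodesic_coeff (in_coords (F_eps \<epsilon>) \<phi>) i x y = P x y * y $ i"
    using flat unfolding locally_projectively_flat_def by metis
  interpret sphere_chart \<epsilon> V \<phi> using c(1) by unfold_locales
  obtain x where x: "x \<in> V" "\<phi> x = axis 3 1" using c(2) by force
  define y :: "real^2" where "y = axis 1 1"
  have z: "(x, y) \<in> TV" "(x, - y) \<in> TV" using x by (auto simp: TV_def y_def)
  have vel: "vel (x, - y) = - vel (x, y)" by (simp add: vel_def linear_neg[OF linear_d1[OF x(1)]])
  \<comment> \<open>Without wind at the pole, \<open>F\<close> is the Euclidean length there and
    hence even.\<close>
  have F: "F (x, - y) = F (x, y)"
  proof -
    have "(F (x, - y))\<^sup>2 = (F (x, y))\<^sup>2"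
      using rel_rel[OF z(1)] rel_rel[OF z(2)] by (simp add: rel_def wind_def x v3 vel)
    then show ?thesis using F_pos[OF z(1)] F_pos[OF z(2)] by (simp add: power2_eq_iff)
  qed
  have s: "spray3 (x, y) = P x y *\<^sub>R vel (x, y)" if "(x, y) \<in> TV" for y
  proof -
    have "spray (x, y) = P x y *\<^sub>R y"
      using P[OF x(1), of y] TV_snd[OF that] by (simp add: vec_eq_iff geodesic_coeff_eq[OF that])
    then show ?thesis
      using d1_spray[OF that] by (simp add: vel_def linear_scale[OF linear_d1[OF x(1)]])
  qed
  \<comment> \<open>The \<open>cen\<close> and \<open>d2\<close> summands are even in
    \<open>y\<close>; only the rotation term survives in the difference.\<close>
  have "- (2 * F (x, y) * \<epsilon>) *\<^sub>R vf (vel (x, y)) = spray3 (x, y) - spray3 (x, - y)"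
    using linear_neg[OF linear_d2[OF x(1)], of "- y" y] linear_neg[OF linear_d2_left[OF x(1)], of y y]
    by (simp add: spray3_def vel F cen_def vf_simps vec_eq_iff)
  also have "\<dots> = (P x y + P x (- y)) *\<^sub>R vel (x, y)"
    unfolding s[OF z(1)] s[OF z(2)] vel by (simp add: algebra_simps)
  finally have "(- (2 * F (x, y) * \<epsilon>) *\<^sub>R vf (vel (x, y))) \<bullet> vf (vel (x, y)) = 0" by simp
  then have "vf (vel (x, y)) = 0" using F_pos[OF z(1)] assms by simp
  \<comment> \<open>\<open>vf\<close> forgets only the third component, and a tangent vector at the
    pole has none.\<close>
  then have "vel (x, y) $ 1 = 0" "vel (x, y) $ 2 = 0"
    by (simp_all add: vf_def vec_eq_iff forall_3)
  moreover have "vel (x, y) $ 3 = 0"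
    using vel_phi[OF z(1)] by (simp add: x inner_axis)
  ultimately have "vel (x, y) = 0" by (simp add: vec_eq_iff forall_3)
  then show False using vel_nonzero[OF z(1)] by simp
qed

section \<open>The Riemannian part and the one-form\<close>

definition alpha_form :: "real \<Rightarrow> real^3 \<Rightarrow> real^3 \<Rightarrow> real^3 \<Rightarrow> real" where
  "alpha_form \<epsilon> p Y Z = (\<epsilon>\<^sup>2 * (vf p \<bullet> Y) * (vf p \<bullet> Z) + (1 - \<epsilon>\<^sup>2 * (vf p \<bullet> vf p)) * (Y \<bullet> Z))
     / (1 - \<epsilon>\<^sup>2 * (vf p \<bullet> vf p))\<^sup>2"

lemma alpha_form_add_left: "alpha_form \<epsilon> p (X + Y) Z = alpha_form \<epsilon> p X Z + alpha_form \<epsilon> p Y Z"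
  and alpha_form_add_right: "alpha_form \<epsilon> p Z (X + Y) = alpha_form \<epsilon> p Z X + alpha_form \<epsilon> p Z Y"
  and alpha_form_scale_left: "alpha_form \<epsilon> p (c *\<^sub>R X) Z = c * alpha_form \<epsilon> p X Z"
  and alpha_form_scale_right: "alpha_form \<epsilon> p Z (c *\<^sub>R X) = c * alpha_form \<epsilon> p Z X"
  by (simp_all add: alpha_form_def inner_add_left inner_add_right add_divide_distrib[symmetric])
    (simp_all add: algebra_simps)

lemma alpha_form_commute: "alpha_form \<epsilon> p X Y = alpha_form \<epsilon> p Y X"
  by (simp add: alpha_form_def inner_commute[of X Y] mult.commute mult.left_commute)

lemma alpha_form_pos:
  assumes "\<epsilon>\<^sup>2 * (vf p \<bullet> vf p) < 1" "Y \<noteq> 0"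
  shows "alpha_form \<epsilon> p Y Y > 0"
proof -
  have "\<epsilon>\<^sup>2 * (vf p \<bullet> Y) * (vf p \<bullet> Y) \<ge> 0" by (simp add: mult.assoc)
  then show ?thesis using assms unfolding alpha_form_def
    by (intro divide_pos_pos add_nonneg_pos) auto
qed

lemma alpha_eq_sqrt:
  assumes "\<epsilon>\<^sup>2 * (vf p \<bullet> vf p) < 1"
  shows "alpha \<epsilon> p Y = sqrt (alpha_form \<epsilon> p Y Y)"
proof -
  have "sqrt ((1 - \<epsilon>\<^sup>2 * (vf p \<bullet> vf p))\<^sup>2) = 1 - \<epsilon>\<^sup>2 * (vf p \<bullet> vf p)" using assms by simp
  then show ?thesis
    by (simp add: alpha_def alpha_form_def real_sqrt_divide power2_eq_square[of "vf p \<bullet> Y"] mult.assoc mult.commute)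
qed

context sphere_chart
begin

abbreviation ac :: "real^2 \<Rightarrow> real^2 \<Rightarrow> real" where
  "ac \<equiv> in_coords (alpha \<epsilon>) \<phi>"

lemma ac_square: "x \<in> V \<Longrightarrow> (ac x u)\<^sup>2 = alpha_form \<epsilon> (\<phi> x) (d1 x u) (d1 x u)"
  using alpha_form_pos[OF lam_pos, of x "d1 x u"]
  by (cases "d1 x u = 0") (simp_all add: in_coords_def d1_def[symmetric] alpha_eq_sqrt lam_pos alpha_form_def)

lemma metric_coeff_eq:
  assumes "x \<in> V"
  shows "metric_coeff ac x $ i $ j = alpha_form \<epsilon> (\<phi> x) (d1 x (axis i 1)) (d1 x (axis j 1))"
  by (simp add: metric_coeff_def ac_square[OF assms] linear_add[OF linear_d1[OF assms]]
      alpha_form_add_left alpha_form_add_right alpha_form_commute[of _ _ "d1 x (axis j 1)"])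

lemma metric_coeff_quadratic:
  assumes "x \<in> V"
  shows "u \<bullet> (metric_coeff ac x *v u) = alpha_form \<epsilon> (\<phi> x) (d1 x u) (d1 x u)"
  by (subst (1 2) d1_expand[OF assms])
    (simp add: inner_vec_def matrix_vector_mult_def sum_2 metric_coeff_eq[OF assms] algebra_simps
      alpha_form_add_left alpha_form_add_right alpha_form_scale_left alpha_form_scale_right)

lemmas smooth_intros_V = smooth_on_const smooth_on_add[OF open_V] smooth_on_diff[OF open_V]
  smooth_on_minus[OF open_V] smooth_on_mult[OF open_V] smooth_on_inner[OF open_V]
  smooth_on_power2[OF open_V] smooth_on_divide[OF open_V]
  smooth_on_bounded_linear[OF open_V bounded_linear_vf] smooth_phi smooth_d1

lemma smooth_metric_coeff: "smooth_on V (\<lambda>x. metric_coeff ac x $ i $ j)"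
proof (rule smooth_on_cong[OF open_V metric_coeff_eq[symmetric]])
  show "smooth_on V (\<lambda>x. alpha_form \<epsilon> (\<phi> x) (d1 x (axis i 1)) (d1 x (axis j 1)))"
    unfolding alpha_form_def by (intro smooth_intros_V) (use lam_pos in force)
qed

end

lemma riemannian_norm_alpha: "riemannian_norm (U_eps \<epsilon>) (alpha \<epsilon>)"
  unfolding riemannian_norm_def Let_def
proof (intro allI impI)
  fix V and \<phi> :: "real^2 \<Rightarrow> real^3" assume "local_coords (U_eps \<epsilon>) V \<phi>"
  then interpret sphere_chart \<epsilon> V \<phi> by unfold_locales
  show "smooth_on V (metric_coeff ac) \<and> (\<forall>x\<in>V. \<forall>u. u \<noteq> 0 \<longrightarrow> 0 < u \<bullet> (metric_coeff ac x *v u)) \<and>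
      (\<forall>x\<in>V. \<forall>y. ac x y = sqrt (y \<bullet> (metric_coeff ac x *v y)))"
  proof (intro conjI ballI allI impI)
    have "smooth_on V (\<lambda>x. \<chi> i. \<chi> j. metric_coeff ac x $ i $ j)"
      by (intro smooth_on_vec_lambda open_V smooth_metric_coeff)
    then show "smooth_on V (metric_coeff ac)" by simp
  next
    fix x and u :: "real^2" assume x: "x \<in> V"
    show "0 < u \<bullet> (metric_coeff ac x *v u)" if "u \<noteq> 0"
      using alpha_form_pos[OF lam_pos[OF x]] d1_eq_0[OF x] that by (simp add: metric_coeff_quadratic[OF x])
    show "ac x u = sqrt (u \<bullet> (metric_coeff ac x *v u))"
      by (simp add: metric_coeff_quadratic[OF x] in_coords_def d1_def[symmetric] alpha_eq_sqrt[OF lam_pos[OF x]])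
  qed
qed

lemma one_form_beta: "one_form (U_eps \<epsilon>) (beta \<epsilon>)"
  unfolding one_form_def
proof (intro allI impI)
  fix V and \<phi> :: "real^2 \<Rightarrow> real^3" assume "local_coords (U_eps \<epsilon>) V \<phi>"
  then interpret sphere_chart \<epsilon> V \<phi> by unfold_locales
  define b :: "real^2 \<Rightarrow> real^2" where "b x = (\<chi> i. beta \<epsilon> (\<phi> x) (d1 x (axis i 1)))" for x
  have "smooth_on V b"
    unfolding b_def[abs_def] beta_def
    by (intro smooth_on_vec_lambda open_V smooth_intros_V) (use lam_pos in force)
  moreover have "in_coords (beta \<epsilon>) \<phi> x y = b x \<bullet> y" if "x \<in> V" for x y
  proof -
    have "b x \<bullet> y = b x $ 1 * y $ 1 + b x $ 2 * y $ 2" by (simp add: inner_vec_def sum_2)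
    then show ?thesis
      unfolding in_coords_def d1_def[symmetric]
      by (subst d1_expand[OF that])
        (simp add: b_def beta_def inner_add_right ring_distribs add_divide_distrib mult.commute mult.left_commute)
  qed
  ultimately show "\<exists>b. smooth_on V b \<and> (\<forall>x\<in>V. \<forall>y. in_coords (beta \<epsilon>) \<phi> x y = b x \<bullet> y)" by blast
qed

text \<open>Cauchy-Schwarz bounds the quotient by \<epsilon> |v| in absolute value. The bound is
  uniform in \<open>Y\<close>: pointwise strict inequality would not make the supremum less than
  1.\<close>

lemma beta_div_alpha_le:
  assumes c: "\<epsilon>\<^sup>2 * (vf p \<bullet> vf p) < 1" and "Y \<noteq> 0"
  shows "beta \<epsilon> p Y / alpha \<epsilon> p Y \<le> sqrt (\<epsilon>\<^sup>2 * (vf p \<bullet> vf p))"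
proof -
  define k where "k = \<epsilon>\<^sup>2 * (vf p \<bullet> vf p)"
  define b where "b = \<epsilon> * (vf p \<bullet> Y)"
  define n where "n = b\<^sup>2 + (Y \<bullet> Y) * (1 - k)"
  have k: "0 \<le> k" "k < 1" using c by (simp_all add: k_def)
  have n: "n > 0" unfolding n_def using k \<open>Y \<noteq> 0\<close> by (intro add_nonneg_pos mult_pos_pos) auto
  have "b\<^sup>2 \<le> k * (Y \<bullet> Y)"
    using mult_left_mono[OF Cauchy_Schwarz_ineq[of "vf p" Y], of "\<epsilon>\<^sup>2"]
    by (simp add: b_def k_def power_mult_distrib mult.assoc)
  then have "b\<^sup>2 * (1 - k) \<le> k * (Y \<bullet> Y) * (1 - k)" using k by (intro mult_right_mono) auto
  then have "b\<^sup>2 \<le> k * n" by (simp add: n_def algebra_simps)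
  then have "\<bar>b\<bar> \<le> sqrt (k * n)" by (intro real_le_rsqrt) simp
  then have "- b \<le> sqrt k * sqrt n" by (simp add: real_sqrt_mult)
  then have "- b / sqrt n \<le> sqrt k" using n by (subst pos_divide_le_eq) auto
  moreover have "beta \<epsilon> p Y / alpha \<epsilon> p Y = - b / sqrt n"
    using k by (simp add: beta_def alpha_def k_def[symmetric] b_def[symmetric] n_def power_mult_distrib[symmetric])
  ultimately show ?thesis by (simp add: k_def)
qed

lemma randers_metric_alpha_beta: "randers_metric (U_eps \<epsilon>) (alpha \<epsilon>) (beta \<epsilon>)"
proof -
  have "finsler_metric (U_eps \<epsilon>) (\<lambda>p y. alpha \<epsilon> p y + beta \<epsilon> p y)"
    using finsler_metric_F_eps[of \<epsilon>] by (simp add: F_eps_def[abs_def])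
  moreover have "(SUP y\<in>-{0}. ereal (in_coords (beta \<epsilon>) \<phi> x y / in_coords (alpha \<epsilon>) \<phi> x y)) < 1"
    if "local_coords (U_eps \<epsilon>) V \<phi>" "x \<in> V" for V :: "(real^2) set" and \<phi> x
  proof -
    interpret sphere_chart \<epsilon> V \<phi> using that(1) by unfold_locales
    let ?k = "sqrt (\<epsilon>\<^sup>2 * (vf (\<phi> x) \<bullet> vf (\<phi> x)))"
    have "(SUP y\<in>-{0}. ereal (in_coords (beta \<epsilon>) \<phi> x y / in_coords (alpha \<epsilon>) \<phi> x y)) \<le> ereal ?k"
      using beta_div_alpha_le[OF lam_pos[OF that(2)]] d1_eq_0[OF that(2)]
      by (intro SUP_least) (simp add: in_coords_def d1_def[symmetric])
    also have "\<dots> < 1" using lam_pos[OF that(2)] by (simp add: one_ereal_def del: ereal_eq_1)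
    finally show ?thesis .
  qed
  ultimately show ?thesis
    unfolding randers_metric_def using riemannian_norm_alpha one_form_beta by blast
qed

section \<open>The domain\<close>

lemma vf_norm_sphere:
  assumes "p \<bullet> p = 1"
  shows "vf p \<bullet> vf p = 1 - (p $ 3)\<^sup>2"
  using assms by (simp add: inner_vec_def sum_3 vf_def power2_eq_square)

lemma U_eps_iff: "p \<in> U_eps \<epsilon> \<longleftrightarrow> p \<bullet> p = 1 \<and> \<epsilon>\<^sup>2 * (1 - (p $ 3)\<^sup>2) < 1"
  using vf_norm_sphere[of p] by (auto simp: U_eps_def norm_eq_1)

lemma U_eps_eq_sphere:
  assumes "\<bar>\<epsilon>\<bar> < 1"
  shows "U_eps \<epsilon> = sphere 0 1"
proof -
  have "\<epsilon>\<^sup>2 * (1 - t\<^sup>2) < 1" for t :: real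
  proof -
    have "\<epsilon>\<^sup>2 < 1" using assms by (simp add: abs_square_less_1)
    moreover have "\<epsilon>\<^sup>2 * (1 - t\<^sup>2) \<le> \<epsilon>\<^sup>2 * 1" by (intro mult_left_mono) auto
    ultimately show ?thesis by simp
  qed
  then show ?thesis by (auto simp: U_eps_iff norm_eq_1)
qed

lemma arccos_less_arcsin_iff:
  assumes "0 < s" "s \<le> 1" "\<bar>t\<bar> \<le> 1"
  shows "arccos t < arcsin s \<longleftrightarrow> sqrt (1 - s\<^sup>2) < t"
proof -
  have "arcsin s = arccos (sqrt (1 - s\<^sup>2))"
  proof (rule sym, rule arccos_unique)
    show "0 \<le> arcsin s" using assms arcsin_le_arcsin[of 0 s] by simp
    show "arcsin s \<le> pi" using arcsin_bounded[of s] assms pi_gt_zero by linarith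
    show "cos (arcsin s) = sqrt (1 - s\<^sup>2)" using assms by (intro cos_arcsin) auto
  qed
  moreover have "\<bar>sqrt (1 - s\<^sup>2)\<bar> \<le> 1" using assms by (simp add: power_le_one abs_square_le_1)
  ultimately show ?thesis using arccos_less_mono[of t "sqrt (1 - s\<^sup>2)"] assms by simp
qed

text \<open>With z the height, the condition \<epsilon>^2 (1 - z^2) < 1 says that |z| exceeds the
  cosine of the radius; the sign of z selects the disk.\<close>

lemma U_eps_eq_disks:
  assumes "\<bar>\<epsilon>\<bar> \<ge> 1"
  shows "U_eps \<epsilon> = sphere_disk (vector [0, 0, 1]) (arcsin (1 / \<bar>\<epsilon>\<bar>))
                        \<union> sphere_disk (vector [0, 0, -1]) (arcsin (1 / \<bar>\<epsilon>\<bar>))"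
proof -
  have s: "0 < 1 / \<bar>\<epsilon>\<bar>" "1 / \<bar>\<epsilon>\<bar> \<le> 1" using assms by auto
  have "p \<in> U_eps \<epsilon> \<longleftrightarrow> arccos (vector [0, 0, 1] \<bullet> p) < arcsin (1 / \<bar>\<epsilon>\<bar>)
      \<or> arccos (vector [0, 0, -1] \<bullet> p) < arcsin (1 / \<bar>\<epsilon>\<bar>)" if p: "p \<bullet> p = 1" for p :: "real^3"
  proof -
    have dot: "vector [0, 0, 1] \<bullet> p = p $ 3" "vector [0, 0, -1] \<bullet> p = - p $ 3"
      by (simp_all add: inner_vec_def sum_3)
    have "\<bar>p $ 3\<bar> \<le> 1" using component_le_norm_cart[of p 3] p norm_eq_1[of p] by simp
    moreover have "p \<in> U_eps \<epsilon> \<longleftrightarrow> sqrt (1 - (1 / \<bar>\<epsilon>\<bar>)\<^sup>2) < \<bar>p $ 3\<bar>"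
    proof -
      have "p \<in> U_eps \<epsilon> \<longleftrightarrow> 1 - (1 / \<bar>\<epsilon>\<bar>)\<^sup>2 < (p $ 3)\<^sup>2"
        using assms by (simp add: U_eps_iff p field_simps)
      also have "\<dots> \<longleftrightarrow> sqrt (1 - (1 / \<bar>\<epsilon>\<bar>)\<^sup>2) < sqrt ((p $ 3)\<^sup>2)" by (simp only: real_sqrt_less_iff)
      finally show ?thesis by simp
    qed
    ultimately show ?thesis
      unfolding dot using arccos_less_arcsin_iff[OF s, of "p $ 3"] arccos_less_arcsin_iff[OF s, of "- p $ 3"] by auto
  qed
  then show ?thesis by (auto simp: sphere_disk_def norm_eq_1 U_eps_iff)
qed

section \<open>Curvature from a moving frame\<close>

lemma pd_frechet:
  fixes f :: "real^'n::finite \<Rightarrow> real"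
  assumes "smooth_on S f" "x \<in> S"
  shows "pd i f x = frechet_derivative f (at x) (axis i 1)"
  by (rule pd_eq[OF smooth_on_has_derivative[OF assms]])

lemma smooth_on_pd:
  fixes f :: "real^'n::finite \<Rightarrow> real"
  assumes "open S" "smooth_on S f"
  shows "smooth_on S (pd i f)"
  by (rule smooth_on_cong[OF assms(1) pd_frechet[OF assms(2), symmetric] smooth_on_derivative[OF assms(2)]])

lemma matrix_inv_2:
  fixes A :: "real^2^2"
  assumes "det A \<noteq> 0"
  shows "matrix_inv A $ 1 $ 1 = A $ 2 $ 2 / det A" "matrix_inv A $ 1 $ 2 = - A $ 1 $ 2 / det A"
    "matrix_inv A $ 2 $ 1 = - A $ 2 $ 1 / det A" "matrix_inv A $ 2 $ 2 = A $ 1 $ 1 / det A"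
proof -
  define B :: "real^2^2" where
    "B = (1 / det A) *\<^sub>R vector [vector [A $ 2 $ 2, - A $ 1 $ 2], vector [- A $ 2 $ 1, A $ 1 $ 1]]"
  have "A ** B = mat 1"
    using assms
    by (simp add: B_def matrix_matrix_mult_def mat_def vec_eq_iff forall_2 sum_2 divide_simps)
      (simp add: det_2 algebra_simps)
  then have "matrix_inv A = B"
    using matrix_inv_left_inverse[of A] assms
    by (metis invertible_det_nz matrix_mul_assoc matrix_mul_lid matrix_mul_rid)
  then show "matrix_inv A $ 1 $ 1 = A $ 2 $ 2 / det A" "matrix_inv A $ 1 $ 2 = - A $ 1 $ 2 / det A"
    "matrix_inv A $ 2 $ 1 = - A $ 2 $ 1 / det A" "matrix_inv A $ 2 $ 2 = A $ 1 $ 1 / det A"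
    by (simp_all add: B_def)
qed

lemma smooth_on_christoffel:
  fixes a :: "real^2 \<Rightarrow> real^2^2"
  assumes "open S" "\<And>i j. smooth_on S (\<lambda>x. a x $ i $ j)" "\<And>x. x \<in> S \<Longrightarrow> det (a x) \<noteq> 0"
  shows "smooth_on S (christoffel a k i j)"
proof -
  have det: "smooth_on S (\<lambda>x. det (a x))"
    unfolding det_2 by (intro smooth_on_diff smooth_on_mult assms)
  have "smooth_on S (\<lambda>x. matrix_inv (a x) $ k $ l)" for k l
  proof -
    have "smooth_on S (\<lambda>x. matrix_inv (a x) $ 1 $ 1)"
      by (rule smooth_on_cong[OF assms(1) matrix_inv_2(1)[OF assms(3), symmetric]], assumption)
        (intro smooth_on_divide smooth_on_minus det assms)
    moreover have "smooth_on S (\<lambda>x. matrix_inv (a x) $ 1 $ 2)"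
      by (rule smooth_on_cong[OF assms(1) matrix_inv_2(2)[OF assms(3), symmetric]], assumption)
        (intro smooth_on_divide smooth_on_minus det assms)
    moreover have "smooth_on S (\<lambda>x. matrix_inv (a x) $ 2 $ 1)"
      by (rule smooth_on_cong[OF assms(1) matrix_inv_2(3)[OF assms(3), symmetric]], assumption)
        (intro smooth_on_divide smooth_on_minus det assms)
    moreover have "smooth_on S (\<lambda>x. matrix_inv (a x) $ 2 $ 2)"
      by (rule smooth_on_cong[OF assms(1) matrix_inv_2(4)[OF assms(3), symmetric]], assumption)
        (intro smooth_on_divide smooth_on_minus det assms)
    ultimately show ?thesis using exhaust_2[of k] exhaust_2[of l] by auto
  qed
  then show ?thesis
    unfolding christoffel_def[abs_def]
    by (intro smooth_on_mult smooth_on_const smooth_on_sum smooth_on_add smooth_on_diff smooth_on_pd assms)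
qed

text \<open>Supplies the continuity of the Gauss curvature at the poles, where the adapted frame is
  not defined.\<close>

lemma smooth_on_curvature_tensor:
  fixes a :: "real^2 \<Rightarrow> real^2^2"
  assumes "open S" "\<And>i j. smooth_on S (\<lambda>x. a x $ i $ j)" "\<And>x. x \<in> S \<Longrightarrow> det (a x) \<noteq> 0"
  shows "smooth_on S (curvature_tensor a l k i j)"
  unfolding curvature_tensor_def[abs_def]
  by (intro smooth_on_mult smooth_on_sum smooth_on_add smooth_on_diff smooth_on_pd
      smooth_on_christoffel assms)

text \<open>\<open>E i\<close> holds the components of \<open>\<partial>\<^sub>i\<close> in an orthonormal frame as one complex number, so that the
  connection form \<open>om\<close> acts by multiplication with \<open>om \<i>\<close>.\<close>

locale moving_frame =
  fixes V :: "(real^2) set" and a :: "real^2 \<Rightarrow> real^2^2"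
    and E :: "2 \<Rightarrow> real^2 \<Rightarrow> complex" and om :: "2 \<Rightarrow> real^2 \<Rightarrow> real"
  assumes open_V: "open V"
    and smooth_E: "\<And>i. smooth_on V (E i)" and smooth_om: "\<And>i. smooth_on V (om i)"
    and metric: "\<And>x i j. x \<in> V \<Longrightarrow> a x $ i $ j = E i x \<bullet> E j x"
    and torsion_free: "\<And>x. x \<in> V \<Longrightarrow>
      frechet_derivative (E 2) (at x) (axis 1 1) + om 1 x *\<^sub>R (\<i> * E 2 x)
      = frechet_derivative (E 1) (at x) (axis 2 1) + om 2 x *\<^sub>R (\<i> * E 1 x)"
    and area: "\<And>x. x \<in> V \<Longrightarrow> Im (cnj (E 1 x) * E 2 x) \<noteq> 0"
begin

definition dE :: "2 \<Rightarrow> 2 \<Rightarrow> real^2 \<Rightarrow> complex" where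
  "dE j k x = frechet_derivative (E k) (at x) (axis j 1)"

text \<open>The covariant derivative of the k-th coordinate field along the j-th, in frame
  components.\<close>

definition T :: "2 \<Rightarrow> 2 \<Rightarrow> real^2 \<Rightarrow> complex" where
  "T j k x = dE j k x + om j x *\<^sub>R (\<i> * E k x)"

lemma T_sym: "x \<in> V \<Longrightarrow> T j k x = T k j x"
  using torsion_free[of x] exhaust_2[of j] exhaust_2[of k] by (auto simp: T_def dE_def)

lemma smooth_a: "smooth_on V (\<lambda>x. a x $ i $ j)"
  by (rule smooth_on_cong[OF open_V metric[symmetric]], assumption) (intro smooth_on_inner open_V smooth_E)

lemma det_a: "x \<in> V \<Longrightarrow> det (a x) = (Im (cnj (E 1 x) * E 2 x))\<^sup>2"
  by (simp add: det_2 metric inner_complex_def power2_eq_square algebra_simps)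

lemma det_a_nonzero: "x \<in> V \<Longrightarrow> det (a x) \<noteq> 0"
  using area by (simp add: det_a)

lemma smooth_dE: "smooth_on V (dE j k)"
  unfolding dE_def[abs_def] by (rule smooth_on_derivative[OF smooth_E])

lemma inner_i_antisym: "(\<i> * u) \<bullet> v = - ((\<i> * v) \<bullet> u)" for u v :: complex
  by (simp add: inner_complex_def algebra_simps)

text \<open>Metric compatibility: multiplication by \<open>\<i>\<close> is skew, so the two
  connection terms cancel.\<close>

lemma pd_a:
  assumes "x \<in> V"
  shows "pd i (\<lambda>x. a x $ j $ l) x = T i j x \<bullet> E l x + T i l x \<bullet> E j x"
proof -
  have "pd i (\<lambda>x. a x $ j $ l) x
      = E j x \<bullet> frechet_derivative (E l) (at x) (axis i 1) + frechet_derivative (E j) (at x) (axis i 1) \<bullet> E l x"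
    by (rule pd_eq_open[OF open_V assms metric])
      (assumption, rule has_derivative_inner[OF smooth_on_has_derivative[OF smooth_E assms] smooth_on_has_derivative[OF smooth_E assms]])
  then show ?thesis
    using inner_i_antisym[of "E l x" "E j x"]
    by (simp add: T_def dE_def inner_add_left inner_commute[of "E j x"])
qed

text \<open>The Koszul argument: with metric compatibility and symmetry of \<open>T\<close>, the
  bracket in the Christoffel symbol collapses to twice
  \<open>T j k x \<bullet> E l x\<close>.\<close>

lemma frame_christoffel:
  assumes x: "x \<in> V"
  shows "christoffel a 1 j k x *\<^sub>R E 1 x + christoffel a 2 j k x *\<^sub>R E 2 x = T j k x"
proof -
  let ?ai = "matrix_inv (a x)"
  define w where "w = christoffel a 1 j k x *\<^sub>R E 1 x + christoffel a 2 j k x *\<^sub>R E 2 x - T j k x"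
  have c: "christoffel a m j k x = (\<Sum>l\<in>UNIV. ?ai $ m $ l * (T j k x \<bullet> E l x))" for m
    unfolding christoffel_def sum_2 pd_a[OF x] T_sym[OF x, of k j] T_sym[OF x, of 1 j]
      T_sym[OF x, of 2 j] T_sym[OF x, of 1 k] T_sym[OF x, of 2 k]
    by simp
  have inv: "invertible (a x)" using det_a_nonzero[OF x] invertible_det_nz by blast
  have "(?ai ** a x) $ l $ m = mat 1 $ l $ m" for l m
    using matrix_inv_left_inverse[OF inv] by simp
  then have ai: "?ai $ l $ 1 * (E 1 x \<bullet> E m x) + ?ai $ l $ 2 * (E 2 x \<bullet> E m x) = (if l = m then 1 else 0)" for l m
    by (simp add: matrix_matrix_mult_def sum_2 mat_def metric[OF x])
  have sym: "?ai $ 2 $ 1 = ?ai $ 1 $ 2"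
    using matrix_inv_2[OF det_a_nonzero[OF x]] by (simp add: metric[OF x] inner_commute)
  have "w \<bullet> E m x = 0" for m
  proof -
    have "w \<bullet> E m x = (T j k x \<bullet> E 1 x) * (?ai $ 1 $ 1 * (E 1 x \<bullet> E m x) + ?ai $ 1 $ 2 * (E 2 x \<bullet> E m x))
        + (T j k x \<bullet> E 2 x) * (?ai $ 2 $ 1 * (E 1 x \<bullet> E m x) + ?ai $ 2 $ 2 * (E 2 x \<bullet> E m x)) - T j k x \<bullet> E m x"
      unfolding w_def c sym by (simp add: sum_2 inner_add_left inner_diff_left sym algebra_simps)
    then show ?thesis unfolding ai using exhaust_2[of m] by auto
  qed
  then have o: "Re w * Re (E m x) + Im w * Im (E m x) = 0" for m by (simp add: inner_complex_def)
  \<comment> \<open>\<open>w\<close> is orthogonal to \<open>E 1 x\<close> and \<open>E 2 x\<close>;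
    the determinant of this linear system is the nonzero area.\<close>
  have "Im (cnj (E 1 x) * E 2 x) * Re w = 0" "Im (cnj (E 1 x) * E 2 x) * Im w = 0"
    using o[of 1] o[of 2] by (simp_all, algebra+)
  then have "w = 0" using area[OF x] by (simp add: complex_eq_iff)
  then show ?thesis by (simp add: w_def)
qed

text \<open>Cartan's second structure equation. Plane rotations commute, so the terms quadratic in
  \<open>om\<close> drop out and only the exterior derivative of \<open>om\<close> remains.\<close>

lemma frame_curvature:
  assumes x: "x \<in> V"
  shows "curvature_tensor a 1 k i j x *\<^sub>R E 1 x + curvature_tensor a 2 k i j x *\<^sub>R E 2 x
    = (pd i (om j) x - pd j (om i) x) *\<^sub>R (\<i> * E k x)"
proof -
  let ?G = "\<lambda>m j k. christoffel a m j k x"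
  have sG: "smooth_on V (christoffel a m j k)" for m j k
    by (rule smooth_on_christoffel[OF open_V smooth_a det_a_nonzero])
  have dE_eq: "dE j k x = T j k x - om j x *\<^sub>R (\<i> * E k x)" for j k by (simp add: T_def)
  have der: "pd i (christoffel a 1 j k) x *\<^sub>R E 1 x + pd i (christoffel a 2 j k) x *\<^sub>R E 2 x
      = frechet_derivative (dE j k) (at x) (axis i 1) + pd i (om j) x *\<^sub>R (\<i> * E k x)
        + om j x *\<^sub>R (\<i> * dE i k x)
        - ?G 1 j k *\<^sub>R dE i 1 x - ?G 2 j k *\<^sub>R dE i 2 x" for i j
  proof -
    note D = smooth_on_has_derivative[OF _ x]
    have L: "((\<lambda>x. christoffel a 1 j k x *\<^sub>R E 1 x + christoffel a 2 j k x *\<^sub>R E 2 x) has_derivative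
      (\<lambda>d. ?G 1 j k *\<^sub>R frechet_derivative (E 1) (at x) d + frechet_derivative (christoffel a 1 j k) (at x) d *\<^sub>R E 1 x
        + (?G 2 j k *\<^sub>R frechet_derivative (E 2) (at x) d + frechet_derivative (christoffel a 2 j k) (at x) d *\<^sub>R E 2 x))) (at x)"
      by (intro has_derivative_add has_derivative_scaleR D sG smooth_E)
    have R: "(T j k has_derivative (\<lambda>d. frechet_derivative (dE j k) (at x) d
        + (om j x *\<^sub>R (\<i> * frechet_derivative (E k) (at x) d) + frechet_derivative (om j) (at x) d *\<^sub>R (\<i> * E k x)))) (at x)"
      unfolding T_def[abs_def]
      by (intro has_derivative_add has_derivative_scaleR has_derivative_mult_right D smooth_dE smooth_E smooth_om)
    from has_derivative_eq_on[OF open_V x frame_christoffel L R, of "axis i 1"]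
    show ?thesis unfolding pd_frechet[OF sG x] pd_frechet[OF smooth_om x] dE_def
      by (simp add: algebra_simps)
  qed
  have sym: "frechet_derivative (dE j k) (at x) (axis i 1) = frechet_derivative (dE i k) (at x) (axis j 1)"
    unfolding dE_def[abs_def] by (rule symmetric_second_derivative_smooth[OF open_V x smooth_E])
  have "curvature_tensor a 1 k i j x *\<^sub>R E 1 x + curvature_tensor a 2 k i j x *\<^sub>R E 2 x
    = (pd i (christoffel a 1 j k) x *\<^sub>R E 1 x + pd i (christoffel a 2 j k) x *\<^sub>R E 2 x)
    - (pd j (christoffel a 1 i k) x *\<^sub>R E 1 x + pd j (christoffel a 2 i k) x *\<^sub>R E 2 x)
    + (?G 1 j k *\<^sub>R (?G 1 i 1 *\<^sub>R E 1 x + ?G 2 i 1 *\<^sub>R E 2 x) + ?G 2 j k *\<^sub>R (?G 1 i 2 *\<^sub>R E 1 x + ?G 2 i 2 *\<^sub>R E 2 x))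
    - (?G 1 i k *\<^sub>R (?G 1 j 1 *\<^sub>R E 1 x + ?G 2 j 1 *\<^sub>R E 2 x) + ?G 2 i k *\<^sub>R (?G 1 j 2 *\<^sub>R E 1 x + ?G 2 j 2 *\<^sub>R E 2 x))"
    by (simp add: curvature_tensor_def sum_2 algebra_simps)
  also have "\<dots> = (pd i (om j) x - pd j (om i) x) *\<^sub>R (\<i> * E k x)
      + om j x *\<^sub>R (\<i> * dE i k x) - om i x *\<^sub>R (\<i> * dE j k x)
      + om i x *\<^sub>R (\<i> * (?G 1 j k *\<^sub>R E 1 x + ?G 2 j k *\<^sub>R E 2 x))
      - om j x *\<^sub>R (\<i> * (?G 1 i k *\<^sub>R E 1 x + ?G 2 i k *\<^sub>R E 2 x))"
    unfolding der frame_christoffel[OF x, of _ 1] frame_christoffel[OF x, of _ 2] sym dE_eq[of _ 1] dE_eq[of _ 2]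
    by (simp add: algebra_simps)
  also have "\<dots> = (pd i (om j) x - pd j (om i) x) *\<^sub>R (\<i> * E k x)"
    by (simp only: frame_christoffel[OF x] T_def) (simp add: algebra_simps)
  finally show ?thesis .
qed

text \<open>Pairing \<open>\<i> * E 2 x\<close> with \<open>E 1 x\<close> gives minus the area,
  while the determinant of the metric is the square of the area.\<close>

lemma frame_gauss:
  assumes x: "x \<in> V"
  shows "(\<Sum>l\<in>UNIV. curvature_tensor a l 2 1 2 x * a x $ l $ 1) / det (a x)
    = - (pd 1 (om 2) x - pd 2 (om 1) x) / Im (cnj (E 1 x) * E 2 x)"
proof -
  have "(\<Sum>l\<in>UNIV. curvature_tensor a l 2 1 2 x * a x $ l $ 1)
      = (curvature_tensor a 1 2 1 2 x *\<^sub>R E 1 x + curvature_tensor a 2 2 1 2 x *\<^sub>R E 2 x) \<bullet> E 1 x"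
    by (simp add: sum_2 metric[OF x] inner_add_left)
  also have "\<dots> = - (pd 1 (om 2) x - pd 2 (om 1) x) * Im (cnj (E 1 x) * E 2 x)"
    unfolding frame_curvature[OF x] by (simp add: inner_complex_def algebra_simps)
  finally show ?thesis using area[OF x] by (simp add: det_a[OF x] power2_eq_square)
qed

end

section \<open>The Gauss curvature of the Riemannian part\<close>

text \<open>The Gauss curvature of \<alpha> at height \<open>t\<close>. For \<epsilon>^2 = 1 the
  numerator is -4 times the denominator.\<close>

definition gauss_profile :: "real \<Rightarrow> real \<Rightarrow> real" where
  "gauss_profile \<epsilon> t = (1 - 5 * \<epsilon>\<^sup>2 + (5 * \<epsilon>\<^sup>2 - \<epsilon> ^ 4) * (1 - t\<^sup>2)) / (1 - \<epsilon>\<^sup>2 * (1 - t\<^sup>2))"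

context sphere_chart
begin

text \<open>With the height \<open>z\<close>, the 1-form \<open>\<psi> = h(v, \<cdot>)\<close> (\<open>angular\<close>) and \<open>\<lambda> = 1 - \<epsilon>\<^sup>2 (1 - z\<^sup>2)\<close>, the metric is
  \<open>\<alpha>\<^sup>2 = dz\<^sup>2 / (\<lambda> (1 - z\<^sup>2)) + \<psi>\<^sup>2 / (\<lambda>\<^sup>2 (1 - z\<^sup>2))\<close>, which provides an orthonormal frame away from the poles;
  \<open>iz\<close> and \<open>ir\<close> are \<open>(1 - z\<^sup>2)\<^bsup>-1/2\<^esup>\<close> and \<open>\<lambda>\<^bsup>-1/2\<^esup>\<close>. The poles are reached by continuity.\<close>

definition height :: "real^2 \<Rightarrow> real" where "height x = \<phi> x $ 3"

definition height' :: "2 \<Rightarrow> real^2 \<Rightarrow> real" where "height' k x = d1 x (axis k 1) $ 3"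

definition angular :: "2 \<Rightarrow> real^2 \<Rightarrow> real" where "angular k x = vf (\<phi> x) \<bullet> d1 x (axis k 1)"

definition Vr :: "(real^2) set" where "Vr = {x \<in> V. (height x)\<^sup>2 < 1}"

definition iz :: "real^2 \<Rightarrow> real" where "iz x = 1 / sqrt (1 - (height x)\<^sup>2)"

definition ir :: "real^2 \<Rightarrow> real" where "ir x = 1 / sqrt (1 - \<epsilon>\<^sup>2 * (1 - (height x)\<^sup>2))"

definition frame :: "2 \<Rightarrow> real^2 \<Rightarrow> complex" where
  "frame k x = (iz x * ir x * height' k x) *\<^sub>R 1 + (iz x * (ir x)\<^sup>2 * angular k x) *\<^sub>R \<i>"

text \<open>Found by solving the torsion equation for a multiple of \<open>angular\<close>: the
  factor is -z (P + 2 \<epsilon>^2 R) \<open>ir\<close>, where P and R are the squares of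
  \<open>iz\<close> and \<open>ir\<close> and z is the height. The body has this sum over a common
  denominator.\<close>

definition conn_form :: "2 \<Rightarrow> real^2 \<Rightarrow> real" where
  "conn_form k x = - (height x * (1 + \<epsilon>\<^sup>2 * (1 - (height x)\<^sup>2)) * (iz x)\<^sup>2 * (ir x)\<^sup>2 * ir x) * angular k x"

lemma r2_pos: "x \<in> V \<Longrightarrow> \<epsilon>\<^sup>2 * (1 - (height x)\<^sup>2) < 1"
  using phi_in_U[of x] by (simp add: U_eps_iff height_def)

lemma smooth_height: "smooth_on V height"
  unfolding height_def[abs_def]
  by (rule smooth_on_bounded_linear[OF open_V bounded_linear_vec_nth smooth_phi])

lemma height_derivative: "x \<in> V \<Longrightarrow> (height has_derivative (\<lambda>d. d1 x d $ 3)) (at x)"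
  unfolding height_def[abs_def]
  by (rule bounded_linear.has_derivative[OF bounded_linear_vec_nth phi_derivative])

lemma open_Vr: "open Vr"
proof -
  have "Vr = V \<inter> (\<lambda>x. (height x)\<^sup>2) -` {..<1}" by (auto simp: Vr_def)
  then show ?thesis
    using continuous_on_open_vimage[OF open_V, of "\<lambda>x. (height x)\<^sup>2"]
      continuous_on_power[OF smooth_on_continuous_on[OF smooth_height]]
    by (metis Int_commute open_lessThan)
qed

lemma Vr_V: "x \<in> Vr \<Longrightarrow> x \<in> V" and s2_pos: "x \<in> Vr \<Longrightarrow> (height x)\<^sup>2 < 1"
  by (auto simp: Vr_def)

lemma smooth_on_Vr: "smooth_on V f \<Longrightarrow> smooth_on Vr f"
  by (rule smooth_on_subset[OF open_Vr]) (auto simp: Vr_V)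

lemma iz_square: "x \<in> Vr \<Longrightarrow> (iz x)\<^sup>2 * (1 - (height x)\<^sup>2) = 1"
  using s2_pos[of x] by (simp add: iz_def power_divide)

lemma ir_square: "x \<in> V \<Longrightarrow> (ir x)\<^sup>2 * (1 - \<epsilon>\<^sup>2 * (1 - (height x)\<^sup>2)) = 1"
  using r2_pos[of x] by (simp add: ir_def power_divide)

lemma smooth_iz: "smooth_on Vr iz"
  unfolding iz_def[abs_def]
  by (intro smooth_on_divide smooth_on_sqrt smooth_on_diff smooth_on_power2 smooth_on_const
      smooth_on_Vr[OF smooth_height] open_Vr) (use s2_pos in fastforce)+

lemma smooth_ir: "smooth_on Vr ir"
  unfolding ir_def[abs_def]
  by (intro smooth_on_divide smooth_on_sqrt smooth_on_diff smooth_on_mult smooth_on_power2 smooth_on_const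
      smooth_on_Vr[OF smooth_height] open_Vr) (use r2_pos[OF Vr_V] in fastforce)+

lemma smooth_height': "smooth_on Vr (height' k)"
  unfolding height'_def[abs_def]
  by (intro smooth_on_Vr smooth_on_bounded_linear[OF open_V bounded_linear_vec_nth] smooth_d1)

lemma smooth_angular: "smooth_on Vr (angular k)"
  unfolding angular_def[abs_def] by (intro smooth_on_Vr smooth_intros_V)

lemmas smooth_intros_Vr = smooth_on_const smooth_on_add[OF open_Vr] smooth_on_diff[OF open_Vr]
  smooth_on_minus[OF open_Vr] smooth_on_mult[OF open_Vr] smooth_on_scaleR[OF open_Vr]
  smooth_on_power2[OF open_Vr] smooth_iz smooth_ir smooth_height' smooth_angular
  smooth_on_Vr[OF smooth_height]

lemma smooth_frame: "smooth_on Vr (frame k)"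
  unfolding frame_def[abs_def] by (intro smooth_intros_Vr)

lemma smooth_conn_form: "smooth_on Vr (conn_form k)"
  unfolding conn_form_def[abs_def] by (intro smooth_intros_Vr)

lemma iz_derivative:
  assumes x: "x \<in> Vr"
  shows "(iz has_derivative (\<lambda>d. iz x * (iz x)\<^sup>2 * height x * (d1 x d $ 3))) (at x)"
proof -
  have p: "1 - (height x)\<^sup>2 > 0" using s2_pos[OF x] by simp
  then have s: "sqrt (1 - (height x)\<^sup>2) > 0" "sqrt (1 - (height x)\<^sup>2) * sqrt (1 - (height x)\<^sup>2) = 1 - (height x)\<^sup>2"
    by simp_all
  have "((\<lambda>t. 1 / sqrt (1 - t\<^sup>2)) has_real_derivative iz x * (iz x)\<^sup>2 * height x) (at (height x))"
    using p s by (auto intro!: derivative_eq_intros simp: iz_def power_divide divide_simps)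
  from DERIV_compose_FDERIV[OF this height_derivative[OF Vr_V[OF x]]]
  show ?thesis by (simp add: iz_def[abs_def] mult_ac)
qed

lemma ir_derivative:
  assumes x: "x \<in> Vr"
  shows "(ir has_derivative (\<lambda>d. - ir x * (ir x)\<^sup>2 * \<epsilon>\<^sup>2 * height x * (d1 x d $ 3))) (at x)"
proof -
  let ?r = "\<lambda>t. 1 - \<epsilon>\<^sup>2 * (1 - t\<^sup>2)"
  have p: "?r (height x) > 0" using r2_pos[OF Vr_V[OF x]] by simp
  then have s: "sqrt (?r (height x)) > 0" "sqrt (?r (height x)) * sqrt (?r (height x)) = ?r (height x)"
    by simp_all
  have "((\<lambda>t. 1 / sqrt (?r t)) has_real_derivative - ir x * (ir x)\<^sup>2 * \<epsilon>\<^sup>2 * height x) (at (height x))"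
    using p s by (auto intro!: derivative_eq_intros simp: ir_def power_divide divide_simps)
  from DERIV_compose_FDERIV[OF this height_derivative[OF Vr_V[OF x]]]
  show ?thesis by (simp add: ir_def[abs_def] mult_ac)
qed

lemma height'_derivative: "x \<in> V \<Longrightarrow> (height' k has_derivative (\<lambda>d. d2 x (axis k 1) d $ 3)) (at x)"
  unfolding height'_def[abs_def]
  by (rule bounded_linear.has_derivative[OF bounded_linear_vec_nth d1_derivative])

lemma angular_derivative: "x \<in> V \<Longrightarrow> (angular k has_derivative
    (\<lambda>d. vf (\<phi> x) \<bullet> d2 x (axis k 1) d + vf (d1 x d) \<bullet> d1 x (axis k 1))) (at x)"
  unfolding angular_def[abs_def]
  by (rule has_derivative_inner[OF has_derivative_vf[OF phi_derivative] d1_derivative])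

lemma horizontal: "x \<in> V \<Longrightarrow> \<phi> x $ 1 * d1 x u $ 1 + \<phi> x $ 2 * d1 x u $ 2 = - (height x * d1 x u $ 3)"
  using phi_d1[of x u] by (simp add: inner_vec_def sum_3 height_def)

lemma radius: "x \<in> V \<Longrightarrow> (\<phi> x $ 1)\<^sup>2 + (\<phi> x $ 2)\<^sup>2 = 1 - (height x)\<^sup>2"
  using phi_unit[of x] by (simp add: inner_vec_def sum_3 height_def power2_eq_square)

text \<open>On the sphere the gradient of the height z and the field v are orthogonal, both of
  squared length 1 - z^2; hence (1 - z^2) h = dz^2 + \<psi>^2.\<close>

lemma gram_height_angular:
  assumes x: "x \<in> V"
  shows "(1 - (height x)\<^sup>2) * gram x i j = height' i x * height' j x + angular i x * angular j x"
proof -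
  have a: "angular k x = \<phi> x $ 1 * d1 x (axis k 1) $ 2 - \<phi> x $ 2 * d1 x (axis k 1) $ 1" for k
    by (simp add: angular_def vf_def inner_vec_def sum_3)
  have g: "gram x i j = d1 x (axis i 1) $ 1 * d1 x (axis j 1) $ 1 + d1 x (axis i 1) $ 2 * d1 x (axis j 1) $ 2
      + height' i x * height' j x"
    by (simp add: gram_def height'_def inner_vec_def sum_3)
  show ?thesis
    using horizontal[OF x, of "axis i 1"] horizontal[OF x, of "axis j 1"] radius[OF x]
    unfolding g a height'_def[symmetric] by algebra
qed

abbreviation area_form :: "real^2 \<Rightarrow> real" where
  "area_form x \<equiv> height' 1 x * angular 2 x - height' 2 x * angular 1 x"

text \<open>Determinants in \<open>gram_height_angular\<close> show that the square of the area form
  is (1 - z^2)^2 times the Gram determinant.\<close>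

lemma area_form_nonzero:
  assumes x: "x \<in> Vr"
  shows "area_form x \<noteq> 0"
proof -
  have "(1 - (height x)\<^sup>2)\<^sup>2 * gram_det x
    = ((1 - (height x)\<^sup>2) * gram x 1 1) * ((1 - (height x)\<^sup>2) * gram x 2 2) - ((1 - (height x)\<^sup>2) * gram x 1 2)\<^sup>2"
    by (simp add: gram_det_def power2_eq_square algebra_simps)
  also have "\<dots> = (area_form x)\<^sup>2"
    unfolding gram_height_angular[OF Vr_V[OF x]] by (simp add: power2_eq_square algebra_simps)
  finally show ?thesis using gram_det_pos[OF Vr_V[OF x]] s2_pos[OF x] by auto
qed

text \<open>By skewness of \<open>vf\<close> each expression is, up to sign, half of the exterior
  derivative of \<psi>, so d\<psi> = -2 z/(1 - z^2) dz \<and> \<psi>.\<close>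

lemma angular_exterior_derivative:
  assumes x: "x \<in> Vr"
  shows "vf (d1 x (axis 1 1)) \<bullet> d1 x (axis 2 1) = - height x * (iz x)\<^sup>2 * area_form x"
    and "vf (d1 x (axis 2 1)) \<bullet> d1 x (axis 1 1) = height x * (iz x)\<^sup>2 * area_form x"
proof -
  have a: "angular k x = \<phi> x $ 1 * d1 x (axis k 1) $ 2 - \<phi> x $ 2 * d1 x (axis k 1) $ 1" for k
    by (simp add: angular_def vf_def inner_vec_def sum_3)
  have v: "vf (d1 x (axis 1 1)) \<bullet> d1 x (axis 2 1)
      = d1 x (axis 1 1) $ 1 * d1 x (axis 2 1) $ 2 - d1 x (axis 1 1) $ 2 * d1 x (axis 2 1) $ 1"
    by (simp add: vf_def inner_vec_def sum_3)
  have "(1 - (height x)\<^sup>2) * (vf (d1 x (axis 1 1)) \<bullet> d1 x (axis 2 1)) = - height x * area_form x"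
    using horizontal[OF Vr_V[OF x], of "axis 1 1"] horizontal[OF Vr_V[OF x], of "axis 2 1"] radius[OF Vr_V[OF x]]
    unfolding v a height'_def[symmetric] by algebra
  then show 1: "vf (d1 x (axis 1 1)) \<bullet> d1 x (axis 2 1) = - height x * (iz x)\<^sup>2 * area_form x"
    using iz_square[OF x] by algebra
  have "vf (d1 x (axis 2 1)) \<bullet> d1 x (axis 1 1) = - (vf (d1 x (axis 1 1)) \<bullet> d1 x (axis 2 1))"
    using vf_antisym[of "d1 x (axis 2 1)" "d1 x (axis 1 1)"] by (simp add: inner_commute)
  then show "vf (d1 x (axis 2 1)) \<bullet> d1 x (axis 1 1) = height x * (iz x)\<^sup>2 * area_form x"
    unfolding 1 by simp
qed

lemma frame_metric:
  assumes x: "x \<in> Vr"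
  shows "metric_coeff ac x $ i $ j = frame i x \<bullet> frame j x"
proof -
  have v: "vf (\<phi> x) \<bullet> vf (\<phi> x) = 1 - (height x)\<^sup>2"
    using vf_norm_sphere[OF phi_unit[OF Vr_V[OF x]]] by (simp add: height_def)
  let ?e = "\<epsilon>\<^sup>2" and ?s = "1 - (height x)\<^sup>2" and ?P = "(iz x)\<^sup>2" and ?R = "(ir x)\<^sup>2"
  have r: "1 - ?e * ?s \<noteq> 0" using r2_pos[OF Vr_V[OF x]] by simp
  have g: "gram x i j = ?P * (height' i x * height' j x + angular i x * angular j x)"
    using gram_height_angular[OF Vr_V[OF x], of i j] iz_square[OF x] by algebra
  have "metric_coeff ac x $ i $ j
      = (?e * angular i x * angular j x + (1 - ?e * ?s) * gram x i j) / (1 - ?e * ?s)\<^sup>2"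
    by (simp add: metric_coeff_eq[OF Vr_V[OF x]] alpha_form_def v angular_def gram_def)
  also have "\<dots> = ?P * ?R * height' i x * height' j x + ?P * ?R\<^sup>2 * angular i x * angular j x"
    unfolding g using iz_square[OF x] ir_square[OF Vr_V[OF x]] r
    by (subst nonzero_divide_eq_eq) (simp, algebra)
  also have "\<dots> = frame i x \<bullet> frame j x"
    by (simp add: frame_def inner_complex_def power2_eq_square algebra_simps)
  finally show ?thesis .
qed

lemma frame_area: "Im (cnj (frame 1 x) * frame 2 x) = (iz x)\<^sup>2 * (ir x)\<^sup>2 * ir x * area_form x"
  by (simp add: frame_def power2_eq_square algebra_simps)

lemma frame_derivative:
  assumes x: "x \<in> Vr"
  shows "frechet_derivative (frame k) (at x) d
    = (iz x * ir x * (((iz x)\<^sup>2 - \<epsilon>\<^sup>2 * (ir x)\<^sup>2) * height x * (d1 x d $ 3) * height' k x + d2 x (axis k 1) d $ 3)) *\<^sub>R 1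
    + (iz x * (ir x)\<^sup>2 * (((iz x)\<^sup>2 - 2 * \<epsilon>\<^sup>2 * (ir x)\<^sup>2) * height x * (d1 x d $ 3) * angular k x
        + vf (\<phi> x) \<bullet> d2 x (axis k 1) d + vf (d1 x d) \<bullet> d1 x (axis k 1))) *\<^sub>R \<i>"
proof -
  have "(frame k has_derivative (\<lambda>d.
    (iz x * ir x * (((iz x)\<^sup>2 - \<epsilon>\<^sup>2 * (ir x)\<^sup>2) * height x * (d1 x d $ 3) * height' k x + d2 x (axis k 1) d $ 3)) *\<^sub>R 1
    + (iz x * (ir x)\<^sup>2 * (((iz x)\<^sup>2 - 2 * \<epsilon>\<^sup>2 * (ir x)\<^sup>2) * height x * (d1 x d $ 3) * angular k x
        + vf (\<phi> x) \<bullet> d2 x (axis k 1) d + vf (d1 x d) \<bullet> d1 x (axis k 1))) *\<^sub>R \<i>)) (at x)"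
    unfolding frame_def[abs_def]
    by (rule has_derivative_eq_rhs, (rule derivative_intros iz_derivative[OF x] ir_derivative[OF x]
          height'_derivative[OF Vr_V[OF x]] angular_derivative[OF Vr_V[OF x]])+)
      (simp add: fun_eq_iff complex_eq_iff power2_eq_square algebra_simps)
  from frechet_derivative_at[OF this, symmetric] show ?thesis by (rule fun_cong)
qed

lemma conn_form_derivative:
  assumes x: "x \<in> Vr"
  shows "pd j (conn_form k) x
    = - ((iz x)\<^sup>2 * (ir x)\<^sup>2 * ir x) *
      (((1 + \<epsilon>\<^sup>2 * (1 - (height x)\<^sup>2) - 2 * \<epsilon>\<^sup>2 * (height x)\<^sup>2)
         + (height x)\<^sup>2 * (1 + \<epsilon>\<^sup>2 * (1 - (height x)\<^sup>2)) * (2 * (iz x)\<^sup>2 - 3 * \<epsilon>\<^sup>2 * (ir x)\<^sup>2)) * height' j x * angular k x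
       + height x * (1 + \<epsilon>\<^sup>2 * (1 - (height x)\<^sup>2)) *
          (vf (\<phi> x) \<bullet> d2 x (axis k 1) (axis j 1) + vf (d1 x (axis j 1)) \<bullet> d1 x (axis k 1)))"
proof -
  have "(conn_form k has_derivative (\<lambda>d. - ((iz x)\<^sup>2 * (ir x)\<^sup>2 * ir x) *
      (((1 + \<epsilon>\<^sup>2 * (1 - (height x)\<^sup>2) - 2 * \<epsilon>\<^sup>2 * (height x)\<^sup>2)
         + (height x)\<^sup>2 * (1 + \<epsilon>\<^sup>2 * (1 - (height x)\<^sup>2)) * (2 * (iz x)\<^sup>2 - 3 * \<epsilon>\<^sup>2 * (ir x)\<^sup>2)) * (d1 x d $ 3) * angular k x
       + height x * (1 + \<epsilon>\<^sup>2 * (1 - (height x)\<^sup>2)) *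
          (vf (\<phi> x) \<bullet> d2 x (axis k 1) d + vf (d1 x d) \<bullet> d1 x (axis k 1))))) (at x)"
    unfolding conn_form_def[abs_def]
    by (rule has_derivative_eq_rhs, (rule derivative_intros iz_derivative[OF x] ir_derivative[OF x]
          height_derivative[OF Vr_V[OF x]] angular_derivative[OF Vr_V[OF x]])+)
      (simp add: fun_eq_iff power2_eq_square algebra_simps)
  from pd_eq[OF this] show ?thesis by (simp add: height'_def)
qed

lemma moving_frame_chart: "moving_frame Vr (metric_coeff ac) frame conn_form"
proof
  show "open Vr" "smooth_on Vr (frame i)" "smooth_on Vr (conn_form i)" for i
    by (rule open_Vr smooth_frame smooth_conn_form)+
  show "metric_coeff ac x $ i $ j = frame i x \<bullet> frame j x" if "x \<in> Vr" for x i j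
    by (rule frame_metric[OF that])
  fix x assume x: "x \<in> Vr"
  have nz: "iz x \<noteq> 0" "ir x \<noteq> 0" using iz_square[OF x] ir_square[OF Vr_V[OF x]] by auto
  then show "Im (cnj (frame 1 x) * frame 2 x) \<noteq> 0"
    unfolding frame_area using area_form_nonzero[OF x] by simp
  let ?e = "\<epsilon>\<^sup>2" and ?t = "height x" and ?P = "(iz x)\<^sup>2" and ?R = "(ir x)\<^sup>2"
  \<comment> \<open>Partial fractions, recovering the sum from which \<open>conn_form\<close> was
    obtained.\<close>
  have PR: "?P * ?R * (1 + ?e * (1 - ?t\<^sup>2)) = ?P + 2 * ?e * ?R"
    using iz_square[OF x] ir_square[OF Vr_V[OF x]] by algebra
  have sym: "d2 x (axis 2 1) (axis 1 1) = d2 x (axis 1 1) (axis 2 1)" by (rule d2_sym[OF Vr_V[OF x]])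
  show "frechet_derivative (frame 2) (at x) (axis 1 1) + conn_form 1 x *\<^sub>R (\<i> * frame 2 x)
      = frechet_derivative (frame 1) (at x) (axis 2 1) + conn_form 2 x *\<^sub>R (\<i> * frame 1 x)"
    (is "?l = ?r")
  proof (rule complex_eqI)
    \<comment> \<open>The real part of the frame is a function of the height times dz, hence closed,
      and \<open>conn_form\<close> is proportional to the imaginary part.\<close>
    show "Re ?l = Re ?r"
      unfolding frame_derivative[OF x] sym height'_def[symmetric] frame_def conn_form_def
      by (simp only: plus_complex.sel scaleR_complex.sel times_complex.sel one_complex.sel imaginary_unit.sel)
        algebra
    \<comment> \<open>The bracket collects the logarithmic derivative of iz ir^2, namely z (P - 2
      \<epsilon>^2 R), and the -2 z P from d\<psi>.\<close>
    have "iz x * (ir x)\<^sup>2 * height x * area_form x * (?P - 2 * ?e * ?R - 2 * ?P)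
        + height x * (?P * ?R * (1 + ?e * (1 - ?t\<^sup>2))) * ir x * iz x * ir x * area_form x = 0"
      unfolding PR by algebra
    then show "Im ?l = Im ?r"
      unfolding frame_derivative[OF x] sym angular_exterior_derivative[OF x] height'_def[symmetric]
        frame_def conn_form_def
      by (simp only: plus_complex.sel scaleR_complex.sel times_complex.sel one_complex.sel imaginary_unit.sel)
        algebra
  qed
qed

lemma gauss_in_coords_regular:
  assumes x: "x \<in> Vr"
  shows "gauss_in_coords ac x = gauss_profile \<epsilon> (height x)"
proof -
  interpret mf: moving_frame Vr "metric_coeff ac" frame conn_form by (rule moving_frame_chart)
  let ?e = "\<epsilon>\<^sup>2" and ?t = "height x" and ?P = "(iz x)\<^sup>2" and ?R = "(ir x)\<^sup>2"
  have nz: "iz x \<noteq> 0" "ir x \<noteq> 0" using iz_square[OF x] ir_square[OF Vr_V[OF x]] by auto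
  have sym: "d2 x (axis 2 1) (axis 1 1) = d2 x (axis 1 1) (axis 2 1)" by (rule d2_sym[OF Vr_V[OF x]])
  \<comment> \<open>The derivative of iz^2 cancels against d\<psi>, because iz^2 \<psi> is the
    closed form of the longitude.\<close>
  have "- (pd 1 (conn_form 2) x - pd 2 (conn_form 1) x)
      = (?P * ?R * ir x * area_form x) * (1 + ?e * (1 - ?t\<^sup>2) - 2 * ?e * ?t\<^sup>2 - 3 * ?e * ?t\<^sup>2 * (1 + ?e * (1 - ?t\<^sup>2)) * ?R)"
    unfolding conn_form_derivative[OF x] sym angular_exterior_derivative[OF x] by algebra
  then have "gauss_in_coords ac x
      = 1 + ?e * (1 - ?t\<^sup>2) - 2 * ?e * ?t\<^sup>2 - 3 * ?e * ?t\<^sup>2 * (1 + ?e * (1 - ?t\<^sup>2)) * ?R"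
    using area_form_nonzero[OF x] nz
    unfolding gauss_in_coords_def Let_def mf.frame_gauss[OF x] frame_area by simp
  moreover have "1 - ?e * (1 - ?t\<^sup>2) \<noteq> 0" using r2_pos[OF Vr_V[OF x]] by simp
  ultimately show ?thesis
    unfolding gauss_profile_def using ir_square[OF Vr_V[OF x]]
    by (subst nonzero_eq_divide_eq) (simp, algebra)
qed

lemma inj_on_phi: "inj_on \<phi> V"
  using coords unfolding local_coords_def homeomorphism_def by (metis inj_on_inverseI)

text \<open>The chart is injective and height 1 or -1 occurs only at the two poles; so the excluded
  points are isolated.\<close>

lemma finite_poles: "finite (V - Vr)"
proof (rule inj_on_finite[OF inj_on_subset[OF inj_on_phi], of "V - Vr" "{axis 3 1, - axis 3 1}"])
  show "\<phi> ` (V - Vr) \<subseteq> {axis 3 1, - axis 3 1}"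
  proof (rule image_subsetI)
    fix x assume x: "x \<in> V - Vr"
    then have "(\<phi> x $ 1)\<^sup>2 + (\<phi> x $ 2)\<^sup>2 \<le> 0" "(height x)\<^sup>2 \<ge> 1"
      using radius[of x] by (auto simp: Vr_def)
    then have 0: "\<phi> x $ 1 = 0" "\<phi> x $ 2 = 0"
      by (auto simp: sum_power2_le_zero_iff)
    then have "(height x)\<^sup>2 = 1" using radius[of x] x by simp
    then show "\<phi> x \<in> {axis 3 1, - axis 3 1}"
      using 0 by (auto simp: vec_eq_iff forall_3 axis_def height_def power2_eq_1_iff)
  qed
qed auto

lemma gauss_in_coords_eq:
  assumes x: "x \<in> V"
  shows "gauss_in_coords ac x = gauss_profile \<epsilon> (\<phi> x $ 3)"
proof -
  define h where "h x = gauss_in_coords ac x - gauss_profile \<epsilon> (height x)" for x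
  have det: "det (metric_coeff ac x) \<noteq> 0" if "x \<in> V" for x
  proof -
    have "u = 0" if "metric_coeff ac x *v u = 0" for u
      using metric_coeff_quadratic[OF \<open>x \<in> V\<close>, of u] alpha_form_pos[OF lam_pos[OF \<open>x \<in> V\<close>], of "d1 x u"]
        d1_eq_0[OF \<open>x \<in> V\<close>, of u] that by fastforce
    then have "invertible (metric_coeff ac x)"
      by (simp add: invertible_left_inverse matrix_left_invertible_ker)
    then show ?thesis by (simp add: invertible_det_nz)
  qed
  have "smooth_on V (\<lambda>x. det (metric_coeff ac x))"
    unfolding det_2 by (intro smooth_intros_V smooth_metric_coeff)
  then have "smooth_on V (gauss_in_coords ac)"
    unfolding gauss_in_coords_def[abs_def] Let_def
    by (intro smooth_intros_V smooth_on_sum[OF open_V] smooth_on_curvature_tensor[OF open_V]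
        smooth_metric_coeff det)
  moreover have "smooth_on V (\<lambda>x. gauss_profile \<epsilon> (height x))"
    unfolding gauss_profile_def by (intro smooth_intros_V smooth_height) (use r2_pos in force)
  ultimately have "smooth_on V h" unfolding h_def[abs_def] by (intro smooth_on_diff open_V)
  then have "isCont h x"
    using smooth_on_continuous_on x open_V continuous_on_eq_continuous_at by blast
  then have "(h \<longlongrightarrow> h x) (at x)" by (simp add: isCont_def)
  moreover have "eventually (\<lambda>y. h y = 0) (at x)"
  proof -
    \<comment> \<open>Only the poles other than \<open>x\<close> are removed, so a punctured
      neighbourhood of \<open>x\<close> lies in \<open>Vr\<close>.\<close>
    have "open (V - (V - Vr - {x}))"
      by (intro open_Diff open_V finite_imp_closed finite_Diff finite_poles)
    then have "eventually (\<lambda>y. y \<in> V - (V - Vr - {x}) - {x}) (at x)"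
      using x by (intro eventually_at_in_open) auto
    then show ?thesis
      by eventually_elim (auto simp: h_def gauss_in_coords_regular)
  qed
  then have "(h \<longlongrightarrow> 0) (at x)" by (rule tendsto_eventually)
  ultimately have "h x = 0" using tendsto_unique[of "at x"] by fastforce
  then show ?thesis by (simp add: h_def height_def)
qed

end

subsection \<open>Existence of coordinates\<close>

text \<open>Without a chart at \<open>p\<close> every number would satisfy the condition under
  \<open>THE\<close> in \<open>gauss_curvature\<close>. The chart inverts the orthogonal projection
  of the hemisphere around \<open>p\<close> to its tangent plane, cut down to
  \<open>U_eps \<epsilon>\<close>.\<close>

lemma exists_local_coords:
  assumes "p \<in> U_eps \<epsilon>"
  shows "\<exists>(V::(real^2) set) \<phi> x. local_coords (U_eps \<epsilon>) V \<phi> \<and> x \<in> V \<and> \<phi> x = p"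
proof -
  have pp: "p \<bullet> p = 1"
    using assms by (auto simp: U_eps_def norm_eq_1)
  obtain S where S: "p \<in> S" "pairwise orthogonal S" "\<And>x. x \<in> S \<Longrightarrow> norm x = 1"
    "independent S" "card S = DIM(real^3)" "span S = UNIV"
    using vector_in_orthonormal_basis[of p] pp by (auto simp: norm_eq_1)
  have "finite S" "card (S - {p}) = 2" using S(1,5) card_ge_0_finite[of S] by auto
  then obtain e e' where ee: "S - {p} = {e, e'}" "e \<noteq> e'" by (auto simp: card_2_iff)
  then have Seq: "S = {p, e, e'}" "p \<noteq> e" "p \<noteq> e'" using S(1) by auto
  have o: "e \<bullet> e = 1" "e' \<bullet> e' = 1" "e \<bullet> e' = 0" "e' \<bullet> e = 0" "e \<bullet> p = 0" "p \<bullet> e = 0" "e' \<bullet> p = 0" "p \<bullet> e' = 0"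
    using S(2,3) ee Seq by (auto simp: pairwise_def orthogonal_def norm_eq_1)
  have expand: "(q \<bullet> p) *\<^sub>R p + (q \<bullet> e) *\<^sub>R e + (q \<bullet> e') *\<^sub>R e' = q" for q
    using orthonormal_basis_expand[OF S(2,3) _ \<open>finite S\<close>, of q] ee Seq S(6) by (simp add: add.assoc)
  define \<phi> :: "real^2 \<Rightarrow> real^3" where
    "\<phi> x = x $ 1 *\<^sub>R e + x $ 2 *\<^sub>R e' + sqrt (1 - x \<bullet> x) *\<^sub>R p" for x
  define \<psi> :: "real^3 \<Rightarrow> real^2" where "\<psi> q = (\<chi> i. if i = 1 then q \<bullet> e else q \<bullet> e')" for q
  define V0 :: "(real^2) set" where "V0 = {x. x \<bullet> x < 1}"
  define V where "V = V0 \<inter> (\<lambda>x. \<epsilon>\<^sup>2 * (vf (\<phi> x) \<bullet> vf (\<phi> x))) -` {..<1}"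
  have "open V0" unfolding V0_def by (intro open_Collect_less continuous_intros)
  have "smooth_on V0 (\<lambda>x. x $ i)" for i
    by (intro smooth_on_linear \<open>open V0\<close> bounded_linear_vec_nth)
  moreover have "smooth_on V0 (\<lambda>x. sqrt (1 - x \<bullet> x))"
    by (intro smooth_on_sqrt smooth_on_diff smooth_on_inner smooth_on_const
        smooth_on_linear[OF _ bounded_linear_ident] \<open>open V0\<close>) (auto simp: V0_def)
  ultimately have s0: "smooth_on V0 \<phi>"
    unfolding \<phi>_def[abs_def] by (intro smooth_on_add smooth_on_scaleR smooth_on_const \<open>open V0\<close>)
  have oV: "open V"
  proof -
    have "smooth_on V0 (\<lambda>x. \<epsilon>\<^sup>2 * (vf (\<phi> x) \<bullet> vf (\<phi> x)))"
      by (intro smooth_on_mult smooth_on_const smooth_on_inner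
          smooth_on_bounded_linear[OF _ bounded_linear_vf] s0 \<open>open V0\<close>)
    then show ?thesis unfolding V_def
      by (intro continuous_open_preimage smooth_on_continuous_on \<open>open V0\<close> open_lessThan)
  qed
  have sV: "smooth_on V \<phi>"
    by (rule smooth_on_subset[OF oV _ s0]) (auto simp: V_def)
  have xx: "x \<bullet> x = (x $ 1)\<^sup>2 + (x $ 2)\<^sup>2" for x :: "real^2"
    by (simp add: inner_vec_def sum_2 power2_eq_square)
  have unit: "\<phi> x \<bullet> \<phi> x = 1" "\<phi> x \<bullet> p > 0" if "x \<in> V0" for x
  proof -
    have "\<phi> x \<bullet> \<phi> x = (x $ 1)\<^sup>2 + (x $ 2)\<^sup>2 + (sqrt (1 - x \<bullet> x))\<^sup>2"
      by (simp add: \<phi>_def inner_add_left inner_add_right o pp power2_eq_square)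
    then show "\<phi> x \<bullet> \<phi> x = 1" using that by (simp add: V0_def xx)
    show "\<phi> x \<bullet> p > 0" using that by (simp add: \<phi>_def inner_add_left o pp V0_def)
  qed
  have psi: "\<psi> (\<phi> x) = x" for x
    by (simp add: \<psi>_def \<phi>_def inner_add_left o pp vec_eq_iff forall_2)
  have phi_psi: "\<phi> (\<psi> q) = q \<and> \<psi> q \<in> V0" if "q \<bullet> q = 1" "q \<bullet> p > 0" for q
  proof -
    have "q \<bullet> q = ((q \<bullet> p) *\<^sub>R p + (q \<bullet> e) *\<^sub>R e + (q \<bullet> e') *\<^sub>R e') \<bullet> ((q \<bullet> p) *\<^sub>R p + (q \<bullet> e) *\<^sub>R e + (q \<bullet> e') *\<^sub>R e')"
      by (simp only: expand)
    also have "\<dots> = (q \<bullet> p)\<^sup>2 + (q \<bullet> e)\<^sup>2 + (q \<bullet> e')\<^sup>2"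
      by (simp add: inner_add_left inner_add_right o pp power2_eq_square)
    finally have 1: "1 - \<psi> q \<bullet> \<psi> q = (q \<bullet> p)\<^sup>2" using that by (simp add: xx \<psi>_def)
    then have "\<psi> q \<in> V0" using that(2) by (simp add: V0_def) (smt (verit) zero_less_power2)
    moreover have "\<phi> (\<psi> q) = q"
      using expand[of q] that(2) unfolding \<phi>_def 1 by (simp add: \<psi>_def algebra_simps)
    ultimately show ?thesis by simp
  qed
  have im: "\<phi> ` V = U_eps \<epsilon> \<inter> {q. q \<bullet> p > 0}"
  proof (intro equalityI subsetI)
    fix q assume "q \<in> \<phi> ` V"
    then show "q \<in> U_eps \<epsilon> \<inter> {q. q \<bullet> p > 0}"
      using unit by (auto simp: V_def U_eps_def norm_eq_1)
  next
    fix q assume "q \<in> U_eps \<epsilon> \<inter> {q. q \<bullet> p > 0}"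
    then have q: "q \<bullet> q = 1" "q \<bullet> p > 0" "\<epsilon>\<^sup>2 * (vf q \<bullet> vf q) < 1" by (auto simp: U_eps_def norm_eq_1)
    then have "\<psi> q \<in> V" using phi_psi[OF q(1,2)] by (simp add: V_def)
    then show "q \<in> \<phi> ` V" using phi_psi[OF q(1,2)] by (metis imageI)
  qed
  have blpsi: "bounded_linear \<psi>"
    unfolding linear_conv_bounded_linear[symmetric]
    by (rule linearI) (auto simp: \<psi>_def vec_eq_iff inner_add_left)
  have "inj (frechet_derivative \<phi> (at x))" if "x \<in> V" for x
  proof -
    note D = smooth_on_has_derivative[OF sV that]
    \<comment> \<open>The linear map \<open>\<psi>\<close> is its own derivative, so differentiating
      \<open>psi\<close> gives a left inverse of the differential.\<close>
    have "\<psi> (frechet_derivative \<phi> (at x) d) = d" for d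
      using has_derivative_eq_on[OF oV that psi bounded_linear.has_derivative[OF blpsi D] has_derivative_ident] .
    then show ?thesis by (metis injI)
  qed
  moreover have "openin (top_of_set (U_eps \<epsilon>)) (\<phi> ` V)"
    unfolding im by (intro openin_open_Int open_Collect_less continuous_intros)
  moreover have "homeomorphism V (\<phi> ` V) \<phi> \<psi>"
    by (rule homeomorphismI)
      (auto simp: psi smooth_on_continuous_on[OF sV] linear_continuous_on[OF blpsi])
  ultimately have "local_coords (U_eps \<epsilon>) V \<phi>"
    unfolding local_coords_def using oV sV im by blast
  moreover have "p \<in> \<phi> ` V" unfolding im using assms pp by simp
  ultimately show ?thesis by blast
qed

lemma gauss_curvature_eq:
  assumes "p \<in> U_eps \<epsilon>"
  shows "gauss_curvature (U_eps \<epsilon>) (alpha \<epsilon>) p = gauss_profile \<epsilon> (p $ 3)"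
proof -
  have *: "gauss_in_coords (in_coords (alpha \<epsilon>) \<phi>) x = gauss_profile \<epsilon> (\<phi> x $ 3)"
    if "local_coords (U_eps \<epsilon>) V \<phi>" "x \<in> V" for V :: "(real^2) set" and \<phi> x
  proof -
    interpret sphere_chart \<epsilon> V \<phi> using that(1) by unfold_locales
    show ?thesis by (rule gauss_in_coords_eq[OF that(2)])
  qed
  obtain V :: "(real^2) set" and \<phi> x where c: "local_coords (U_eps \<epsilon>) V \<phi>" "x \<in> V" "\<phi> x = p"
    using exists_local_coords[OF assms] by blast
  show ?thesis
    unfolding gauss_curvature_def
  proof (rule the_equality)
    show "\<forall>(V::(real^2) set) \<phi> x. local_coords (U_eps \<epsilon>) V \<phi> \<longrightarrow> x \<in> V \<longrightarrow> \<phi> x = p \<longrightarrow>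
        gauss_in_coords (in_coords (alpha \<epsilon>) \<phi>) x = gauss_profile \<epsilon> (p $ 3)"
      using * by blast
  next
    fix K assume "\<forall>(V::(real^2) set) \<phi> x. local_coords (U_eps \<epsilon>) V \<phi> \<longrightarrow> x \<in> V \<longrightarrow> \<phi> x = p \<longrightarrow>
        gauss_in_coords (in_coords (alpha \<epsilon>) \<phi>) x = K"
    then show "K = gauss_profile \<epsilon> (p $ 3)" using c *[OF c(1,2)] by metis
  qed
qed

lemma gauss_curvature_not_constant:
  assumes "\<epsilon> \<notin> {0, 1, -1}"
  shows "\<not> gauss_curvature (U_eps \<epsilon>) (alpha \<epsilon>) constant_on U_eps \<epsilon>"
proof
  assume const: "gauss_curvature (U_eps \<epsilon>) (alpha \<epsilon>) constant_on U_eps \<epsilon>"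
  define e where "e = \<epsilon>\<^sup>2"
  have e: "e > 0" "e \<noteq> 1" using assms by (auto simp: e_def power2_eq_1_iff)
  \<comment> \<open>A value of 1 - z^2 with 0 < t and e t < 1 whatever the size of e; it is compared
    with the north pole, where 1 - z^2 = 0.\<close>
  define t where "t = 1 / (1 + e)"
  have t: "0 < t" "t \<le> 1" "t * (1 + e) = 1" using e by (simp_all add: t_def)
  define p :: "real^3" where "p = vector [sqrt t, 0, sqrt (1 - t)]"
  have p3: "(p $ 3)\<^sup>2 = 1 - t" using t by (simp add: p_def)
  have "p \<bullet> p = 1" using t by (simp add: p_def inner_vec_def sum_3)
  moreover have "e * t < 1" using t e by (simp add: algebra_simps)
  ultimately have p: "p \<in> U_eps \<epsilon>" by (simp add: U_eps_iff p3 e_def)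
  have n: "axis 3 (1::real) \<in> U_eps \<epsilon>" by (simp add: U_eps_iff inner_axis_axis)
  have "gauss_profile \<epsilon> (p $ 3) = gauss_profile \<epsilon> ((axis 3 1 :: real^3) $ 3)"
    using const p n gauss_curvature_eq[OF p] gauss_curvature_eq[OF n] unfolding constant_on_def by metis
  moreover have "\<epsilon> ^ 4 = e\<^sup>2" by (simp add: e_def)
  ultimately have "(1 - 5 * e + (5 * e - e\<^sup>2) * t) / (1 - e * t) = 1 - 5 * e"
    by (simp add: gauss_profile_def p3 e_def[symmetric])
  then have "1 - 5 * e + (5 * e - e\<^sup>2) * t = (1 - 5 * e) * (1 - e * t)"
    using \<open>e * t < 1\<close> by (simp add: divide_eq_eq)
  \<comment> \<open>The difference of the two sides, which factors and shows why exactly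
    \<epsilon>^2 = 0 and \<epsilon>^2 = 1 are exceptional.\<close>
  then have "6 * e * t * (1 - e) = 0" by algebra
  then show False using e t by simp
qed

lemma gauss_profile_values:
  shows "gauss_profile 0 t = 1"
    and "\<epsilon>\<^sup>2 = 1 \<Longrightarrow> t \<noteq> 0 \<Longrightarrow> gauss_profile \<epsilon> t = -4"
proof -
  show "gauss_profile 0 t = 1" by (simp add: gauss_profile_def)
  assume "\<epsilon>\<^sup>2 = 1" "t \<noteq> 0"
  moreover have "\<epsilon> ^ 4 = (\<epsilon>\<^sup>2)\<^sup>2" by simp
  ultimately show "gauss_profile \<epsilon> t = -4" by (simp add: gauss_profile_def divide_eq_eq)
qed

theorem theorem1p1:
  fixes \<epsilon> :: real
  shows "(\<bar>\<epsilon>\<bar> < 1 \<longrightarrow> U_eps \<epsilon> = sphere 0 1) \<and>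
    (\<bar>\<epsilon>\<bar> \<ge> 1 \<longrightarrow> U_eps \<epsilon> = sphere_disk (vector [0, 0, 1]) (arcsin (1 / \<bar>\<epsilon>\<bar>))
                        \<union> sphere_disk (vector [0, 0, -1]) (arcsin (1 / \<bar>\<epsilon>\<bar>))) \<and>
    randers_metric (U_eps \<epsilon>) (alpha \<epsilon>) (beta \<epsilon>) \<and>
    constant_flag_curvature (U_eps \<epsilon>) (F_eps \<epsilon>) 1 \<and>
    vanishing_S_curvature (U_eps \<epsilon>) (F_eps \<epsilon>) \<and>
    (\<epsilon> \<noteq> 0 \<longrightarrow> \<not> locally_projectively_flat (U_eps \<epsilon>) (F_eps \<epsilon>)) \<and>
    (\<epsilon> \<notin> {0, 1, -1} \<longrightarrow> \<not> gauss_curvature (U_eps \<epsilon>) (alpha \<epsilon>) constant_on U_eps \<epsilon>) \<and>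
    (\<epsilon> = 0 \<longrightarrow> (\<forall>p\<in>U_eps \<epsilon>. gauss_curvature (U_eps \<epsilon>) (alpha \<epsilon>) p = 1)) \<and>
    (\<epsilon> \<in> {1, -1} \<longrightarrow> (\<forall>p\<in>U_eps \<epsilon>. gauss_curvature (U_eps \<epsilon>) (alpha \<epsilon>) p = -4))"
proof (intro conjI impI)
  show "\<bar>\<epsilon>\<bar> < 1 \<Longrightarrow> U_eps \<epsilon> = sphere 0 1" by (rule U_eps_eq_sphere)
  show "\<bar>\<epsilon>\<bar> \<ge> 1 \<Longrightarrow> U_eps \<epsilon> = sphere_disk (vector [0, 0, 1]) (arcsin (1 / \<bar>\<epsilon>\<bar>))
      \<union> sphere_disk (vector [0, 0, -1]) (arcsin (1 / \<bar>\<epsilon>\<bar>))"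
    by (rule U_eps_eq_disks)
  show "randers_metric (U_eps \<epsilon>) (alpha \<epsilon>) (beta \<epsilon>)" by (rule randers_metric_alpha_beta)
  show "constant_flag_curvature (U_eps \<epsilon>) (F_eps \<epsilon>) 1" by (rule constant_flag_curvature_F_eps)
  show "vanishing_S_curvature (U_eps \<epsilon>) (F_eps \<epsilon>)" by (rule vanishing_S_curvature_F_eps)
  show "\<epsilon> \<noteq> 0 \<Longrightarrow> \<not> locally_projectively_flat (U_eps \<epsilon>) (F_eps \<epsilon>)"
    by (rule not_locally_projectively_flat_F_eps)
  show "\<epsilon> \<notin> {0, 1, -1} \<Longrightarrow> \<not> gauss_curvature (U_eps \<epsilon>) (alpha \<epsilon>) constant_on U_eps \<epsilon>"
    by (rule gauss_curvature_not_constant)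
  show "\<forall>p\<in>U_eps \<epsilon>. gauss_curvature (U_eps \<epsilon>) (alpha \<epsilon>) p = 1" if "\<epsilon> = 0"
    using that by (auto simp: gauss_curvature_eq gauss_profile_values(1))
  show "\<forall>p\<in>U_eps \<epsilon>. gauss_curvature (U_eps \<epsilon>) (alpha \<epsilon>) p = -4" if "\<epsilon> \<in> {1, -1}"
  proof
    fix p assume p: "p \<in> U_eps \<epsilon>"
    have "\<epsilon>\<^sup>2 = 1" using that by auto
    \<comment> \<open>For \<epsilon>^2 = 1 the domain omits the equator, where the denominator z^2
      of the profile would vanish.\<close>
    moreover have "p $ 3 \<noteq> 0" using p \<open>\<epsilon>\<^sup>2 = 1\<close> by (auto simp: U_eps_iff)
    ultimately show "gauss_curvature (U_eps \<epsilon>) (alpha \<epsilon>) p = -4"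
      unfolding gauss_curvature_eq[OF p] by (rule gauss_profile_values(2))
  qed
qed

end
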